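(* Let $\alpha$ be an integer with $\alpha\notin\{0,1,2\}$, $v_3(\alpha-1)=1$ and $(\alpha-1)/3\equiv -1\bmod 3$, and let $J$ be the Sylow $3$-subgroup of the Macdonald group $G(\alpha)$, with elements $A,B,C\in J$ as defined in the context. Then: (a) $Z_5(J)=\langle A^3,B^3,C^3\rangle=J^3$, and $J/Z_5(J)\cong\mathrm{Heis}(\mathbb{Z}/3\mathbb{Z})$. (b) The group $Z_3(J)=\langle A^9,B^9,C^9\rangle=J^9$ is abelian of exponent $9$, and $Z_5(J)/Z_3(J)\cong(\mathbb{Z}/3\mathbb{Z})^3$. (c) $Z(J)=\langle A^{27}\rangle=J^{27}$, and the exponent of $J$ is equal to $81$.
   Context: For elements $a,b$ of a group, $[a,b]=a^{-1}b^{-1}ab$ and $b^a=a^{-1}ba$. For a group $T$, $Z_0(T)=1$ and $Z_{i+1}(T)/Z_i(T)$ is the center of $T/Z_i(T)$; for $n\in\mathbb{Z}$, $T^n$ denotes the subgroup of $T$ generated by all $t^n$, $t\in T$. $\mathrm{Heis}(R)$ is the Heisenberg group over the ring $R$ (upper unitriangular $3\times 3$ matrices over $R$). The Macdonald group is $G(\alpha)=\langle A,B\mid A^{[A,B]}=A^\alpha,\ B^{[B,A]}=B^\alpha\rangle$; for $\alpha\notin\{0,1,2\}$ it is finite and nilpotent, hence the direct product of its Sylow subgroups. By abuse of notation $A,B\in J$ denote the images of the two generators of $G(\alpha)$ under the projection $G(\alpha)\to J$ (so $A,B$ generate $J$), and $C=[A,B]\in J$. $v_3$ denotes the $3$-adic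 valuation. *)

theory Defs
  imports
    "HOL-Analysis.Analysis"
    "HOL-Algebra.Elementary_Groups"
    "HOL-Number_Theory.Cong"
begin

section \<open>Group-theoretic notions\<close>

definition conjugate :: "('a, 'b) monoid_scheme \<Rightarrow> 'a \<Rightarrow> 'a \<Rightarrow> 'a"
  where "conjugate G b a = inv\<^bsub>G\<^esub> a \<otimes>\<^bsub>G\<^esub> b \<otimes>\<^bsub>G\<^esub> a"

definition commutator :: "('a, 'b) monoid_scheme \<Rightarrow> 'a \<Rightarrow> 'a \<Rightarrow> 'a"
  where "commutator G a b = inv\<^bsub>G\<^esub> a \<otimes>\<^bsub>G\<^esub> inv\<^bsub>G\<^esub> b \<otimes>\<^bsub>G\<^esub> a \<otimes>\<^bsub>G\<^esub> b"

definition center :: "('a, 'b) monoid_scheme \<Rightarrow> 'a set"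
  where "center G = {z \<in> carrier G. \<forall>x \<in> carrier G. z \<otimes>\<^bsub>G\<^esub> x = x \<otimes>\<^bsub>G\<^esub> z}"

fun upper_central :: "('a, 'b) monoid_scheme \<Rightarrow> nat \<Rightarrow> 'a set" where
  "upper_central G 0 = {\<one>\<^bsub>G\<^esub>}"
| "upper_central G (Suc i) =
     {x \<in> carrier G. upper_central G i #>\<^bsub>G\<^esub> x \<in> center (G Mod upper_central G i)}"

definition power_subgroup :: "('a, 'b) monoid_scheme \<Rightarrow> int \<Rightarrow> 'a set"
  where "power_subgroup G n = generate G {t [^]\<^bsub>G\<^esub> n | t. t \<in> carrier G}"

text \<open>The value is 0 when no positive exponent exists.\<close>

definition group_exponent :: "('a, 'b) monoid_scheme \<Rightarrow> nat"
  where "group_exponent G =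
    (let P = (\<lambda>n::nat. n > 0 \<and> (\<forall>x \<in> carrier G. x [^]\<^bsub>G\<^esub> n = \<one>\<^bsub>G\<^esub>))
     in if \<exists>n. P n then LEAST n. P n else 0)"

text \<open>Since \<open>order G = 0\<close> for infinite \<open>G\<close>, the condition \<open>\<not> p dvd m\<close> makes
  this a notion for finite groups only.\<close>

definition sylow_subgroup :: "('a, 'b) monoid_scheme \<Rightarrow> nat \<Rightarrow> 'a set \<Rightarrow> bool"
  where "sylow_subgroup G p P \<longleftrightarrow>
    subgroup P G \<and> (\<exists>a m. order G = p ^ a * m \<and> \<not> p dvd m \<and> card P = p ^ a)"

text \<open>For \<open>G\<close> the internal direct product of its Sylow subgroups, this says that \<open>\<pi>\<close> is
  the projection onto the factor \<open>P\<close>: the identity on \<open>P\<close> and trivial on every other factor.\<close>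

definition sylow_projection ::
    "('a, 'b) monoid_scheme \<Rightarrow> nat \<Rightarrow> 'a set \<Rightarrow> ('a \<Rightarrow> 'a) \<Rightarrow> bool"
  where "sylow_projection G p P \<pi> \<longleftrightarrow>
    \<pi> \<in> hom G (G\<lparr>carrier := P\<rparr>) \<and>
    (\<forall>x \<in> P. \<pi> x = x) \<and>
    (\<forall>q Q. prime q \<and> q \<noteq> p \<and> sylow_subgroup G q Q \<longrightarrow> (\<forall>x \<in> Q. \<pi> x = \<one>\<^bsub>G\<^esub>))"


section \<open>The Heisenberg group\<close>

text \<open>Entries are given one by one because \<open>3 = 0\<close> in the index type \<open>3\<close>, so its
  order is not the order \<open>1, 2, 3\<close> of rows and columns. As a coefficient ring, the type
  \<open>3\<close> is the ring of integers modulo 3.\<close>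

definition heis :: "('a::comm_ring_1 ^ 3 ^ 3) monoid"
  where "heis =
    \<lparr>carrier = {M. M $ 1 $ 1 = 1 \<and> M $ 2 $ 2 = 1 \<and> M $ 3 $ 3 = 1 \<and>
                   M $ 2 $ 1 = 0 \<and> M $ 3 $ 1 = 0 \<and> M $ 3 $ 2 = 0},
     mult = (**), one = mat 1\<rparr>"


section \<open>Free groups\<close>

text \<open>A letter \<open>(g, True)\<close> stands for the generator \<open>g\<close> and \<open>(g, False)\<close> for its inverse.\<close>

type_synonym 'g word = "('g \<times> bool) list"

inductive word_eq :: "'g word \<Rightarrow> 'g word \<Rightarrow> bool" where
  refl: "word_eq u u"
| sym: "word_eq u v \<Longrightarrow> word_eq v u"
| trans: "word_eq u v \<Longrightarrow> word_eq v w \<Longrightarrow> word_eq u w"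
| cancel: "word_eq (u @ [(g, b), (g, \<not> b)] @ v) (u @ v)"

definition word_class :: "'g word \<Rightarrow> 'g word set"
  where "word_class u = {v. word_eq u v}"

definition free_group :: "'g word set monoid"
  where "free_group =
    \<lparr>carrier = range word_class,
     mult = (\<lambda>U V. \<Union>u \<in> U. \<Union>v \<in> V. word_class (u @ v)),
     one = word_class []\<rparr>"

definition free_gen :: "'g \<Rightarrow> 'g word set"
  where "free_gen g = word_class [(g, True)]"

lemma word_class_eq_iff: "word_class u = word_class v \<longleftrightarrow> word_eq u v"
proof
  assume "word_class u = word_class v"
  then have "v \<in> word_class u" by (simp add: word_class_def word_eq.refl)
  then show "word_eq u v" by (simp add: word_class_def)
next
  assume uv: "word_eq u v"
  have "word_eq u w \<longleftrightarrow> word_eq v w" for w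
    using uv word_eq.sym[OF uv] by (blast intro: word_eq.trans)
  then show "word_class u = word_class v" by (simp add: word_class_def)
qed

lemma word_eq_append_left: "word_eq u v \<Longrightarrow> word_eq (w @ u) (w @ v)"
proof (induction rule: word_eq.induct)
  case (cancel u g b v)
  show ?case using word_eq.cancel[of "w @ u" g b v] by simp
qed (fact word_eq.refl, rule word_eq.sym, assumption, rule word_eq.trans)

lemma word_eq_append_right: "word_eq u v \<Longrightarrow> word_eq (u @ w) (v @ w)"
proof (induction rule: word_eq.induct)
  case (cancel u g b v)
  show ?case using word_eq.cancel[of u g b "v @ w"] by simp
qed (fact word_eq.refl, rule word_eq.sym, assumption, rule word_eq.trans)

lemma word_eq_append: "word_eq u u' \<Longrightarrow> word_eq v v' \<Longrightarrow> word_eq (u @ v) (u' @ v')"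
  by (meson word_eq.trans word_eq_append_left word_eq_append_right)

lemma free_group_mult:
  "word_class u \<otimes>\<^bsub>free_group\<^esub> word_class v = word_class (u @ v)"
proof -
  have eq: "word_class (u' @ v') = word_class (u @ v)"
    if "u' \<in> word_class u" "v' \<in> word_class v" for u' v'
    using that word_eq.sym[OF word_eq_append[of u u' v v']]
    unfolding word_class_eq_iff by (simp add: word_class_def)
  have ne: "word_class w \<noteq> {}" for w :: "'a word"
    unfolding word_class_def using word_eq.refl[of w] by blast
  have "(\<Union>v' \<in> word_class v. word_class (u' @ v')) = word_class (u @ v)"
    if "u' \<in> word_class u" for u'
    using ne eq[OF that] by (rule SUP_eq_const)
  with ne have "(\<Union>u' \<in> word_class u. \<Union>v' \<in> word_class v. word_class (u' @ v'))
      = word_class (u @ v)"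
    by (rule SUP_eq_const)
  then show ?thesis by (simp add: free_group_def)
qed

definition word_inv :: "'g word \<Rightarrow> 'g word"
  where "word_inv u = rev (map (\<lambda>(g, b). (g, \<not> b)) u)"

lemma word_eq_inv: "word_eq (word_inv u @ u) []"
proof (induction u)
  case (Cons l u)
  obtain g b where l: "l = (g, b)" by fastforce
  have "word_eq (word_inv u @ [(g, \<not> b), (g, \<not> \<not> b)] @ u) (word_inv u @ u)"
    by (rule word_eq.cancel)
  from word_eq.trans[OF this Cons.IH] show ?case
    by (simp add: word_inv_def l)
qed (auto simp: word_inv_def intro: word_eq.refl)

lemma free_group_is_group: "group (free_group :: 'g word set monoid)"
proof (rule groupI)
  fix x :: "'g word set" assume "x \<in> carrier free_group"
  then obtain u where u: "x = word_class u" by (auto simp: free_group_def)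
  have "word_class (word_inv u) \<otimes>\<^bsub>free_group\<^esub> x = \<one>\<^bsub>free_group\<^esub>"
    using word_eq_inv[of u]
    by (simp add: u free_group_mult) (simp add: free_group_def word_class_eq_iff)
  then show "\<exists>y \<in> carrier free_group. y \<otimes>\<^bsub>free_group\<^esub> x = \<one>\<^bsub>free_group\<^esub>"
    by (auto simp: free_group_def)
next
  fix x :: "'g word set" assume "x \<in> carrier free_group"
  then obtain u where u: "x = word_class u" by (auto simp: free_group_def)
  have "word_class [] \<otimes>\<^bsub>free_group\<^esub> x = x" by (simp add: u free_group_mult)
  then show "\<one>\<^bsub>free_group\<^esub> \<otimes>\<^bsub>free_group\<^esub> x = x" by (simp add: free_group_def)
next
  fix x y :: "'g word set"
  assume "x \<in> carrier free_group" "y \<in> carrier free_group"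
  then obtain u v where "x = word_class u" "y = word_class v" by (auto simp: free_group_def)
  then have "x \<otimes>\<^bsub>free_group\<^esub> y = word_class (u @ v)" by (simp add: free_group_mult)
  then show "x \<otimes>\<^bsub>free_group\<^esub> y \<in> carrier free_group" by (simp add: free_group_def)
next
  fix x y z :: "'g word set"
  assume "x \<in> carrier free_group" "y \<in> carrier free_group" "z \<in> carrier free_group"
  then obtain u v w where "x = word_class u" "y = word_class v" "z = word_class w"
    by (auto simp: free_group_def)
  then show "x \<otimes>\<^bsub>free_group\<^esub> y \<otimes>\<^bsub>free_group\<^esub> z = x \<otimes>\<^bsub>free_group\<^esub> (y \<otimes>\<^bsub>free_group\<^esub> z)"
    by (simp add: free_group_mult)
qed (simp add: free_group_def)

lemma free_gen_closed: "free_gen g \<in> carrier free_group"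
  by (simp add: free_gen_def free_group_def)

definition word_eval :: "('a, 'b) monoid_scheme \<Rightarrow> ('g \<Rightarrow> 'a) \<Rightarrow> 'g word \<Rightarrow> 'a"
  where "word_eval H f u =
    foldr (\<lambda>(g, b) x. (if b then f g else inv\<^bsub>H\<^esub> f g) \<otimes>\<^bsub>H\<^esub> x) u \<one>\<^bsub>H\<^esub>"

lemma free_group_universal:
  fixes H :: "('a, 'b) monoid_scheme" and f :: "'g \<Rightarrow> 'a"
  assumes "group H" and f: "\<And>g. f g \<in> carrier H"
  obtains h where "h \<in> hom free_group H" and "\<And>g. h (free_gen g) = f g"
proof -
  interpret H: group H by fact
  have closed: "word_eval H f u \<in> carrier H" for u
    by (induction u) (auto simp: word_eval_def f)
  have app: "word_eval H f (u @ v) = word_eval H f u \<otimes>\<^bsub>H\<^esub> word_eval H f v" for u v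
  proof (induction u)
    case Nil
    then show ?case using closed[of v] by (simp add: word_eval_def)
  next
    case (Cons l u)
    obtain g b where l: "l = (g, b)" by fastforce
    have cons: "word_eval H f ((g, b) # w) =
        (if b then f g else inv\<^bsub>H\<^esub> f g) \<otimes>\<^bsub>H\<^esub> word_eval H f w" for w
      by (simp add: word_eval_def)
    show ?case
      using Cons closed[of u] closed[of v] f[of g] by (simp add: l cons H.m_assoc)
  qed
  have resp: "word_eval H f u = word_eval H f v" if "word_eq u v" for u v
    using that
  proof (induction rule: word_eq.induct)
    case (cancel u g b v)
    have "word_eval H f [(g, b), (g, \<not> b)] = \<one>\<^bsub>H\<^esub>"
      using f[of g] by (simp add: word_eval_def)
    then show ?case
      using closed[of v] closed[of u] by (simp only: app H.l_one)
  qed auto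
  define h where "h U = word_eval H f (SOME u. u \<in> U)" for U
  have h: "h (word_class u) = word_eval H f u" for u
  proof -
    have "(SOME v. v \<in> word_class u) \<in> word_class u"
      by (rule someI[of _ u]) (simp add: word_class_def word_eq.refl)
    then show ?thesis
      unfolding h_def by (metis resp word_class_def mem_Collect_eq)
  qed
  have "h \<in> hom free_group H"
  proof (rule homI)
    fix x assume "x \<in> carrier (free_group :: 'g word set monoid)"
    then show "h x \<in> carrier H" by (auto simp: free_group_def h closed)
  next
    fix x y :: "'g word set"
    assume "x \<in> carrier free_group" "y \<in> carrier free_group"
    then obtain u v where "x = word_class u" "y = word_class v" by (auto simp: free_group_def)
    then show "h (x \<otimes>\<^bsub>free_group\<^esub> y) = h x \<otimes>\<^bsub>H\<^esub> h y"
      by (simp add: free_group_mult h app)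
  qed
  moreover have "h (free_gen g) = f g" for g
    using f[of g] by (simp add: free_gen_def h word_eval_def)
  ultimately show ?thesis using that by blast
qed


section \<open>The Macdonald group\<close>

definition normal_closure :: "('a, 'b) monoid_scheme \<Rightarrow> 'a set \<Rightarrow> 'a set"
  where "normal_closure G R = \<Inter>{N. N \<lhd> G \<and> R \<subseteq> N}"

lemma normal_closure_normal:
  assumes "group G" and "R \<subseteq> carrier G"
  shows "normal_closure G R \<lhd> G"
proof -
  interpret group G by fact
  let ?S = "{N. N \<lhd> G \<and> R \<subseteq> N}"
  have "carrier G \<in> ?S"
    using assms(2) normal_invI[OF subgroup_self] by auto
  then have ne: "?S \<noteq> {}" by blast
  have "subgroup (\<Inter>?S) G"
    using ne by (intro subgroups_Inter) (auto simp: normal_imp_subgroup)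
  moreover have "x \<otimes>\<^bsub>G\<^esub> h \<otimes>\<^bsub>G\<^esub> inv\<^bsub>G\<^esub> x \<in> \<Inter>?S"
    if "x \<in> carrier G" "h \<in> \<Inter>?S" for x h
    using that by (auto intro: normal.inv_op_closed2)
  ultimately show ?thesis
    unfolding normal_closure_def by (rule normal_invI)
qed

datatype mac_gen = GenA | GenB

definition mac_relators :: "int \<Rightarrow> mac_gen word set set"
  where "mac_relators \<alpha> =
    (let F = free_group; a = free_gen GenA; b = free_gen GenB
     in {conjugate F a (commutator F a b) \<otimes>\<^bsub>F\<^esub> inv\<^bsub>F\<^esub> (a [^]\<^bsub>F\<^esub> \<alpha>),
         conjugate F b (commutator F b a) \<otimes>\<^bsub>F\<^esub> inv\<^bsub>F\<^esub> (b [^]\<^bsub>F\<^esub> \<alpha>)})"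

definition macdonald :: "int \<Rightarrow> mac_gen word set set monoid"
  where "macdonald \<alpha> = free_group Mod normal_closure free_group (mac_relators \<alpha>)"

definition mac_elem :: "int \<Rightarrow> mac_gen \<Rightarrow> mac_gen word set set"
  where "mac_elem \<alpha> g = normal_closure free_group (mac_relators \<alpha>) #>\<^bsub>free_group\<^esub> free_gen g"

lemma mac_relators_closed: "mac_relators \<alpha> \<subseteq> carrier free_group"
proof -
  interpret F: group "free_group :: mac_gen word set monoid" by (rule free_group_is_group)
  show ?thesis
    by (simp add: mac_relators_def Let_def conjugate_def commutator_def free_gen_closed
        del: F.int_pow_neg)
qed

lemma macdonald_group: "group (macdonald \<alpha>)"
  unfolding macdonald_def
  by (intro normal.factorgroup_is_group normal_closure_normal free_group_is_group
      mac_relators_closed)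

lemma mac_elem_closed: "mac_elem \<alpha> g \<in> carrier (macdonald \<alpha>)"
  by (auto simp: mac_elem_def macdonald_def FactGroup_def RCOSETS_def free_gen_closed)

end

theory Submission
  imports Defs "HOL-Algebra.Multiplicative_Group" "HOL-Algebra.Bij"
begin

text \<open>The relations give \<open>A\<^sup>n B = B A\<^sup>s C\<^sup>n\<close> with \<open>s = 1 + b + \<dots> + b\<^sup>n\<^sup>-\<^sup>1\<close>, where \<open>b\<close> is inverse
  to \<open>\<alpha>\<close>, and they are symmetric under exchanging \<open>A\<close> with \<open>B\<close> and \<open>C\<close> with its inverse. Evaluating the
  commutator of \<open>B\<close> and a power of \<open>A\<close> in two ways makes a power of \<open>A\<close> equal to a power of \<open>B\<close>; the
  3-adic valuation of the exponent is exactly 3 for a suitable choice. Hence \<open>A\<^sup>2\<^sup>7 = B\<^sup>-\<^sup>2\<^sup>7\<close> is central of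
  order at most 3 and \<open>C\<^sup>2\<^sup>7 = 1\<close>. If \<open>A\<^sup>2\<^sup>7 \<noteq> 1\<close>, commutators with \<open>A\<close> and \<open>B\<close> propagate this nontriviality
  upwards through the chain obtained by adjoining successively \<open>A\<^sup>2\<^sup>7\<close>; \<open>C\<^sup>9\<close>; \<open>A\<^sup>9, B\<^sup>9\<close>; \<open>C\<^sup>3\<close>;
  \<open>A\<^sup>3, B\<^sup>3\<close>; \<open>C\<close>; \<open>A, B\<close>, which is therefore the upper central series.

  To see \<open>A\<^sup>2\<^sup>7 \<noteq> 1\<close>, it suffices to find a group with generators satisfying the relations in which \<open>A\<^sup>2\<^sup>7\<close>
  is an element of order 3, because the kernel of \<open>\<pi>\<close> has order prime to 3. For \<open>\<alpha> = -2\<close> a permutation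
  group does this, and its elements \<open>A\<^sup>r\<close>, \<open>B\<close> satisfy the relations for all other \<open>\<alpha>\<close>.\<close>

section \<open>Geometric sums modulo powers of 3\<close>

text \<open>The hypotheses on \<open>\<alpha>\<close> amount to \<open>\<alpha> mod 9 = 7\<close>,
  so \<open>\<alpha> - 1\<close> and \<open>b - 1\<close> are divisible by 3 exactly once. Every
  nontriviality argument rests on this exactness, which survives cubing:
  \<open>b ^ 3 ^ k - 1\<close> is divisible by 3 exactly \<open>k + 1\<close> times.

  One model serves all \<open>\<alpha>\<close> because -2 has order 27 modulo 81: the residues equal
  to 7 modulo 9 are its powers with exponent \<open>r\<close> congruent to 1 modulo 3. For these
  \<open>r\<close>, 27 divides \<open>gsum 40 r - r\<close>, so the commutator of \<open>A^r\<close>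
  and \<open>B\<close> is \<open>C^r\<close> up to a central factor.

  The table of \<open>A\<close> comes from \<open>A B^s = B^n A C^n\<close> with
  \<open>s = gsum 40 n\<close>, where \<open>n\<close> determines \<open>s\<close> bijectively
  modulo 81. Applied to \<open>A^i\<close> it sends the coset of \<open>B^s A^i\<close> to that of
  \<open>B^n A^(1 + 40^n i)\<close>.

  The claims on power subgroups and on the exponent concern all elements, not only generators.
  Heis(Z/3Z) has exponent 3, so all cubes lie in the fifth centre; from there on, cubing descends
  through abelian sections of exponent 3, where generators suffice.\<close>

definition gsum :: "nat \<Rightarrow> nat \<Rightarrow> nat"
  where "gsum b n = (\<Sum>i<n. b ^ i)"

lemma gsum_0 [simp]: "gsum b 0 = 0"
  and gsum_Suc: "gsum b (Suc n) = gsum b n + b ^ n"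
  by (simp_all add: gsum_def)

lemma gsum_Suc2: "gsum b (Suc n) = 1 + b * gsum b n"
  unfolding gsum_def by (subst sum.lessThan_Suc_shift) (simp add: sum_distrib_left)

lemma gsum_numeral: "gsum b (numeral k) = 1 + b * gsum b (pred_numeral k)"
  by (simp add: numeral_eq_Suc gsum_Suc2)

lemma gsum_add: "gsum b (m + n) = gsum b m + b ^ m * gsum b n"
  by (induction n) (simp_all add: gsum_Suc algebra_simps power_add)

text \<open>Cutting the sum into \<open>n\<close> blocks of length \<open>m\<close>, the block with
  index \<open>i\<close> is the first one times \<open>b ^ (m * i)\<close>.\<close>

lemma gsum_mult: "gsum b (m * n) = gsum b m * gsum (b ^ m) n"
proof (induction n)
  case (Suc n)
  have "gsum b (m * Suc n) = gsum b (m * n) + b ^ (m * n) * gsum b m"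
    using gsum_add[of b "m * n" m] by (simp add: add.commute)
  with Suc show ?case by (simp add: gsum_Suc algebra_simps power_mult)
qed simp

lemma gsum_ge: "b > 0 \<Longrightarrow> n \<le> gsum b n"
proof (induction n)
  case (Suc n)
  then have "b ^ n \<ge> 1" by simp
  moreover have "n \<le> gsum b n" using Suc by simp
  ultimately show ?case unfolding gsum_Suc by linarith
qed simp

lemma gsum_cong: "[b = c] (mod m) \<Longrightarrow> [gsum b n = gsum c n] (mod m)"
  unfolding gsum_def by (intro cong_sum cong_pow)

text \<open>By \<open>gsum_mult\<close> a step multiplies by \<open>1 + c + c\<^sup>2\<close> with
  \<open>c = b ^ 3 ^ k\<close>, and this is 3 modulo 9 because \<open>c\<close> is 1 modulo 3. The
  modulus makes the valuation exactly \<open>k\<close>.\<close>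

lemma gsum_3_power:
  assumes "b mod 3 = 1"
  shows "[gsum b (3 ^ k) = 3 ^ k] (mod 3 ^ Suc k)"
proof (induction k)
  case 0
  then show ?case by (simp add: gsum_Suc cong_def)
next
  case (Suc k)
  define c where "c = b ^ 3 ^ k"
  have "[c = 1 ^ 3 ^ k] (mod 3)" unfolding c_def by (intro cong_pow) (simp add: assms cong_def)
  then have "c mod 3 = 1" by (simp add: cong_def)
  then obtain v where v: "c = 3 * v + 1" by (metis mult_div_mod_eq)
  have "gsum c 3 = 3 * (1 + 3 * (v + v\<^sup>2))"
    by (simp add: v eval_nat_numeral gsum_Suc algebra_simps)
  moreover have "gsum b (3 ^ Suc k) = gsum b (3 ^ k) * gsum c 3"
    using gsum_mult[of b "3 ^ k" 3] by (simp add: c_def mult.commute)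
  ultimately have eq: "gsum b (3 ^ Suc k) = 3 * (gsum b (3 ^ k) * (1 + 3 * (v + v\<^sup>2)))"
    by (simp only: mult_ac)
  have "[gsum b (3 ^ k) * (1 + 3 * (v + v\<^sup>2)) = 3 ^ k * (1 + 3 * (v + v\<^sup>2))] (mod 3 ^ Suc k)"
    by (intro cong_mult Suc cong_refl)
  also have "3 ^ k * (1 + 3 * (v + v\<^sup>2)) = 3 ^ k + 3 ^ Suc k * (v + v\<^sup>2)"
    by (simp add: algebra_simps)
  also have "[\<dots> = 3 ^ k] (mod 3 ^ Suc k)" by (simp add: cong_def)
  finally have "[3 * (gsum b (3 ^ k) * (1 + 3 * (v + v\<^sup>2))) = 3 * 3 ^ k] (mod 3 * 3 ^ Suc k)"
    by (simp only: cong_def mult_mod_right [symmetric])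
  then show ?case by (subst eq) (simp only: power_Suc)
qed

text \<open>A block of \<open>3 ^ k\<close> terms sums to 0 modulo \<open>3 ^ k\<close>, so only the
  incomplete last block counts. The length of the sum thus matters only modulo 81 in later
  computations modulo 81.\<close>

lemma gsum_period:
  assumes "b mod 3 = 1" "[n = n'] (mod 3 ^ k)"
  shows "[gsum b n = gsum b n'] (mod 3 ^ k)"
proof -
  have z: "[gsum b (3 ^ k) = 0] (mod 3 ^ k)"
    using cong_dvd_modulus_nat[OF gsum_3_power[OF assms(1), of k], of "3 ^ k"]
    by (simp add: cong_def)
  have *: "[gsum b n = gsum b (n mod 3 ^ k)] (mod 3 ^ k)" for n
  proof -
    have "gsum b n = gsum b (n mod 3 ^ k) + b ^ (n mod 3 ^ k) * (gsum b (3 ^ k) * gsum (b ^ 3 ^ k) (n div 3 ^ k))"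
      by (metis gsum_add gsum_mult mod_mult_div_eq)
    also have "[\<dots> = gsum b (n mod 3 ^ k) + b ^ (n mod 3 ^ k) * (0 * gsum (b ^ 3 ^ k) (n div 3 ^ k))] (mod 3 ^ k)"
      by (intro cong_add cong_mult cong_refl z)
    finally show ?thesis by simp
  qed
  show ?thesis using *[of n] *[of n'] assms(2) by (simp add: cong_def)
qed

text \<open>Lifting the exponent: the residues 4 and 7 modulo 9, those of \<open>b\<close> and
  \<open>a\<close>, mean that 3 divides \<open>c - 1\<close> and 9 does not. Cubing
  \<open>1 + 3 * q * u\<close> adds exactly one factor 3.\<close>

lemma cube_power_minus_1:
  fixes c :: nat
  assumes "c mod 9 = 4 \<or> c mod 9 = 7"
  shows "\<exists>u. c ^ 3 ^ k = 1 + 3 ^ Suc k * u \<and> \<not> 3 dvd u"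
proof (induction k)
  case 0
  have "c = 1 + 3 * (c div 3)" using assms by presburger
  moreover have "\<not> 3 dvd c div 3" using assms by presburger
  ultimately show ?case by auto
next
  case (Suc k)
  then obtain u where u: "c ^ 3 ^ k = 1 + 3 ^ Suc k * u" "\<not> 3 dvd u" by blast
  define q where "q = (3::nat) ^ k"
  have "c ^ 3 ^ Suc k = (c ^ 3 ^ k) ^ 3" by (simp add: power_mult [symmetric] mult.commute)
  also have "\<dots> = (1 + 3 * q * u) ^ 3" by (simp add: u q_def)
  also have "\<dots> = 1 + 9 * q * (u + 3 * (q * u\<^sup>2 + q\<^sup>2 * u ^ 3))"
    by (simp add: eval_nat_numeral algebra_simps)
  finally have "c ^ 3 ^ Suc k = 1 + 3 ^ Suc (Suc k) * (u + 3 * (q * u\<^sup>2 + q\<^sup>2 * u ^ 3))"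
    by (simp add: q_def)
  moreover have "\<not> 3 dvd u + 3 * (q * u\<^sup>2 + q\<^sup>2 * u ^ 3)"
    using u(2) by (metis dvd_add_left_iff dvd_triv_left)
  ultimately show ?case by blast
qed

text \<open>An explicit inverse of each of the nine residues of \<open>a\<close> pins down the
  residue of \<open>b\<close>. This reduces statements modulo 81 about the pair to nine
  evaluations.\<close>

lemma residue_cases:
  fixes a b :: nat
  assumes "a mod 9 = 7" "(a * b) mod 81 = 1"
  shows "(a mod 81, b mod 81) \<in> {(7,58),(16,76),(25,13),(34,31),(43,49),(52,67),(61,4),(70,22),(79,40)}"
proof -
  define r s where "r = a mod 81" and "s = b mod 81"
  have "r mod 9 = 7" using assms(1) by (simp add: r_def mod_mod_cancel)
  then have r: "r = 9 * (r div 9) + 7" by (metis mult_div_mod_eq)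
  have "r < 81" by (simp add: r_def)
  then have "r div 9 \<in> {0,1,2,3,4,5,6,7,8}" by auto
  with r have r: "r \<in> {7,16,25,34,43,52,61,70,79}" by auto
  have rs: "(r * s) mod 81 = 1" using assms(2) by (simp add: r_def s_def mod_simps)
  have s: "s < 81" by (simp add: s_def)
  have cancel: "s = d" if "(c * r) mod 81 = 1" "c mod 81 = d" for c d
  proof -
    have "s = s * ((c * r) mod 81) mod 81" using that s by simp
    also have "\<dots> = c * ((r * s) mod 81) mod 81" by (simp add: mod_simps ac_simps)
    finally show ?thesis using rs that(2) by simp
  qed
  show ?thesis
    unfolding r_def [symmetric] s_def [symmetric] using r
    apply (elim insertE emptyE)
    subgoal using cancel[of 58 58] by simp
    subgoal using cancel[of 76 76] by simp
    subgoal using cancel[of 13 13] by simp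
    subgoal using cancel[of 31 31] by simp
    subgoal using cancel[of 49 49] by simp
    subgoal using cancel[of 67 67] by simp
    subgoal using cancel[of 4 4] by simp
    subgoal using cancel[of 22 22] by simp
    subgoal using cancel[of 40 40] by simp
    done
qed

lemma inverse_mod_9:
  fixes a b :: nat
  assumes "a mod 9 = 7" "(a * b) mod 81 = 1"
  shows "b mod 9 = 4"
proof -
  have "b mod 81 mod 9 = b mod 9" by (simp add: mod_mod_cancel)
  with residue_cases[OF assms] show ?thesis by auto
qed

text \<open>The source of the exact valuation 3. Both sides matter only modulo 81, hence only
  through the residues of \<open>a\<close> and \<open>b\<close>; since a sum of positive powers is
  at least its length, \<open>w\<close> can be taken in the natural numbers.\<close>

lemma gsum_minus_exact:
  fixes a b :: nat
  assumes "a mod 9 = 7" "(a * b) mod 81 = 1"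
  shows "\<exists>m w. gsum b (a ^ m) = a ^ m + 27 * w \<and> \<not> 3 dvd w"
proof -
  have b9: "b mod 9 = 4" by (rule inverse_mod_9[OF assms])
  then have b3: "b mod 3 = 1" by presburger
  have key: "\<exists>w. gsum b (a ^ m) = a ^ m + 27 * w \<and> \<not> 3 dvd w"
    if e: "gsum (b mod 81) ((a mod 81) ^ m mod 81) mod 81 = ((a mod 81) ^ m mod 81 + 27 * e) mod 81"
      "\<not> 3 dvd e" for m e
  proof -
    have "[gsum b (a ^ m) = gsum b (((a mod 81) ^ m) mod 81)] (mod 3 ^ 4)"
      by (intro gsum_period b3) (simp add: cong_def power_mod)
    also have "[gsum b (((a mod 81) ^ m) mod 81) = gsum (b mod 81) (((a mod 81) ^ m) mod 81)] (mod 3 ^ 4)"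
      by (intro gsum_cong) (simp add: cong_def)
    also have "[gsum (b mod 81) (((a mod 81) ^ m) mod 81) = (a mod 81) ^ m mod 81 + 27 * e] (mod 3 ^ 4)"
      using e(1) by (simp add: cong_def)
    also have "[(a mod 81) ^ m mod 81 + 27 * e = a ^ m + 27 * e] (mod 3 ^ 4)"
      by (intro cong_add cong_refl) (simp add: cong_def power_mod)
    finally have "[int (gsum b (a ^ m)) = int (a ^ m + 27 * e)] (mod int 81)"
      by (simp only: cong_int_iff) simp
    then have "int 81 dvd int (gsum b (a ^ m)) - int (a ^ m + 27 * e)"
      by (simp only: cong_iff_dvd_diff)
    then obtain k where "int (gsum b (a ^ m)) - int (a ^ m + 27 * e) = int 81 * k" ..
    then have k: "int (gsum b (a ^ m)) = int (a ^ m + 27 * e) + 81 * k" by simp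
    have "b > 0" using b9 by presburger
    then have ge: "a ^ m \<le> gsum b (a ^ m)" by (rule gsum_ge)
    define w where "w = nat (int e + 3 * k)"
    from ge have "int (a ^ m) \<le> int (gsum b (a ^ m))" by (simp only: of_nat_le_iff)
    then have w: "int w = int e + 3 * k" using k unfolding w_def by simp
    then have "int (gsum b (a ^ m)) = int (a ^ m + 27 * w)" using k by simp
    then have "gsum b (a ^ m) = a ^ m + 27 * w" by (simp only: of_nat_eq_iff)
    moreover have "\<not> 3 dvd w" using w e(2) by presburger
    ultimately show ?thesis by blast
  qed
  \<comment> \<open>For \<open>a\<close> congruent to 25 modulo 27, the choice \<open>m = 1\<close>
    gives a difference divisible by 81, so the next power of \<open>a\<close> is used.\<close>
  define m where "m = (if a mod 81 mod 27 = 25 then 2 else 1 :: nat)"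
  have "\<exists>e. gsum (b mod 81) ((a mod 81) ^ m mod 81) mod 81 = ((a mod 81) ^ m mod 81 + 27 * e) mod 81
      \<and> \<not> 3 dvd e"
    using residue_cases[OF assms]
    apply (elim insertE emptyE; simp only: prod.inject; elim conjE; simp only: m_def)
    subgoal by (rule exI[of _ 1]) (simp add: gsum_numeral gsum_Suc2)
    subgoal by (rule exI[of _ 2]) (simp add: gsum_numeral gsum_Suc2)
    subgoal by (rule exI[of _ 1]) (simp add: gsum_numeral gsum_Suc2)
    subgoal by (rule exI[of _ 1]) (simp add: gsum_numeral gsum_Suc2)
    subgoal by (rule exI[of _ 2]) (simp add: gsum_numeral gsum_Suc2)
    subgoal by (rule exI[of _ 1]) (simp add: gsum_numeral gsum_Suc2)
    subgoal by (rule exI[of _ 1]) (simp add: gsum_numeral gsum_Suc2)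
    subgoal by (rule exI[of _ 2]) (simp add: gsum_numeral gsum_Suc2)
    subgoal by (rule exI[of _ 1]) (simp add: gsum_numeral gsum_Suc2)
    done
  then show ?thesis using key by blast
qed

section \<open>Central extensions\<close>

text \<open>One step of \<open>upper_central\<close>, for an arbitrary \<open>N\<close>: a candidate
  chain can be examined before it is identified with the upper central series.\<close>

definition central_mod :: "('a, 'b) monoid_scheme \<Rightarrow> 'a set \<Rightarrow> 'a set"
  where "central_mod G N = {x \<in> carrier G. N #>\<^bsub>G\<^esub> x \<in> center (G Mod N)}"

section \<open>Commutators and conjugation written without inverses\<close>

context group
begin

lemma commutator_closed [simp]:
  "x \<in> carrier G \<Longrightarrow> g \<in> carrier G \<Longrightarrow> commutator G x g \<in> carrier G"
  by (simp add: commutator_def)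

lemma commutator_eq_iff:
  assumes "x \<in> carrier G" "g \<in> carrier G" "c \<in> carrier G"
  shows "commutator G x g = c \<longleftrightarrow> x \<otimes> g = g \<otimes> x \<otimes> c"
proof -
  have "commutator G x g = inv (g \<otimes> x) \<otimes> (x \<otimes> g)"
    using assms by (simp add: commutator_def inv_mult_group m_assoc)
  then show ?thesis using assms by (simp add: inv_solve_left')
qed

lemma swap_commutator:
  "x \<in> carrier G \<Longrightarrow> g \<in> carrier G \<Longrightarrow> x \<otimes> g = g \<otimes> x \<otimes> commutator G x g"
  using commutator_eq_iff[of x g "commutator G x g"] by simp

lemma assoc_subst:
  "u \<otimes> v = r \<Longrightarrow> u \<in> carrier G \<Longrightarrow> v \<in> carrier G \<Longrightarrow> z \<in> carrier G
    \<Longrightarrow> u \<otimes> (v \<otimes> z) = r \<otimes> z"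
  by (simp add: m_assoc [symmetric])

lemma commutator_eq_one_iff:
  "x \<in> carrier G \<Longrightarrow> g \<in> carrier G \<Longrightarrow> commutator G x g = \<one> \<longleftrightarrow> x \<otimes> g = g \<otimes> x"
  by (simp add: commutator_eq_iff)

text \<open>The equation \<open>x \<otimes> g = g \<otimes> y\<close> is
  \<open>y = inv g \<otimes> x \<otimes> g\<close> cleared of inverses. In this form conjugation is
  a rewrite rule with natural exponents.\<close>

lemma semiconj_pow:
  fixes n :: nat
  assumes [simp]: "x \<in> carrier G" "y \<in> carrier G" "g \<in> carrier G" and eq: "x \<otimes> g = g \<otimes> y"
  shows "x [^] n \<otimes> g = g \<otimes> y [^] n"
proof (induction n)
  case (Suc n)
  have "x [^] Suc n \<otimes> g = x [^] n \<otimes> g \<otimes> y" by (simp add: eq m_assoc)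
  also have "\<dots> = g \<otimes> y [^] Suc n" by (simp add: Suc m_assoc)
  finally show ?case .
qed simp

lemma semiconj_pow_pow:
  fixes n k a :: nat
  assumes [simp]: "x \<in> carrier G" "g \<in> carrier G" and eq: "x \<otimes> g = g \<otimes> x [^] a"
  shows "x [^] n \<otimes> g [^] k = g [^] k \<otimes> x [^] (n * a ^ k)"
proof (induction k)
  case (Suc k)
  have "x [^] n \<otimes> g [^] Suc k = g [^] k \<otimes> (x [^] (n * a ^ k) \<otimes> g)"
    by (simp add: Suc m_assoc [symmetric])
  also have "x [^] (n * a ^ k) \<otimes> g = g \<otimes> x [^] (n * a ^ Suc k)"
    using semiconj_pow[OF _ _ _ eq] by (simp add: nat_pow_pow ac_simps)
  finally show ?case by (simp add: m_assoc)
qed simp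

lemma commute_nat_pow:
  fixes m n :: nat
  assumes "x \<in> carrier G" "y \<in> carrier G" "x \<otimes> y = y \<otimes> x"
  shows "x [^] m \<otimes> y [^] n = y [^] n \<otimes> x [^] m"
  using semiconj_pow_pow[of x y 1 m n] assms by simp

lemma centralizer_subgroup:
  assumes "y \<in> carrier G"
  shows "subgroup {x \<in> carrier G. x \<otimes> y = y \<otimes> x} G"
proof (rule subgroupI)
  fix a assume "a \<in> {x \<in> carrier G. x \<otimes> y = y \<otimes> x}"
  then have a: "a \<in> carrier G" "a \<otimes> y = y \<otimes> a" by auto
  have "inv a \<otimes> y = inv a \<otimes> (y \<otimes> a) \<otimes> inv a" using a(1) assms by (simp add: m_assoc)
  also have "\<dots> = y \<otimes> inv a" using a(1) assms by (simp add: a(2)[symmetric] m_assoc [symmetric])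
  finally show "inv a \<in> {x \<in> carrier G. x \<otimes> y = y \<otimes> x}" using a(1) by simp
next
  fix a b assume "a \<in> {x \<in> carrier G. x \<otimes> y = y \<otimes> x}" "b \<in> {x \<in> carrier G. x \<otimes> y = y \<otimes> x}"
  then have ab: "a \<in> carrier G" "b \<in> carrier G" "a \<otimes> y = y \<otimes> a" "b \<otimes> y = y \<otimes> b" by auto
  have "a \<otimes> b \<otimes> y = a \<otimes> y \<otimes> b" using assms ab(1,2,4) by (simp add: m_assoc)
  also have "\<dots> = y \<otimes> (a \<otimes> b)" using ab(1,2) assms by (subst ab(3)) (simp add: m_assoc)
  finally show "a \<otimes> b \<in> {x \<in> carrier G. x \<otimes> y = y \<otimes> x}" using ab by simp
qed (use assms in \<open>auto intro!: exI[of _ \<one>]\<close>)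

lemma commute_int_pow:
  fixes i j :: int
  assumes "x \<in> carrier G" "y \<in> carrier G" "x \<otimes> y = y \<otimes> x"
  shows "x [^] i \<otimes> y [^] j = y [^] j \<otimes> x [^] i"
proof -
  have "x [^] i \<otimes> y = y \<otimes> x [^] i"
    using subgroup_int_pow_closed[OF centralizer_subgroup[of y], of x i] assms by simp
  then show ?thesis
    using subgroup_int_pow_closed[OF centralizer_subgroup[of "x [^] i"], of y j] assms by simp
qed

lemma commute_layer_mult:
  fixes i j k l :: int
  assumes [simp]: "x \<in> carrier G" "y \<in> carrier G" and c: "x \<otimes> y = y \<otimes> x"
  shows "(x [^] i \<otimes> y [^] j) \<otimes> (x [^] k \<otimes> y [^] l) = x [^] (i + k) \<otimes> y [^] (j + l)"
proof -
  have "(x [^] i \<otimes> y [^] j) \<otimes> (x [^] k \<otimes> y [^] l) = x [^] i \<otimes> (y [^] j \<otimes> x [^] k) \<otimes> y [^] l"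
    by (simp add: m_assoc)
  also have "y [^] j \<otimes> x [^] k = x [^] k \<otimes> y [^] j" using commute_int_pow[OF _ _ c] by simp
  also have "x [^] i \<otimes> (x [^] k \<otimes> y [^] j) \<otimes> y [^] l = (x [^] i \<otimes> x [^] k) \<otimes> (y [^] j \<otimes> y [^] l)"
    by (simp add: m_assoc)
  also have "\<dots> = x [^] (i + k) \<otimes> y [^] (j + l)" by (simp add: int_pow_mult)
  finally show ?thesis .
qed

lemma conj_int_pow:
  fixes i :: int
  assumes "x \<in> carrier G" "g \<in> carrier G"
  shows "inv g \<otimes> x [^] i \<otimes> g = (inv g \<otimes> x \<otimes> g) [^] i"
proof -
  have "(\<lambda>u. inv g \<otimes> u \<otimes> g) \<in> hom G G"
  proof (rule homI)
    fix u v assume u: "u \<in> carrier G" "v \<in> carrier G"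
    have "g \<otimes> (inv g \<otimes> z) = z" if "z \<in> carrier G" for z
      using that assms(2) by (simp add: m_assoc [symmetric])
    then show "inv g \<otimes> (u \<otimes> v) \<otimes> g = inv g \<otimes> u \<otimes> g \<otimes> (inv g \<otimes> v \<otimes> g)"
      using assms(2) u by (simp add: m_assoc)
  qed (use assms in simp)
  then show ?thesis
    using hom_int_pow[OF _ assms(1) is_group is_group] by fast
qed

text \<open>Conjugation by \<open>g\<close> is a homomorphism that sends \<open>x\<close> to
  \<open>x \<otimes> w\<close> and \<open>y\<close> to \<open>y \<otimes> v\<close> and fixes
  \<open>n\<close>. The factors \<open>w\<close> and \<open>v\<close> commute with all that stands
  to their right, so they collect at the end: the commutator with \<open>g\<close> is additive in
  the exponents.\<close>

lemma conj_layer: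
  fixes i j :: int
  assumes [simp]: "x \<in> carrier G" "y \<in> carrier G" "n \<in> carrier G" "g \<in> carrier G"
      "w \<in> carrier G" "v \<in> carrier G"
    and xg: "x \<otimes> g = g \<otimes> x \<otimes> w" and yg: "y \<otimes> g = g \<otimes> y \<otimes> v" and ng: "n \<otimes> g = g \<otimes> n"
    and w: "w \<otimes> x = x \<otimes> w" "w \<otimes> y = y \<otimes> w" "w \<otimes> n = n \<otimes> w"
    and v: "v \<otimes> y = y \<otimes> v" "v \<otimes> n = n \<otimes> v"
  shows "commutator G (x [^] i \<otimes> y [^] j \<otimes> n) g = w [^] i \<otimes> v [^] j"
proof -
  have X: "x [^] i \<otimes> g = g \<otimes> (x [^] i \<otimes> w [^] i)"
  proof -
    have "inv g \<otimes> x \<otimes> g = x \<otimes> w" using xg by (simp add: m_assoc inv_solve_left')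
    then have "inv g \<otimes> x [^] i \<otimes> g = x [^] i \<otimes> w [^] i"
      by (simp add: conj_int_pow int_pow_mult_distrib[OF w(1)[symmetric]])
    then show ?thesis by (simp add: m_assoc inv_solve_left')
  qed
  have Y: "y [^] j \<otimes> g = g \<otimes> (y [^] j \<otimes> v [^] j)"
  proof -
    have "inv g \<otimes> y \<otimes> g = y \<otimes> v" using yg by (simp add: m_assoc inv_solve_left')
    then have "inv g \<otimes> y [^] j \<otimes> g = y [^] j \<otimes> v [^] j"
      by (simp add: conj_int_pow int_pow_mult_distrib[OF v(1)[symmetric]])
    then show ?thesis by (simp add: m_assoc inv_solve_left')
  qed
  have wy: "w [^] i \<otimes> y [^] j = y [^] j \<otimes> w [^] i" by (rule commute_int_pow) (simp_all add: w)
  have wn: "w [^] i \<otimes> n = n \<otimes> w [^] i" using commute_int_pow[of w n i 1] by (simp add: w)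
  have vn: "v [^] j \<otimes> n = n \<otimes> v [^] j" using commute_int_pow[of v n j 1] by (simp add: v)
  have "x [^] i \<otimes> y [^] j \<otimes> n \<otimes> g = x [^] i \<otimes> (y [^] j \<otimes> g) \<otimes> n"
    by (simp add: m_assoc ng)
  also have "\<dots> = (x [^] i \<otimes> g) \<otimes> (y [^] j \<otimes> v [^] j) \<otimes> n" by (simp add: assoc_subst[OF Y] m_assoc)
  also have "\<dots> = g \<otimes> x [^] i \<otimes> (w [^] i \<otimes> y [^] j) \<otimes> (v [^] j \<otimes> n)" by (simp add: assoc_subst[OF X] m_assoc)
  also have "\<dots> = g \<otimes> x [^] i \<otimes> y [^] j \<otimes> (w [^] i \<otimes> n) \<otimes> v [^] j" by (simp add: assoc_subst[OF wy] vn m_assoc)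
  also have "\<dots> = g \<otimes> (x [^] i \<otimes> y [^] j \<otimes> n) \<otimes> (w [^] i \<otimes> v [^] j)" by (simp add: assoc_subst[OF wn] m_assoc)
  finally show ?thesis by (subst commutator_eq_iff) simp_all
qed

end

lemma (in group_hom) hom_commutator:
  "x \<in> carrier G \<Longrightarrow> g \<in> carrier G \<Longrightarrow> h (commutator G x g) = commutator H (h x) (h g)"
  by (simp add: commutator_def)

section \<open>Centrality modulo a normal subgroup\<close>

context group
begin

lemma quotient_hom: "N \<lhd> G \<Longrightarrow> group_hom G (G Mod N) (\<lambda>x. N #> x)"
  by (intro group_hom.intro group_hom_axioms.intro is_group normal.factorgroup_is_group
      normal.r_coset_hom_Mod)

lemma quotient_one_iff:
  assumes "N \<lhd> G" "x \<in> carrier G"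
  shows "N #> x = \<one>\<^bsub>G Mod N\<^esub> \<longleftrightarrow> x \<in> N"
proof -
  have "subgroup N G" using assms(1) by (rule normal_imp_subgroup)
  then show ?thesis using assms(2) by (auto simp: coset_join2 dest: coset_join1)
qed

lemma central_mod_closed: "x \<in> central_mod G N \<Longrightarrow> x \<in> carrier G"
  by (simp add: central_mod_def)

lemma commutator_in_normal_iff:
  assumes "N \<lhd> G" "x \<in> carrier G" "g \<in> carrier G"
  shows "commutator G x g \<in> N \<longleftrightarrow>
    (N #> x) \<otimes>\<^bsub>G Mod N\<^esub> (N #> g) = (N #> g) \<otimes>\<^bsub>G Mod N\<^esub> (N #> x)"
proof -
  interpret Q: group_hom G "G Mod N" "\<lambda>x. N #> x" using assms(1) by (rule quotient_hom)
  show ?thesis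
    using assms Q.hom_closed by (metis Q.H.commutator_eq_one_iff Q.hom_commutator commutator_closed quotient_one_iff)
qed

lemma central_mod_iff:
  assumes "N \<lhd> G"
  shows "x \<in> central_mod G N \<longleftrightarrow> x \<in> carrier G \<and> (\<forall>g \<in> carrier G. commutator G x g \<in> N)"
  using commutator_in_normal_iff[OF assms, of x]
  by (auto simp: central_mod_def center_def carrier_FactGroup simp del: mult_FactGroup)

text \<open>This is the intersection over all \<open>g\<close> of the preimages of the centralizers
  \<open>K g\<close> of \<open>N #> g\<close>.\<close>

lemma central_mod_subgroup:
  assumes "N \<lhd> G"
  shows "subgroup (central_mod G N) G"
proof -
  interpret Q: group_hom G "G Mod N" "\<lambda>x. N #> x" using assms by (rule quotient_hom)
  define K where "K g = {u \<in> carrier (G Mod N). u \<otimes>\<^bsub>G Mod N\<^esub> (N #> g) = (N #> g) \<otimes>\<^bsub>G Mod N\<^esub> u}" for g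
  have eq: "x \<in> central_mod G N \<longleftrightarrow> x \<in> carrier G \<and> (\<forall>g \<in> carrier G. N #> x \<in> K g)" for x
    using Q.hom_closed
    by (auto simp: K_def central_mod_def center_def carrier_FactGroup simp del: mult_FactGroup)
  have sub: "subgroup (K g) (G Mod N)" if "g \<in> carrier G" for g
    unfolding K_def by (rule Q.H.centralizer_subgroup) (rule Q.hom_closed[OF that])
  show ?thesis
  proof (rule subgroupI)
    have "N #> \<one> = \<one>\<^bsub>G Mod N\<^esub>" by (rule Q.hom_one)
    then have "N #> \<one> \<in> K g" if "g \<in> carrier G" for g
      using subgroup.one_closed[OF sub[OF that]] by (simp only:)
    then have "\<one> \<in> central_mod G N" unfolding eq by blast
    then show "central_mod G N \<noteq> {}" by blast
  next
    fix a assume a: "a \<in> central_mod G N"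
    then have "N #> inv a = inv\<^bsub>G Mod N\<^esub> (N #> a)" by (intro Q.hom_inv) (simp add: eq)
    moreover have "N #> a \<in> K g" if "g \<in> carrier G" for g using a that by (simp only: eq)
    ultimately have "N #> inv a \<in> K g" if "g \<in> carrier G" for g
      using subgroup.m_inv_closed[OF sub[OF that]] that by (simp only:)
    then show "inv a \<in> central_mod G N" using a by (simp add: eq)
  next
    fix a b assume ab: "a \<in> central_mod G N" "b \<in> central_mod G N"
    then have "N #> (a \<otimes> b) = (N #> a) \<otimes>\<^bsub>G Mod N\<^esub> (N #> b)" by (intro Q.hom_mult) (simp_all add: eq)
    moreover have "N #> a \<in> K g" "N #> b \<in> K g" if "g \<in> carrier G" for g
      using ab that by (simp_all only: eq)
    ultimately have "N #> (a \<otimes> b) \<in> K g" if "g \<in> carrier G" for g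
      using subgroup.m_closed[OF sub[OF that]] that by (simp only:)
    then show "a \<otimes> b \<in> central_mod G N" using ab by (simp add: eq)
  qed (auto simp: central_mod_def)
qed

lemma normal_subset_central_mod: "N \<lhd> G \<Longrightarrow> N \<subseteq> central_mod G N"
proof
  fix x assume N: "N \<lhd> G" and x: "x \<in> N"
  have sN: "subgroup N G" using N by (rule normal_imp_subgroup)
  have xc: "x \<in> carrier G" using sN x by (rule subgroup.mem_carrier)
  have "commutator G x g \<in> N" if g: "g \<in> carrier G" for g
  proof -
    have "inv g \<otimes> x \<otimes> g \<in> N" using normal.inv_op_closed1[OF N g x] .
    then have "inv x \<otimes> (inv g \<otimes> x \<otimes> g) \<in> N"
      using sN x by (simp add: subgroup.m_closed subgroup.m_inv_closed)
    then show ?thesis using g xc by (simp add: commutator_def m_assoc)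
  qed
  then show "x \<in> central_mod G N" using N xc by (simp add: central_mod_iff)
qed

text \<open>The cosets that commute with \<open>N #> x\<close> form a subgroup of the quotient, so
  it is enough that they include the images of \<open>S\<close>.\<close>

lemma central_modI_generators:
  assumes N: "N \<lhd> G" and S: "S \<subseteq> carrier G" "generate G S = carrier G"
    and x: "x \<in> carrier G" and c: "\<And>g. g \<in> S \<Longrightarrow> commutator G x g \<in> N"
  shows "x \<in> central_mod G N"
proof -
  interpret Q: group_hom G "G Mod N" "\<lambda>x. N #> x" using N by (rule quotient_hom)
  let ?C = "{u \<in> carrier (G Mod N). u \<otimes>\<^bsub>G Mod N\<^esub> (N #> x) = (N #> x) \<otimes>\<^bsub>G Mod N\<^esub> u}"
  have sub: "subgroup ?C (G Mod N)" by (rule Q.H.centralizer_subgroup) (use x in simp)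
  have "N #> g \<in> ?C" if "g \<in> generate G S" for g
    using that
  proof (induction rule: generate.induct)
    case one
    then show ?case using subgroup.one_closed[OF sub] by (simp del: mult_FactGroup one_FactGroup)
  next
    case (incl g)
    then show ?case using c[OF incl] S(1) commutator_in_normal_iff[OF N x, of g]
      by (auto simp del: mult_FactGroup)
  next
    case (inv g)
    then have "N #> g \<in> ?C" using c[OF inv] S(1) commutator_in_normal_iff[OF N x, of g]
      by (auto simp del: mult_FactGroup)
    then show ?case using subgroup.m_inv_closed[OF sub] S(1) inv
      by (metis (no_types, lifting) Q.hom_inv subsetD)
  next
    case (eng g g')
    then have "g \<in> carrier G" "g' \<in> carrier G" using S by simp_all
    then show ?case using subgroup.m_closed[OF sub eng.IH] by (metis (no_types, lifting) Q.hom_mult)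
  qed
  then have "N #> g \<in> ?C" if "g \<in> carrier G" for g using S(2) that by blast
  then show ?thesis using x commutator_in_normal_iff[OF N x] unfolding central_mod_iff[OF N]
    by (simp del: mult_FactGroup)
qed

text \<open>A conjugate of \<open>h\<close> differs from \<open>h\<close> by a commutator, which
  lies in \<open>N\<close> and hence in \<open>H\<close>.\<close>

lemma normal_between_central_mod:
  assumes N: "N \<lhd> G" and H: "subgroup H G" "N \<subseteq> H" "H \<subseteq> central_mod G N"
  shows "H \<lhd> G"
proof (rule normal_invI[OF H(1)])
  fix x h assume x: "x \<in> carrier G" and h: "h \<in> H"
  then have hc: "h \<in> carrier G" using H(1) by (simp add: subgroup.mem_carrier)
  have "commutator G h (inv x) \<in> H"
    using h x H central_mod_iff[OF N] by (meson inv_closed subsetD)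
  then have "h \<otimes> commutator G h (inv x) \<in> H" using h H(1) by (simp add: subgroup.m_closed)
  moreover have "h \<otimes> commutator G h (inv x) = x \<otimes> h \<otimes> inv x"
    using x hc by (simp add: commutator_def m_assoc [symmetric])
  ultimately show "x \<otimes> h \<otimes> inv x \<in> H" by simp
qed

text \<open>The images of \<open>x\<close> and \<open>y\<close> in the quotient are central, so the
  products of their powers are closed under multiplication and inversion. The case
  \<open>x = y\<close> is allowed and covers layers with a single generator.\<close>

lemma generate_layer:
  assumes N: "N \<lhd> G" and x: "x \<in> central_mod G N" and y: "y \<in> central_mod G N"
    and t: "t \<in> generate G (insert x (insert y N))"
  shows "\<exists>(i::int) (j::int). \<exists>n \<in> N. t = x [^] i \<otimes> y [^] j \<otimes> n"
proof -
  interpret Q: group_hom G "G Mod N" "\<lambda>x. N #> x" using N by (rule quotient_hom)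
  have xc [simp]: "x \<in> carrier G" "y \<in> carrier G" using x y by (simp_all add: central_mod_closed)
  have sN: "subgroup N G" using N by (rule normal_imp_subgroup)
  then have sub: "insert x (insert y N) \<subseteq> carrier G" using subgroup.subset by auto
  define Q X Y where "Q = G Mod N" and "X = N #> x" and "Y = N #> y"
  interpret QH: group Q unfolding Q_def by (rule Q.H.is_group)
  have XY [simp]: "X \<in> carrier Q" "Y \<in> carrier Q" by (simp_all add: X_def Y_def Q_def)
  have comm: "X \<otimes>\<^bsub>Q\<^esub> Y = Y \<otimes>\<^bsub>Q\<^esub> X"
    using x y commutator_in_normal_iff[OF N, of x y] central_mod_iff[OF N]
    by (simp add: X_def Y_def Q_def del: mult_FactGroup)
  have N1: "N #> n = \<one>\<^bsub>Q\<^esub>" if "n \<in> N" for n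
    unfolding Q_def using that quotient_one_iff[OF N] sN subgroup.mem_carrier by metis
  have gen: "(N #> x = X) \<and> (N #> y = Y)" by (simp add: X_def Y_def)
  have "\<exists>(i::int) (j::int). N #> t = X [^]\<^bsub>Q\<^esub> i \<otimes>\<^bsub>Q\<^esub> Y [^]\<^bsub>Q\<^esub> j"
    using t
  proof (induction rule: generate.induct)
    case one
    have "N #> \<one> = X [^]\<^bsub>Q\<^esub> (0::int) \<otimes>\<^bsub>Q\<^esub> Y [^]\<^bsub>Q\<^esub> (0::int)"
      by (subst N1[OF subgroup.one_closed[OF sN]]) simp
    then show ?case by (intro exI)
  next
    case (incl t)
    have "N #> x = X [^]\<^bsub>Q\<^esub> (1::int) \<otimes>\<^bsub>Q\<^esub> Y [^]\<^bsub>Q\<^esub> (0::int)"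
      "N #> y = X [^]\<^bsub>Q\<^esub> (0::int) \<otimes>\<^bsub>Q\<^esub> Y [^]\<^bsub>Q\<^esub> (1::int)"
      using gen by simp_all
    moreover have "t \<in> N \<Longrightarrow> N #> t = X [^]\<^bsub>Q\<^esub> (0::int) \<otimes>\<^bsub>Q\<^esub> Y [^]\<^bsub>Q\<^esub> (0::int)"
      using N1 by simp
    ultimately show ?case using incl by blast
  next
    case (inv t)
    have i: "N #> inv u = inv\<^bsub>Q\<^esub> (N #> u)" if "u \<in> carrier G" for u
      unfolding Q_def using that by simp
    have "N #> inv x = X [^]\<^bsub>Q\<^esub> (-1::int) \<otimes>\<^bsub>Q\<^esub> Y [^]\<^bsub>Q\<^esub> (0::int)"
      "N #> inv y = X [^]\<^bsub>Q\<^esub> (0::int) \<otimes>\<^bsub>Q\<^esub> Y [^]\<^bsub>Q\<^esub> (-1::int)"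
      using gen i[of x] i[of y] QH.int_pow_neg[of X 1] QH.int_pow_neg[of Y 1]
      by (simp_all del: Q.hom_inv)
    moreover have "t \<in> N \<Longrightarrow> N #> inv t = X [^]\<^bsub>Q\<^esub> (0::int) \<otimes>\<^bsub>Q\<^esub> Y [^]\<^bsub>Q\<^esub> (0::int)"
      using N1[of "inv t"] subgroup.m_inv_closed[OF sN] by simp
    ultimately show ?case using inv by blast
  next
    case (eng s t)
    then obtain i j k l :: int where e: "N #> s = X [^]\<^bsub>Q\<^esub> i \<otimes>\<^bsub>Q\<^esub> Y [^]\<^bsub>Q\<^esub> j"
      "N #> t = X [^]\<^bsub>Q\<^esub> k \<otimes>\<^bsub>Q\<^esub> Y [^]\<^bsub>Q\<^esub> l" by blast
    have "s \<in> carrier G" "t \<in> carrier G" using eng generate_in_carrier[OF sub] by simp_all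
    then have "N #> (s \<otimes> t) = (N #> s) \<otimes>\<^bsub>Q\<^esub> (N #> t)" unfolding Q_def by (rule Q.hom_mult)
    then show ?case unfolding e by (metis QH.commute_layer_mult XY comm)
  qed
  then obtain i j :: int where ij: "N #> t = X [^]\<^bsub>Q\<^esub> i \<otimes>\<^bsub>Q\<^esub> Y [^]\<^bsub>Q\<^esub> j" by blast
  let ?u = "x [^] i \<otimes> y [^] j"
  have tc [simp]: "t \<in> carrier G" using t generate_in_carrier[OF sub] by simp
  have "N #> ?u = X [^]\<^bsub>Q\<^esub> i \<otimes>\<^bsub>Q\<^esub> Y [^]\<^bsub>Q\<^esub> j"
    unfolding Q_def X_def Y_def by (simp add: Q.hom_mult Q.hom_int_pow del: mult_FactGroup)
  with ij have "N #> t = N #> ?u" by simp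
  then have "N #> (inv ?u \<otimes> t) = \<one>\<^bsub>G Mod N\<^esub>"
    by (simp add: Q.hom_mult Q.hom_inv del: mult_FactGroup one_FactGroup)
  moreover have "inv ?u \<otimes> t \<in> carrier G" by simp
  ultimately have "inv ?u \<otimes> t \<in> N" using quotient_one_iff[OF N] by blast
  moreover have "t = ?u \<otimes> (inv ?u \<otimes> t)"
    by (simp add: m_assoc [symmetric])
  ultimately show ?thesis by blast
qed

end

lemma coprime_3_power:
  fixes x :: nat
  assumes "\<not> 3 dvd x"
  shows "coprime x (3 ^ e)"
proof -
  have "prime (3::nat)" by simp
  then have "coprime 3 x" using assms by (rule prime_imp_coprime)
  then show ?thesis by (simp add: coprime_commute)
qed

context group
begin

lemma semiconj_inv:
  assumes "x \<in> carrier G" "y \<in> carrier G" "c \<in> carrier G" "x \<otimes> c = c \<otimes> y"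
  shows "inv c \<otimes> x = y \<otimes> inv c"
proof -
  have "inv c \<otimes> x = inv c \<otimes> (x \<otimes> c) \<otimes> inv c" using assms(1-3) by (simp add: m_assoc)
  also have "\<dots> = y \<otimes> inv c" using assms(1-3) by (subst assms(4)) (simp add: m_assoc [symmetric])
  finally show ?thesis .
qed

lemma semiconj_pow_pow':
  fixes n k a :: nat
  assumes [simp]: "x \<in> carrier G" "g \<in> carrier G" and eq: "g \<otimes> x = x [^] a \<otimes> g"
  shows "g [^] k \<otimes> x [^] n = x [^] (n * a ^ k) \<otimes> g [^] k"
proof (induction k)
  case (Suc k)
  have n: "g \<otimes> x [^] m = x [^] (a * m) \<otimes> g" for m :: nat
    using semiconj_pow[of "x [^] a" x g m] eq by (simp add: nat_pow_pow)
  have "g [^] Suc k \<otimes> x [^] n = g \<otimes> (g [^] k \<otimes> x [^] n)"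
    by (simp only: nat_pow_Suc2 m_assoc nat_pow_closed assms)
  also have "\<dots> = g \<otimes> x [^] (n * a ^ k) \<otimes> g [^] k" by (simp add: Suc m_assoc)
  also have "\<dots> = x [^] (a * (n * a ^ k)) \<otimes> (g \<otimes> g [^] k)" by (simp add: n m_assoc)
  also have "g \<otimes> g [^] k = g [^] Suc k" by (simp only: nat_pow_Suc2 assms)
  finally show ?case by (simp add: ac_simps)
qed simp

text \<open>The order of \<open>x [^] k\<close> divides both \<open>m\<close> and \<open>n\<close>.
  This removes factors prime to 3 from exponents of elements of 3-power order.\<close>

lemma pow_coprime_cancel:
  fixes k m n :: nat
  assumes "x \<in> carrier G" "x [^] (k * m) = \<one>" "x [^] n = \<one>" "coprime m n"
  shows "x [^] k = \<one>"
proof -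
  have "ord (x [^] k) dvd m" using assms by (simp add: pow_eq_id [symmetric] nat_pow_pow)
  moreover have "ord (x [^] k) dvd n"
    using assms by (simp add: pow_eq_id [symmetric] nat_pow_pow mult.commute[of k])
       (simp add: nat_pow_pow [symmetric])
  ultimately have "ord (x [^] k) = 1" using assms(4) by (metis coprime_common_divisor_nat nat_dvd_1_iff_1)
  then show ?thesis using assms(1) ord_eq_1 by (metis nat_pow_closed)
qed

lemma pow_cong:
  fixes i j n :: nat
  assumes "x \<in> carrier G" "x [^] n = \<one>" "[i = j] (mod n)"
  shows "x [^] i = x [^] j"
proof -
  have *: "x [^] i = x [^] (i mod n)" for i
  proof -
    have "x [^] i = x [^] (n * (i div n)) \<otimes> x [^] (i mod n)"
      using assms(1) by (simp add: nat_pow_mult)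
    then show ?thesis using assms(1,2) by (simp add: nat_pow_pow [symmetric])
  qed
  show ?thesis using *[of i] *[of j] assms(3) by (simp add: cong_def)
qed

text \<open>An application of \<open>conj_layer\<close> in the quotient by \<open>N\<close>, where
  the two commutators become central and \<open>n\<close> commutes with \<open>g\<close>.\<close>

lemma commutator_layer:
  fixes i j :: int
  assumes N: "N \<lhd> G" and xyng: "x \<in> carrier G" "y \<in> carrier G" "n \<in> carrier G" "g \<in> carrier G"
    and w: "commutator G x g \<in> central_mod G N" and v: "commutator G y g \<in> central_mod G N"
    and n: "commutator G n g \<in> N"
  shows "commutator G (x [^] i \<otimes> y [^] j \<otimes> n) g \<in> N \<longleftrightarrow>
    commutator G x g [^] i \<otimes> commutator G y g [^] j \<in> N"
proof -
  define Q where "Q = G Mod N"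
  define h where "h = (\<lambda>x. N #> x)"
  interpret h: group_hom G Q h unfolding Q_def h_def by (rule quotient_hom[OF N])
  have one: "h u = \<one>\<^bsub>Q\<^esub> \<longleftrightarrow> u \<in> N" if "u \<in> carrier G" for u
    unfolding h_def Q_def using quotient_one_iff[OF N that] .
  have cen: "h u \<otimes>\<^bsub>Q\<^esub> h z = h z \<otimes>\<^bsub>Q\<^esub> h u" if "u \<in> central_mod G N" "z \<in> carrier G" for u z
    using that commutator_in_normal_iff[OF N, of u z] unfolding h_def Q_def central_mod_iff[OF N] by blast
  have sw: "h u \<otimes>\<^bsub>Q\<^esub> h g = h g \<otimes>\<^bsub>Q\<^esub> h u \<otimes>\<^bsub>Q\<^esub> h (commutator G u g)" if "u \<in> carrier G" for u
    using h.H.swap_commutator[of "h u" "h g"] that xyng by (simp only: h.hom_commutator h.hom_closed)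
  have "commutator Q (h x [^]\<^bsub>Q\<^esub> i \<otimes>\<^bsub>Q\<^esub> h y [^]\<^bsub>Q\<^esub> j \<otimes>\<^bsub>Q\<^esub> h n) (h g)
      = h (commutator G x g) [^]\<^bsub>Q\<^esub> i \<otimes>\<^bsub>Q\<^esub> h (commutator G y g) [^]\<^bsub>Q\<^esub> j"
  proof (rule h.H.conj_layer)
    show "h n \<otimes>\<^bsub>Q\<^esub> h g = h g \<otimes>\<^bsub>Q\<^esub> h n"
      using n xyng commutator_in_normal_iff[OF N, of n g] unfolding h_def Q_def by blast
  qed (use xyng in \<open>simp_all only: h.hom_closed commutator_closed sw cen[OF w] cen[OF v]\<close>)
  also have "\<dots> = h (commutator G x g [^] i \<otimes> commutator G y g [^] j)"
    using xyng by (simp add: h.hom_int_pow)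
  finally have "h (commutator G (x [^] i \<otimes> y [^] j \<otimes> n) g)
      = h (commutator G x g [^] i \<otimes> commutator G y g [^] j)"
    using xyng by (simp add: h.hom_commutator h.hom_int_pow)
  then show ?thesis using one xyng by (metis commutator_closed int_pow_closed m_closed)
qed

text \<open>The condition \<open>descend\<close> compares only neighbouring terms. It suffices: an
  element central modulo \<open>M i\<close> lies in \<open>M n\<close>, is central modulo every
  higher term as well, and so descends one step at a time until it reaches
  \<open>M (Suc i)\<close>.\<close>

lemma upper_central_eq_chain:
  assumes M0: "M 0 = {\<one>}" and Mn: "M n = carrier G"
    and normal: "\<And>i. i \<le> n \<Longrightarrow> M i \<lhd> G" and mono: "\<And>i. i < n \<Longrightarrow> M i \<subseteq> M (Suc i)"
    and central: "\<And>i. i < n \<Longrightarrow> M (Suc i) \<subseteq> central_mod G (M i)"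
    and descend: "\<And>i t. Suc (Suc i) \<le> n \<Longrightarrow> t \<in> M (Suc (Suc i)) \<Longrightarrow> t \<in> central_mod G (M i)
      \<Longrightarrow> t \<in> M (Suc i)"
  shows "i \<le> n \<Longrightarrow> upper_central G i = M i"
proof (induction i)
  case 0
  then show ?case by (simp add: M0)
next
  case (Suc i)
  then have eq: "upper_central G (Suc i) = central_mod G (M i)" by (simp add: central_mod_def)
  have mono': "M i \<subseteq> M k" if "i \<le> k" "k \<le> n" for k
    using that
  proof (induction k rule: dec_induct)
    case (step m)
    then show ?case using mono[of m] by auto
  qed simp
  have cm: "central_mod G (M i) \<subseteq> central_mod G (M k)" if "i \<le> k" "k \<le> n" for k
    using mono'[OF that] normal[of i] normal[of k] Suc.prems that
    by (auto simp: central_mod_iff) blast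
  have down: "t \<in> M k" if t: "t \<in> central_mod G (M i)" and k: "Suc i \<le> k" "k \<le> n" for t k
    using k(2,1)
  proof (induction k rule: inc_induct)
    case base
    then show ?case using t Mn by (simp add: central_mod_closed)
  next
    case (step k)
    then obtain l where l: "k = Suc l" "i \<le> l" by (metis Suc_le_D Suc_le_mono)
    have "t \<in> central_mod G (M l)" using cm[of l] t l step by auto
    then show ?case using descend[of l t] step l by simp
  qed
  show ?case unfolding eq using down central[of i] Suc.prems by auto
qed

end

section \<open>Consequences of the Macdonald relations\<close>

text \<open>The inverse exponent \<open>b\<close> is part of the data and each conjugation relation
  is given in both directions, which keeps all exponents natural. The number \<open>e\<close> is
  only an a priori bound on the orders; that 81 suffices is derived. Both the Sylow subgroup and the
  permutation group are instances.\<close>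

locale macdonald_pair = group G for G (structure) +
  fixes A B C :: 'a and a b e :: nat
  assumes closed [simp]: "A \<in> carrier G" "B \<in> carrier G" "C \<in> carrier G"
    and AB: "A \<otimes> B = B \<otimes> A \<otimes> C"
    and AC: "A \<otimes> C = C \<otimes> A [^] a" and CA: "C \<otimes> A = A [^] b \<otimes> C"
    and CB: "C \<otimes> B = B [^] a \<otimes> C" and BC: "B \<otimes> C = C \<otimes> B [^] b"
    and a9: "a mod 9 = 7" and ab: "(a * b) mod 81 = 1"
    and A_pow: "A [^] ((3::nat) ^ e) = \<one>" and B_pow: "B [^] ((3::nat) ^ e) = \<one>"
begin

text \<open>Exchanging the generators inverts their commutator, and the conjugation relations are
  symmetric under this. Each result on \<open>A\<close> thereby yields one on
  \<open>B\<close>.\<close>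

lemma swap: "macdonald_pair G B A (inv C) a b e"
proof unfold_locales
  have "A \<otimes> B \<otimes> inv C = B \<otimes> A \<otimes> (C \<otimes> inv C)" unfolding AB by (simp add: m_assoc)
  then show "B \<otimes> A = A \<otimes> B \<otimes> inv C" by simp
  show "B \<otimes> inv C = inv C \<otimes> B [^] a"
    using semiconj_inv[of "B [^] a" B "C"] semiconj_inv[of "B" "B [^] a" "inv C"] CB
    by (metis closed inv_closed inv_inv nat_pow_closed inv_solve_left' inv_solve_right' m_assoc m_closed)
  show "inv C \<otimes> B = B [^] b \<otimes> inv C" by (rule semiconj_inv) (simp_all add: BC)
  show "inv C \<otimes> A = A [^] a \<otimes> inv C" by (rule semiconj_inv) (simp_all add: AC)
  show "A \<otimes> inv C = inv C \<otimes> A [^] b"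
    using CA by (metis closed inv_closed nat_pow_closed inv_solve_left' inv_solve_right' m_assoc m_closed)
qed (simp_all add: a9 ab A_pow B_pow)

lemma b9: "b mod 9 = 4"
  by (rule inverse_mod_9[OF a9 ab])

lemma b3: "b mod 3 = 1"
  using b9 by presburger

lemma A_pow_C_pow: "A [^] (n::nat) \<otimes> C [^] (k::nat) = C [^] k \<otimes> A [^] (n * a ^ k)"
  by (rule semiconj_pow_pow) (simp_all add: AC)

lemma C_pow_A_pow: "C [^] (k::nat) \<otimes> A [^] (n::nat) = A [^] (n * b ^ k) \<otimes> C [^] k"
  by (rule semiconj_pow_pow') (simp_all add: CA)

lemma B_pow_C_pow: "B [^] (n::nat) \<otimes> C [^] (k::nat) = C [^] k \<otimes> B [^] (n * b ^ k)"
  by (rule semiconj_pow_pow) (simp_all add: BC)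

lemma C_pow_B_pow: "C [^] (k::nat) \<otimes> B [^] (n::nat) = B [^] (n * a ^ k) \<otimes> C [^] k"
  by (rule semiconj_pow_pow') (simp_all add: CB)

text \<open>Moving the new factor \<open>A\<close> to the left past \<open>C [^] n\<close> turns it
  into \<open>A [^] (b ^ n)\<close>, the next summand of the geometric sum.\<close>

lemma AC_pow: "(A \<otimes> C) [^] (n::nat) = A [^] gsum b n \<otimes> C [^] n"
proof (induction n)
  case (Suc n)
  have "(A \<otimes> C) [^] Suc n = A [^] gsum b n \<otimes> (C [^] n \<otimes> A [^] (1::nat)) \<otimes> C"
    by (simp add: Suc m_assoc)
  also have "\<dots> = A [^] gsum b n \<otimes> A [^] (b ^ n) \<otimes> C [^] n \<otimes> C"
    unfolding C_pow_A_pow by (simp add: m_assoc)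
  finally show ?case by (simp add: nat_pow_mult gsum_Suc m_assoc)
qed simp

lemma A_pow_B: "A [^] (n::nat) \<otimes> B = B \<otimes> (A [^] gsum b n \<otimes> C [^] n)"
  using semiconj_pow[of A "A \<otimes> C" B n] by (simp add: AB AC_pow m_assoc)

lemma B_pow_A: "B [^] (n::nat) \<otimes> A = A \<otimes> (B [^] gsum b n \<otimes> inv C [^] n)"
  by (rule macdonald_pair.A_pow_B[OF swap])

text \<open>For \<open>N = a ^ m\<close>, conjugation by \<open>C [^] m\<close> sends
  \<open>A\<close> to \<open>A [^] N\<close> and at the same time \<open>B [^] N\<close> to
  \<open>B\<close>. It therefore turns \<open>B_pow_A\<close> with exponent \<open>N\<close> into a
  formula for \<open>B\<close> and \<open>A [^] N\<close>.\<close>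

lemma B_A_pow:
  "B \<otimes> A [^] (a ^ m) = A [^] (a ^ m) \<otimes> (B [^] (gsum b (a ^ m) * b ^ m) \<otimes> inv C [^] (a ^ m))"
proof -
  define N s where "N = a ^ m" and "s = gsum b N"
  have c: "inv C [^] N \<otimes> C [^] m = C [^] m \<otimes> inv C [^] N" by (rule commute_nat_pow) simp_all
  have A1: "A \<otimes> C [^] m = C [^] m \<otimes> A [^] N" using A_pow_C_pow[of 1 m] by (simp add: N_def)
  have "C [^] m \<otimes> (B \<otimes> A [^] N) = C [^] m \<otimes> B [^] (1::nat) \<otimes> A [^] N" by (simp add: m_assoc)
  also have "\<dots> = B [^] N \<otimes> (C [^] m \<otimes> A [^] N)" unfolding C_pow_B_pow by (simp add: m_assoc N_def)
  also have "\<dots> = B [^] N \<otimes> A \<otimes> C [^] m" by (simp add: A1 [symmetric] m_assoc)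
  also have "\<dots> = A \<otimes> B [^] s \<otimes> (inv C [^] N \<otimes> C [^] m)" by (simp add: B_pow_A s_def m_assoc)
  also have "\<dots> = A \<otimes> (B [^] s \<otimes> C [^] m) \<otimes> inv C [^] N" by (simp add: c m_assoc)
  also have "\<dots> = (A \<otimes> C [^] m) \<otimes> (B [^] (s * b ^ m) \<otimes> inv C [^] N)"
    unfolding B_pow_C_pow by (simp add: m_assoc)
  also have "\<dots> = C [^] m \<otimes> (A [^] N \<otimes> (B [^] (s * b ^ m) \<otimes> inv C [^] N))"
    by (simp add: A1 m_assoc)
  finally show ?thesis unfolding N_def s_def by simp
qed

text \<open>Comparison of \<open>A_pow_B\<close> for the exponent \<open>a\<^sup>m\<close> with \<open>B_A_pow\<close>, which rests on
  \<open>A [^] (a ^ m) = inv C [^] m \<otimes> A \<otimes> C [^] m\<close> instead.\<close>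

lemma A_pow_B_pow_relation:
  "A [^] (a ^ m) = A [^] gsum b (a ^ m) \<otimes> B [^] ((gsum b (a ^ m) * b ^ m - 1) * a ^ (a ^ m))"
proof -
  define N s t where "N = a ^ m" and "s = gsum b N" and "t = s * b ^ m - 1"
  \<comment> \<open>Positivity makes the truncated subtraction in \<open>t\<close> exact, so that
    one factor \<open>B\<close> can be split off for \<open>A_pow_B\<close>.\<close>
  have "b > 0" "a > 0" using b9 a9 by presburger+
  then have "N > 0" "b ^ m > 0" by (simp_all add: N_def)
  moreover have "s \<ge> N" unfolding s_def by (rule gsum_ge) fact
  ultimately have "s * b ^ m = Suc t" by (simp add: t_def)
  then have "B \<otimes> A [^] N = A [^] N \<otimes> (B [^] Suc t \<otimes> inv C [^] N)"
    using B_A_pow[of m] by (simp add: N_def s_def)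
  also have "\<dots> = (A [^] N \<otimes> B) \<otimes> (B [^] t \<otimes> inv C [^] N)"
    by (simp only: nat_pow_Suc2 m_assoc nat_pow_closed closed inv_closed m_closed)
  also have "\<dots> = B \<otimes> A [^] s \<otimes> (C [^] N \<otimes> B [^] t) \<otimes> inv C [^] N"
    unfolding A_pow_B s_def by (simp add: m_assoc)
  also have "\<dots> = B \<otimes> (A [^] s \<otimes> (B [^] (t * a ^ N) \<otimes> (C [^] N \<otimes> inv C [^] N)))"
    unfolding C_pow_B_pow by (simp add: m_assoc)
  also have "C [^] N \<otimes> inv C [^] N = \<one>" by (simp add: nat_pow_inv)
  finally show ?thesis by (simp add: N_def s_def t_def)
qed

text \<open>Cancelling \<open>A [^] (a ^ m)\<close> in the preceding relation leaves an exponent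
  \<open>27 * w\<close> on \<open>A\<close>. The exponent on \<open>B\<close> agrees with it modulo
  81, because \<open>(a * b) ^ m\<close> is 1 modulo 81 and \<open>a\<close>, \<open>b\<close> are 1
  modulo 3. The congruence is kept for use once the 81st power of \<open>B\<close> is known to
  vanish.\<close>

lemma A_pow_81_aux: "\<exists>(w::nat) (t::nat). A [^] (27 * w) \<otimes> B [^] t = \<one> \<and> \<not> 3 dvd w \<and> [t = 27 * w] (mod 81)"
proof -
  obtain m w where w: "gsum b (a ^ m) = a ^ m + 27 * w" "\<not> 3 dvd w"
    using gsum_minus_exact[OF a9 ab] by blast
  define N where "N = a ^ m"
  define t where "t = (N + 27 * w) * b ^ m - 1"
  have "A [^] N \<otimes> (A [^] (27 * w) \<otimes> B [^] (t * a ^ N)) = A [^] N \<otimes> \<one>"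
    using A_pow_B_pow_relation[of m, folded N_def] w(1)[folded N_def]
    by (simp add: t_def nat_pow_mult [symmetric] m_assoc)
  then have eq: "A [^] (27 * w) \<otimes> B [^] (t * a ^ N) = \<one>"
    by simp
  have "N \<noteq> 0" "b ^ m \<noteq> 0" using a9 b9 unfolding N_def by (auto intro!: Nat.gr0I)
  then have t1: "t + 1 = N * b ^ m + 27 * (w * b ^ m)" by (simp add: t_def algebra_simps)
  have "[N * b ^ m = 1 ^ m] (mod 81)"
    unfolding N_def power_mult_distrib [symmetric] by (rule cong_pow) (simp add: ab cong_def)
  then have "[t + 1 = 1 + 27 * (w * b ^ m)] (mod 81)" unfolding t1 by (intro cong_add) simp_all
  then have t2: "[t = 27 * (w * b ^ m)] (mod 81)" by (metis add.commute cong_add_rcancel_nat)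
  have "[b ^ m * a ^ N = 1 ^ m * 1 ^ N] (mod 3)"
    by (intro cong_mult cong_pow) (use b3 a9 in \<open>simp_all add: cong_def, presburger?\<close>)
  then have "[27 * (b ^ m * a ^ N * w) = 27 * (1 * w)] (mod 27 * 3)"
    by (intro cong_cmult_leftI cong_mult) simp_all
  moreover have "[t * a ^ N = 27 * (w * b ^ m) * a ^ N] (mod 81)" by (intro cong_mult t2) simp
  ultimately have "[t * a ^ N = 27 * w] (mod 81)" by (simp add: cong_def ac_simps)
  then show ?thesis using eq w(2) by blast
qed

text \<open>The element \<open>z\<close> is a power of \<open>A\<close> and also of
  \<open>B\<close>, hence commutes with both and with \<open>C\<close>. But conjugation by
  \<open>C\<close> raises it to the power \<open>a\<close>, so its power \<open>a - 1\<close> is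
  trivial, and \<open>a - 1\<close> is 3 times a number prime to 3.\<close>

lemma A_pow_81: "A [^] (81::nat) = \<one>"
proof -
  obtain w t :: nat where wt: "A [^] (27 * w) \<otimes> B [^] t = \<one>" "\<not> 3 dvd w" using A_pow_81_aux by blast
  define z where "z = A [^] (27 * w)"
  have zc [simp]: "z \<in> carrier G" by (simp add: z_def)
  have zB: "z = inv (B [^] t)" using wt(1) by (simp add: z_def inv_equality)
  have cA: "z \<otimes> A = A \<otimes> z" using commute_nat_pow[of A A "27 * w" 1] by (simp add: z_def)
  have "B \<otimes> B [^] t = B [^] t \<otimes> B" using commute_nat_pow[of B B 1 t] by simp
  then have cB: "z \<otimes> B = B \<otimes> z" unfolding zB by (intro semiconj_inv) simp_all
  have "C = inv (B \<otimes> A) \<otimes> (A \<otimes> B)" using AB by (simp add: inv_solve_left)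
  moreover have "A \<in> {x \<in> carrier G. x \<otimes> z = z \<otimes> x}" "B \<in> {x \<in> carrier G. x \<otimes> z = z \<otimes> x}"
    using cA cB by simp_all
  ultimately have "C \<in> {x \<in> carrier G. x \<otimes> z = z \<otimes> x}"
    using centralizer_subgroup[OF zc] by (metis (no_types, lifting) subgroup.m_closed subgroup.m_inv_closed)
  then have "C \<otimes> z = C \<otimes> A [^] (27 * w * a)"
    using A_pow_C_pow[of "27 * w" 1] by (simp add: z_def)
  then have "A [^] (27 * w) = A [^] (27 * w * a)" by (simp add: z_def)
  also have "27 * w * a = 27 * w + 27 * w * (a - 1)" using a9 by (cases a) simp_all
  also have "A [^] (27 * w + 27 * w * (a - 1)) = A [^] (27 * w) \<otimes> A [^] (27 * w * (a - 1))"
    by (simp only: nat_pow_mult closed)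
  finally have "A [^] (27 * w) \<otimes> \<one> = A [^] (27 * w) \<otimes> A [^] (27 * w * (a - 1))" by simp
  then have "A [^] (27 * w * (a - 1)) = \<one>" by simp
  moreover have "a - 1 = 3 * ((a - 1) div 3)" "\<not> 3 dvd (a - 1) div 3" using a9 by presburger+
  ultimately obtain u where u: "A [^] (27 * w * (3 * u)) = \<one>" "\<not> 3 dvd u" by metis
  then have "A [^] (81 * (w * u)) = \<one>" by (simp add: ac_simps)
  moreover have "coprime (w * u) ((3::nat) ^ e)"
    using coprime_3_power[OF wt(2), of e] coprime_3_power[OF u(2), of e]
    by (simp only: coprime_mult_left_iff)
  ultimately show ?thesis using pow_coprime_cancel[of A 81 "w * u" "3 ^ e"] A_pow by simp
qed

lemma B_pow_81: "B [^] (81::nat) = \<one>"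
  by (rule macdonald_pair.A_pow_81[OF swap])

text \<open>Raising the relation with exponent \<open>27 * w\<close> to the power \<open>w\<close>
  normalizes it, since \<open>w * w\<close> is 1 modulo 3.\<close>

lemma A_pow_27_B_pow_27: "A [^] (27::nat) \<otimes> B [^] (27::nat) = \<one>"
proof -
  obtain w t :: nat where wt: "A [^] (27 * w) \<otimes> B [^] t = \<one>" "\<not> 3 dvd w" "[t = 27 * w] (mod 81)"
    using A_pow_81_aux by blast
  have "B [^] t = B [^] (27 * w)" by (rule pow_cong[OF _ B_pow_81 wt(3)]) simp
  then have "inv (B [^] (27 * w)) = A [^] (27 * w)" using wt(1) by (simp add: inv_equality)
  then have "(inv (B [^] (27 * w))) [^] w = (A [^] (27 * w)) [^] w" by simp
  then have eq: "inv (B [^] (27 * w * w)) = A [^] (27 * w * w)" by (simp add: nat_pow_inv nat_pow_pow)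
  have "w mod 3 = 1 \<or> w mod 3 = 2" using wt(2) by presburger
  then have "[w * w = 1] (mod 3)" by (auto simp: cong_def mod_mult_eq[of w 3 w, symmetric])
  then have "[27 * (w * w) = 27 * 1] (mod 27 * 3)" by (rule cong_cmult_leftI)
  then have c: "[27 * w * w = 27] (mod 81)" by (simp add: mult.assoc)
  have "A [^] (27 * w * w) = A [^] (27::nat)" "B [^] (27 * w * w) = B [^] (27::nat)"
    using pow_cong[OF _ A_pow_81 c] pow_cong[OF _ B_pow_81 c] by simp_all
  with eq show ?thesis by (metis closed(2) l_inv nat_pow_closed)
qed

lemma A_pow_27_commute_B: "A [^] (27::nat) \<otimes> B = B \<otimes> A [^] (27::nat)"
proof -
  have "A [^] (27::nat) = inv (B [^] (27::nat))" using A_pow_27_B_pow_27 by (simp add: inv_equality)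
  moreover have "B \<otimes> B [^] (27::nat) = B [^] (27::nat) \<otimes> B"
    using commute_nat_pow[of B B 1 27] by simp
  ultimately show ?thesis by (simp add: semiconj_inv)
qed

text \<open>In \<open>A_pow_B\<close> with exponent 27 the geometric sum is 27 modulo 81, so the
  powers of \<open>A\<close> on both sides agree. As \<open>A [^] 27\<close> commutes with
  \<open>B\<close>, the remaining factor \<open>C [^] 27\<close> is trivial.\<close>

lemma C_pow_27: "C [^] (27::nat) = \<one>"
proof -
  have "[gsum b (3 ^ 3) = 3 ^ 3] (mod 3 ^ Suc 3)" by (rule gsum_3_power[OF b3])
  then have "A [^] gsum b 27 = A [^] (27::nat)" using pow_cong[OF _ A_pow_81] by simp
  then have "B \<otimes> A [^] (27::nat) \<otimes> \<one> = B \<otimes> A [^] (27::nat) \<otimes> C [^] (27::nat)"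
    using A_pow_B[of 27] by (simp add: A_pow_27_commute_B m_assoc)
  then show ?thesis by simp
qed

end

section \<open>Commutators of powers with the generators\<close>

context macdonald_pair
begin

lemma commutator_A_B:
  assumes "gsum b q = q + r"
  shows "commutator G (A [^] q) B = A [^] r \<otimes> C [^] q"
  by (subst commutator_eq_iff) (simp_all add: A_pow_B assms nat_pow_mult [symmetric] m_assoc)

lemma commutator_C_A:
  assumes "b ^ q = 1 + r"
  shows "commutator G (C [^] q) A = A [^] (r * a ^ q)"
proof -
  have "C [^] q \<otimes> A = A \<otimes> (A [^] r \<otimes> C [^] q)"
    using C_pow_A_pow[of q 1]
    by (simp only: assms plus_1_eq_Suc nat_pow_Suc2 nat_pow_eone mult_1 m_assoc closed nat_pow_closed)
  also have "\<dots> = A \<otimes> C [^] q \<otimes> A [^] (r * a ^ q)" by (simp add: A_pow_C_pow m_assoc)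
  finally show ?thesis by (subst commutator_eq_iff) simp_all
qed

lemma commutator_C_B:
  assumes "a ^ q = 1 + r"
  shows "commutator G (C [^] q) B = B [^] (r * b ^ q)"
proof -
  have "C [^] q \<otimes> B = B \<otimes> (B [^] r \<otimes> C [^] q)"
    using C_pow_B_pow[of q 1]
    by (simp only: assms plus_1_eq_Suc nat_pow_Suc2 nat_pow_eone mult_1 m_assoc closed nat_pow_closed)
  also have "\<dots> = B \<otimes> C [^] q \<otimes> B [^] (r * b ^ q)" by (simp add: B_pow_C_pow m_assoc)
  finally show ?thesis by (subst commutator_eq_iff) simp_all
qed

end

section \<open>The upper central series\<close>

locale macdonald_3group = macdonald_pair +
  assumes gen: "generate G {A, B} = carrier G" and A27: "A [^] (27::nat) \<noteq> \<one>"
begin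

definition add_AB :: "nat \<Rightarrow> 'a set \<Rightarrow> 'a set"
  where "add_AB q N = generate G (insert (A [^] q) (insert (B [^] q) N))"

text \<open>The generator is inserted twice so that the layer has the two-generator form of
  \<open>generate_layer\<close> and \<open>generate_central\<close>.\<close>

definition add_C :: "nat \<Rightarrow> 'a set \<Rightarrow> 'a set"
  where "add_C q N = generate G (insert (C [^] q) (insert (C [^] q) N))"

lemma central_modI:
  assumes "N \<lhd> G" "x \<in> carrier G" "commutator G x A \<in> N" "commutator G x B \<in> N"
  shows "x \<in> central_mod G N"
  by (rule central_modI_generators[OF assms(1) _ gen assms(2)]) (use assms in auto)

lemma generate_central:
  assumes N: "N \<lhd> G" and xy: "x \<in> central_mod G N" "y \<in> central_mod G N"
  shows "N \<subseteq> generate G (insert x (insert y N))"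
    and "generate G (insert x (insert y N)) \<subseteq> central_mod G N"
    and "generate G (insert x (insert y N)) \<lhd> G"
proof -
  have sub: "insert x (insert y N) \<subseteq> central_mod G N"
    using normal_subset_central_mod[OF N] xy by auto
  then have subc: "insert x (insert y N) \<subseteq> carrier G" by (auto simp: central_mod_def)
  show 1: "N \<subseteq> generate G (insert x (insert y N))" by (auto intro: generate.incl)
  show 2: "generate G (insert x (insert y N)) \<subseteq> central_mod G N"
    by (rule generate_subgroup_incl[OF sub central_mod_subgroup[OF N]])
  show "generate G (insert x (insert y N)) \<lhd> G"
    by (rule normal_between_central_mod[OF N generate_is_subgroup[OF subc] 1 2])
qed

end

text \<open>One period of the upper central series, read upwards: modulo \<open>P\<close>, the elements
  \<open>A\<^sup>3\<^sup>q\<close>, \<open>B\<^sup>3\<^sup>q\<close> are central, then \<open>C\<^sup>q\<close>, and then \<open>A\<^sup>q\<close>, \<open>B\<^sup>q\<close>. That nothing else is central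
  follows from \<open>[C\<^sup>q, A] \<in> \<langle>A\<^sup>3\<^sup>q\<rangle>\<close> and \<open>[A\<^sup>q, B] \<in> \<langle>A\<^sup>3\<^sup>q\<rangle>C\<^sup>q\<close>.\<close>

locale macdonald_level = macdonald_3group +
  fixes k q :: nat and P R P' R' :: "'a set"
  assumes q: "q = 3 ^ k"
    and P: "P \<lhd> G" and cenP: "A [^] (3 * q) \<in> central_mod G P" "B [^] (3 * q) \<in> central_mod G P"
    and R: "R = add_AB (3 * q) P" and P': "P' = add_C q R" and R': "R' = add_AB q P'"
    and C3: "C [^] (3 * q) \<in> R"
    and nd: "\<And>i::int. (A [^] (3 * q)) [^] i \<in> P \<Longrightarrow> 3 dvd i"
begin

lemma level_R: "P \<subseteq> R" "R \<subseteq> central_mod G P" "R \<lhd> G"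
  unfolding R add_AB_def using generate_central[OF P cenP] by blast+

lemma A3_in_R: "A [^] (3 * q) \<in> R" and B3_in_R: "B [^] (3 * q) \<in> R"
  unfolding R add_AB_def by (auto intro: generate.incl)

lemma subgroup_R: "subgroup R G"
  by (rule normal_imp_subgroup[OF level_R(3)])

lemma pow_in_R: "x \<in> R \<Longrightarrow> x [^] (n::nat) \<in> R"
  using subgroup_int_pow_closed[OF subgroup_R, of x "int n"] by (simp add: int_pow_int)

text \<open>Since \<open>b ^ q - 1\<close> has valuation exactly \<open>k + 1\<close>, the exponent
  of \<open>A\<close> is \<open>3 * q\<close> times a number prime to 3. This is how nontriviality
  passes from \<open>A [^] (3 * q)\<close> to \<open>C [^] q\<close>.\<close>

lemma commutator_Cq_A: "\<exists>u. commutator G (C [^] q) A = (A [^] (3 * q)) [^] (u::nat) \<and> \<not> 3 dvd u"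
proof -
  obtain u where u: "b ^ q = 1 + 3 * q * u" "\<not> 3 dvd u"
    using cube_power_minus_1[of b k] b9 by (auto simp: q mult.commute)
  have "\<not> 3 dvd u * a ^ q"
    using u(2) a9 by (auto simp: prime_dvd_mult_iff dest!: prime_dvd_power[rotated]) presburger
  moreover have "commutator G (C [^] q) A = (A [^] (3 * q)) [^] (u * a ^ q)"
    using commutator_C_A[OF u(1)] by (simp add: nat_pow_pow mult.assoc)
  ultimately show ?thesis by blast
qed

lemma Cq_central: "C [^] q \<in> central_mod G R"
proof (rule central_modI[OF level_R(3)])
  obtain u where u: "commutator G (C [^] q) A = (A [^] (3 * q)) [^] (u::nat)"
    using commutator_Cq_A by blast
  then show "commutator G (C [^] q) A \<in> R" using A3_in_R by (simp add: pow_in_R)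
  obtain v where v: "a ^ q = 1 + 3 * q * v"
    using cube_power_minus_1[of a k] a9 by (auto simp: q mult.commute)
  have "commutator G (C [^] q) B = (B [^] (3 * q)) [^] (v * b ^ q)"
    using commutator_C_B[OF v] by (simp add: nat_pow_pow mult.assoc)
  then show "commutator G (C [^] q) B \<in> R" using B3_in_R by (simp add: pow_in_R)
qed simp

lemma level_P': "R \<subseteq> P'" "P' \<subseteq> central_mod G R" "P' \<lhd> G"
  unfolding P' add_C_def using generate_central[OF level_R(3) Cq_central Cq_central] by blast+

lemma Cq_in_P': "C [^] q \<in> P'"
  unfolding P' add_C_def by (auto intro: generate.incl)

lemma subgroup_P': "subgroup P' G"
  by (rule normal_imp_subgroup[OF level_P'(3)])

text \<open>The excess of the geometric sum over \<open>q\<close> is a multiple of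
  \<open>3 * q\<close>, so the commutator of \<open>A [^] q\<close> and \<open>B\<close> is
  \<open>C [^] q\<close> up to an element of \<open>R\<close>.\<close>

lemma gsum_q: "\<exists>r. gsum b q = q + 3 * q * r"
proof -
  have "[gsum b q = q] (mod 3 * q)" using gsum_3_power[OF b3, of k] by (simp add: q)
  moreover have "q \<le> gsum b q" using gsum_ge[of b q] b9 by (cases b) auto
  ultimately show ?thesis
    by (metis cong_to_1_nat cong_altdef_nat dvdE le_add_diff_inverse)
qed

lemma commutator_Aq_B: "\<exists>r::nat. commutator G (A [^] q) B = (A [^] (3 * q)) [^] r \<otimes> C [^] q"
  using gsum_q commutator_A_B[of q] by (metis nat_pow_pow closed(1))

lemma commutator_Bq_A: "\<exists>r::nat. commutator G (B [^] q) A = (B [^] (3 * q)) [^] r \<otimes> inv C [^] q"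
  using gsum_q macdonald_pair.commutator_A_B[OF swap, of q] by (metis nat_pow_pow closed(2))

lemma Aq_central: "A [^] q \<in> central_mod G P'" and Bq_central: "B [^] q \<in> central_mod G P'"
proof -
  have one: "\<one> \<in> P'" by (rule subgroup.one_closed[OF subgroup_P'])
  obtain r :: nat where r: "commutator G (A [^] q) B = (A [^] (3 * q)) [^] r \<otimes> C [^] q"
    using commutator_Aq_B by blast
  obtain s :: nat where s: "commutator G (B [^] q) A = (B [^] (3 * q)) [^] s \<otimes> inv C [^] q"
    using commutator_Bq_A by blast
  have c: "commutator G (A [^] q) A = \<one>" "commutator G (B [^] q) B = \<one>"
    using commute_nat_pow[of A A q 1] commute_nat_pow[of B B q 1] by (simp_all add: commutator_eq_one_iff)
  have "inv C [^] q \<in> P'"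
    using subgroup.m_inv_closed[OF subgroup_P' Cq_in_P'] by (simp add: nat_pow_inv)
  then have "commutator G (B [^] q) A \<in> P'" unfolding s
    using subgroup.m_closed[OF subgroup_P'] pow_in_R[OF B3_in_R] level_P'(1) by blast
  moreover have "commutator G (A [^] q) B \<in> P'" unfolding r
    using subgroup.m_closed[OF subgroup_P'] pow_in_R[OF A3_in_R] level_P'(1) Cq_in_P' by blast
  ultimately show "A [^] q \<in> central_mod G P'" "B [^] q \<in> central_mod G P'"
    using one by (auto intro!: central_modI[OF level_P'(3)] simp: c)
qed

lemma level_R': "P' \<subseteq> R'" "R' \<subseteq> central_mod G P'" "R' \<lhd> G"
  unfolding R' add_AB_def using generate_central[OF level_P'(3) Aq_central Bq_central] by blast+

text \<open>Additivity of commutators turns the assumption into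
  \<open>(A [^] (3 * q)) [^] (u * (i + j)) \<in> P\<close> with \<open>u\<close> prime to 3, and
  then \<open>nd\<close> applies. The two exponents stem from the doubled generator in
  \<open>add_C\<close>.\<close>

lemma dvd_if_C_central:
  assumes "n \<in> R" "commutator G ((C [^] q) [^] i \<otimes> (C [^] q) [^] j \<otimes> n) A \<in> P"
  shows "3 dvd (i + j :: int)"
proof -
  obtain u :: nat where u: "commutator G (C [^] q) A = (A [^] (3 * q)) [^] u" "\<not> 3 dvd u"
    using commutator_Cq_A by blast
  let ?W = "(A [^] (3 * q)) [^] u"
  have "subgroup (central_mod G P) G" by (rule central_mod_subgroup[OF P])
  from subgroup_int_pow_closed[OF this cenP(1), of "int u"]
  have W: "?W \<in> central_mod G P" by (simp add: int_pow_int)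
  have "n \<in> central_mod G P" using assms(1) level_R(2) by blast
  then have "n \<in> carrier G" "commutator G n A \<in> P" using central_mod_iff[OF P] by simp_all
  then have "?W [^] i \<otimes> ?W [^] j \<in> P"
    using commutator_layer[OF P, of "C [^] q" "C [^] q" n A i j] assms(2) W by (simp add: u(1))
  then have "(A [^] (3 * q)) [^] (int u * (i + j)) \<in> P"
    by (simp add: int_pow_mult [symmetric] int_pow_int [symmetric] int_pow_pow distrib_left mult.assoc)
  then have "3 dvd int u * (i + j)" by (rule nd)
  moreover have "\<not> 3 dvd int u" using u(2) by presburger
  ultimately show ?thesis using prime_dvd_mult_iff[of "3::int" "int u" "i + j"] by simp
qed

lemma C3_pow_in_R: "3 dvd (i::int) \<Longrightarrow> (C [^] q) [^] i \<in> R"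
proof (elim dvdE)
  fix l assume i: "i = 3 * l"
  have "(C [^] q) [^] i = (C [^] (3 * q)) [^] l"
    by (simp add: i int_pow_int [symmetric] int_pow_pow ac_simps)
  then show ?thesis using subgroup_int_pow_closed[OF subgroup_R C3] by simp
qed

lemma descend_P': "t \<in> P' \<Longrightarrow> t \<in> central_mod G P \<Longrightarrow> t \<in> R"
proof -
  assume t: "t \<in> P'" "t \<in> central_mod G P"
  obtain i j :: int and n where n: "n \<in> R" "t = (C [^] q) [^] i \<otimes> (C [^] q) [^] j \<otimes> n"
    using generate_layer[OF level_R(3) Cq_central Cq_central] t(1) unfolding P' add_C_def by blast
  have "commutator G t A \<in> P" using t(2) central_mod_iff[OF P] by simp
  then have "3 dvd i + j" using dvd_if_C_central[OF n(1)] n(2) by simp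
  then have "(C [^] q) [^] (i + j) \<in> R" by (rule C3_pow_in_R)
  then have "(C [^] q) [^] i \<otimes> (C [^] q) [^] j \<in> R" by (simp add: int_pow_mult)
  then show "t \<in> R" using n subgroup.m_closed[OF subgroup_R] by simp
qed

text \<open>Elements of \<open>R\<close> are central modulo \<open>P\<close>, so this is the
  previous criterion with a trivial remainder.\<close>

lemma dvd_if_C_pow_in_R:
  assumes "(C [^] q) [^] (i::int) \<in> R"
  shows "3 dvd i"
proof -
  have "commutator G ((C [^] q) [^] i) A \<in> P"
    using assms level_R(2) central_mod_iff[OF P] by (meson closed(1) subsetD)
  then show ?thesis using dvd_if_C_central[of \<one> i 0] subgroup.one_closed[OF subgroup_R] by simp
qed

text \<open>The commutator with \<open>B\<close> detects \<open>i\<close> and the one with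
  \<open>A\<close> detects \<open>j\<close>, because a power of a generator commutes with that
  generator. Modulo \<open>R\<close> they are powers of \<open>C [^] q\<close> and of its inverse,
  to which \<open>dvd_if_C_pow_in_R\<close> applies.\<close>

lemma dvd_if_A_B_central:
  assumes n: "n \<in> P'" and A: "commutator G ((A [^] q) [^] i \<otimes> (B [^] q) [^] j \<otimes> n) A \<in> R"
    and B: "commutator G ((A [^] q) [^] i \<otimes> (B [^] q) [^] j \<otimes> n) B \<in> R"
  shows "3 dvd (i::int) \<and> 3 dvd (j::int)"
proof
  interpret h: group_hom G "G Mod R" "\<lambda>x. R #> x" by (rule quotient_hom[OF level_R(3)])
  have sub: "subgroup (central_mod G R) G" by (rule central_mod_subgroup[OF level_R(3)])
  have one: "\<one> \<in> central_mod G R" by (rule subgroup.one_closed[OF sub])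
  have "n \<in> central_mod G R" using n level_P'(2) by blast
  then have nc: "n \<in> carrier G" and nA: "commutator G n A \<in> R" and nB: "commutator G n B \<in> R"
    using central_mod_iff[OF level_R(3)] by simp_all
  obtain r :: nat where r: "commutator G (A [^] q) B = (A [^] (3 * q)) [^] r \<otimes> C [^] q"
    using commutator_Aq_B by blast
  obtain s :: nat where s: "commutator G (B [^] q) A = (B [^] (3 * q)) [^] s \<otimes> inv C [^] q"
    using commutator_Bq_A by blast
  have c: "commutator G (A [^] q) A = \<one>" "commutator G (B [^] q) B = \<one>"
    using commute_nat_pow[of A A q 1] commute_nat_pow[of B B q 1] by (simp_all add: commutator_eq_one_iff)
  have cA: "(A [^] (3 * q)) [^] r \<otimes> C [^] q \<in> central_mod G R"
    using subgroup.m_closed[OF sub] Cq_central pow_in_R[OF A3_in_R]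
      normal_subset_central_mod[OF level_R(3)] by blast
  have cB: "(B [^] (3 * q)) [^] s \<otimes> inv C [^] q \<in> central_mod G R"
    using subgroup.m_closed[OF sub] subgroup.m_inv_closed[OF sub Cq_central] pow_in_R[OF B3_in_R]
      normal_subset_central_mod[OF level_R(3)] by (auto simp: nat_pow_inv)
  \<comment> \<open>A factor in \<open>R\<close> disappears in the quotient, so only the power of
    \<open>C\<close> remains.\<close>
  have drop: "y [^] l \<in> R" if "(x \<otimes> y) [^] l \<in> R" "x \<in> R" "y \<in> carrier G" for x y and l :: int
  proof -
    have xc: "x \<in> carrier G" using that(2) subgroup.mem_carrier[OF subgroup_R] by blast
    have "R #> x = \<one>\<^bsub>G Mod R\<^esub>" using that(2) quotient_one_iff[OF level_R(3) xc] by simp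
    then have "R #> (x \<otimes> y) = R #> y"
      using that(3) xc h.hom_mult[OF xc that(3)] h.hom_closed[OF that(3)] h.H.l_one by metis
    then have "R #> ((x \<otimes> y) [^] l) = R #> (y [^] l)"
      using that(3) xc h.hom_int_pow[of "x \<otimes> y" l] h.hom_int_pow[of y l] by (metis m_closed)
    then show ?thesis
      using that xc quotient_one_iff[OF level_R(3)] by (metis int_pow_closed m_closed)
  qed
  have "((A [^] (3 * q)) [^] r \<otimes> C [^] q) [^] i \<in> R"
    using commutator_layer[OF level_R(3), of "A [^] q" "B [^] q" n B i j] nc nB B one cA
    by (simp add: r c)
  then have "(C [^] q) [^] i \<in> R" using drop pow_in_R[OF A3_in_R] by simp
  then show "3 dvd i" by (rule dvd_if_C_pow_in_R)
  have "((B [^] (3 * q)) [^] s \<otimes> inv C [^] q) [^] j \<in> R"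
    using commutator_layer[OF level_R(3), of "A [^] q" "B [^] q" n A i j] nc nA A one cB
    by (simp add: s c)
  then have "(inv C [^] q) [^] j \<in> R" using drop pow_in_R[OF B3_in_R] by simp
  moreover have "(inv C [^] q) [^] j = (C [^] q) [^] (- j)"
    by (simp add: nat_pow_inv int_pow_inv int_pow_neg)
  ultimately have "3 dvd - j" by (metis dvd_if_C_pow_in_R)
  then show "3 dvd j" by simp
qed

text \<open>Elements of \<open>P'\<close> are central modulo \<open>R\<close>. With
  \<open>j = 0\<close> this is the condition \<open>nd\<close> for the next level.\<close>

lemma dvd_if_A_B_pow_in_P':
  assumes "(A [^] q) [^] (i::int) \<otimes> (B [^] q) [^] (j::int) \<in> P'"
  shows "3 dvd i \<and> 3 dvd j"
proof -
  have "(A [^] q) [^] i \<otimes> (B [^] q) [^] j \<in> central_mod G R" using assms level_P'(2) by blast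
  then show ?thesis
    using dvd_if_A_B_central[of \<one> i j] subgroup.one_closed[OF subgroup_P'] central_mod_iff[OF level_R(3)]
    by simp
qed

lemma descend_R': "t \<in> R' \<Longrightarrow> t \<in> central_mod G R \<Longrightarrow> t \<in> P'"
proof -
  assume t: "t \<in> R'" "t \<in> central_mod G R"
  obtain i j :: int and n where n: "n \<in> P'" "t = (A [^] q) [^] i \<otimes> (B [^] q) [^] j \<otimes> n"
    using generate_layer[OF level_P'(3) Aq_central Bq_central] t(1) unfolding R' add_AB_def by blast
  have "commutator G t A \<in> R" "commutator G t B \<in> R"
    using t(2) central_mod_iff[OF level_R(3)] by simp_all
  then have "3 dvd i \<and> 3 dvd j" using dvd_if_A_B_central[OF n(1)] n(2) by simp
  then obtain i' j' where ij: "i = 3 * i'" "j = 3 * j'" by (elim conjE dvdE)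
  have "(A [^] q) [^] i = (A [^] (3 * q)) [^] i'" "(B [^] q) [^] j = (B [^] (3 * q)) [^] j'"
    by (simp_all add: ij int_pow_int [symmetric] int_pow_pow ac_simps)
  then have "(A [^] q) [^] i \<in> P'" "(B [^] q) [^] j \<in> P'"
    using subgroup_int_pow_closed[OF subgroup_P'] A3_in_R B3_in_R level_P'(1) by (metis subsetD)+
  then show "t \<in> P'" using n subgroup.m_closed[OF subgroup_P'] by simp
qed

lemma Aq_in_R': "A [^] q \<in> R'" and Bq_in_R': "B [^] q \<in> R'"
  unfolding R' add_AB_def by (auto intro: generate.incl)

lemma cube_P':
  assumes "t \<in> P'"
  shows "t [^] (3::nat) \<in> R"
proof -
  interpret h: group_hom G "G Mod R" "\<lambda>x. R #> x" by (rule quotient_hom[OF level_R(3)])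
  obtain i j :: int and n where n: "n \<in> R" "t = (C [^] q) [^] i \<otimes> (C [^] q) [^] j \<otimes> n"
    using generate_layer[OF level_R(3) Cq_central Cq_central] assms unfolding P' add_C_def by blast
  have nc: "n \<in> carrier G" using n(1) subgroup.mem_carrier[OF subgroup_R] by blast
  have "R #> n = \<one>\<^bsub>G Mod R\<^esub>" using n(1) quotient_one_iff[OF level_R(3) nc] by simp
  moreover have t: "t = (C [^] q) [^] (i + j) \<otimes> n" using n(2) by (simp add: int_pow_mult)
  ultimately have "R #> t = R #> (C [^] q) [^] (i + j)"
    using h.hom_mult[of "(C [^] q) [^] (i + j)" n] nc h.hom_closed h.H.r_one
    by (metis closed(3) int_pow_closed nat_pow_closed)
  then have "R #> t [^] (3::nat) = R #> ((C [^] q) [^] (i + j)) [^] (3::nat)"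
    using h.hom_nat_pow[of t 3] h.hom_nat_pow[of "(C [^] q) [^] (i + j)" 3] t nc
    by (metis closed(3) int_pow_closed m_closed nat_pow_closed)
  also have "((C [^] q) [^] (i + j)) [^] (3::nat) = (C [^] q) [^] (3 * (i + j))"
    by (simp add: int_pow_int [symmetric] int_pow_pow ac_simps)
  also have "R #> \<dots> = \<one>\<^bsub>G Mod R\<^esub>"
    using quotient_one_iff[OF level_R(3)] C3_pow_in_R[of "3 * (i + j)"] by simp
  finally show ?thesis using quotient_one_iff[OF level_R(3)] t nc by simp
qed

text \<open>The commutator of \<open>B\<close> with \<open>A [^] q\<close> lies in
  \<open>P'\<close>, hence is central modulo \<open>R\<close>. So replacing \<open>B\<close> by its
  cube cubes the commutator modulo \<open>R\<close>, and cubes from \<open>P'\<close> lie in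
  \<open>R\<close>.\<close>

lemma commutator_B3_Aq: "commutator G (B [^] (3::nat)) (A [^] q) \<in> R"
proof -
  obtain r :: nat where r: "commutator G (A [^] q) B = (A [^] (3 * q)) [^] r \<otimes> C [^] q"
    using commutator_Aq_B by blast
  have "commutator G (A [^] q) B \<in> P'" unfolding r
    using subgroup.m_closed[OF subgroup_P'] pow_in_R[OF A3_in_R] level_P'(1) Cq_in_P' by blast
  moreover have "commutator G B (A [^] q) = inv (commutator G (A [^] q) B)"
    by (simp add: commutator_def inv_mult_group m_assoc)
  ultimately have w: "commutator G B (A [^] q) \<in> P'"
    using subgroup.m_inv_closed[OF subgroup_P'] by simp
  have one: "\<one> \<in> R" by (rule subgroup.one_closed[OF subgroup_R])
  have c1: "commutator G \<one> (A [^] q) = \<one>" by (simp add: commutator_eq_one_iff)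
  \<comment> \<open>Trivial factors pad the word to the shape of
    \<open>commutator_layer\<close>.\<close>
  have "commutator G (B [^] (3::int) \<otimes> \<one> [^] (0::int) \<otimes> \<one>) (A [^] q) \<in> R"
    using commutator_layer[OF level_R(3), of B \<one> \<one> "A [^] q" 3 0] w level_P'(2) one cube_P'[OF w]
      normal_subset_central_mod[OF level_R(3)] int_pow_int[of G "commutator G B (A [^] q)" 3]
    by (auto simp: c1 subset_iff)
  then show ?thesis using int_pow_int[of G B 3] by simp
qed

end

section \<open>Subgroups whose generators commute modulo a normal subgroup\<close>

context group
begin

lemma generate_commute:
  assumes S: "S \<subseteq> carrier G" and comm: "\<And>s t. s \<in> S \<Longrightarrow> t \<in> S \<Longrightarrow> s \<otimes> t = t \<otimes> s"
    and xy: "x \<in> generate G S" "y \<in> generate G S"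
  shows "x \<otimes> y = y \<otimes> x"
proof -
  have 1: "u \<otimes> s = s \<otimes> u" if "u \<in> generate G S" "s \<in> S" for u s
  proof -
    have "generate G S \<subseteq> {x \<in> carrier G. x \<otimes> s = s \<otimes> x}"
      by (rule generate_subgroup_incl) (use S comm that centralizer_subgroup in auto)
    then show ?thesis using that by blast
  qed
  have xc: "x \<in> carrier G" using xy(1) generate_in_carrier[OF S] by blast
  have "generate G S \<subseteq> {y \<in> carrier G. y \<otimes> x = x \<otimes> y}"
    by (rule generate_subgroup_incl) (use S 1[OF xy(1)] centralizer_subgroup[OF xc] in auto)
  then show ?thesis using xy by auto
qed

lemma generate_commute_pow:
  fixes n :: nat
  assumes S: "S \<subseteq> carrier G" and comm: "\<And>s t. s \<in> S \<Longrightarrow> t \<in> S \<Longrightarrow> s \<otimes> t = t \<otimes> s"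
    and pow: "\<And>s. s \<in> S \<Longrightarrow> s [^] n = \<one>" and x: "x \<in> generate G S"
  shows "x [^] n = \<one>"
  using x
proof (induction rule: generate.induct)
  case (inv s)
  then show ?case using S pow[OF inv] by (auto simp: nat_pow_inv)
next
  case (eng s t)
  then have "s \<in> carrier G" "t \<in> carrier G" using generate_in_carrier[OF S] by auto
  moreover have "s \<otimes> t = t \<otimes> s" by (rule generate_commute[OF S comm eng(1,2)])
  ultimately show ?case using eng.IH pow_mult_distrib by simp
qed (use pow in simp_all)

lemma generate_commute_mod:
  fixes n :: nat
  assumes N: "N \<lhd> G" and S: "S \<subseteq> carrier G"
    and comm: "\<And>s t. s \<in> S \<Longrightarrow> t \<in> S \<Longrightarrow> commutator G s t \<in> N"
    and pow: "\<And>s. s \<in> S \<Longrightarrow> s [^] n \<in> N" and x: "x \<in> generate G S"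
  shows "x [^] n \<in> N"
proof -
  define Q where "Q = G Mod N"
  define h where "h = (\<lambda>x. N #> x)"
  interpret h: group_hom G Q h unfolding Q_def h_def by (rule quotient_hom[OF N])
  have one: "h u = \<one>\<^bsub>Q\<^esub> \<longleftrightarrow> u \<in> N" if "u \<in> carrier G" for u
    unfolding h_def Q_def using quotient_one_iff[OF N that] .
  have xc: "x \<in> carrier G" using x generate_in_carrier[OF S] by blast
  have "h x [^]\<^bsub>Q\<^esub> n = \<one>\<^bsub>Q\<^esub>"
  proof (rule h.H.generate_commute_pow)
    show "h ` S \<subseteq> carrier Q" using S h.hom_closed by blast
    show "h x \<in> generate Q (h ` S)" using h.generate_img[OF S] x by blast
  next
    fix s t assume "s \<in> h ` S" "t \<in> h ` S"
    then obtain s' t' where st: "s' \<in> S" "s = h s'" "t' \<in> S" "t = h t'" by blast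
    then have "s' \<in> carrier G" "t' \<in> carrier G" using S by blast+
    from commutator_in_normal_iff[OF N this] show "s \<otimes>\<^bsub>Q\<^esub> t = t \<otimes>\<^bsub>Q\<^esub> s"
      using comm[OF st(1,3)] unfolding st(2,4) Q_def h_def by blast
  next
    fix s assume "s \<in> h ` S"
    then obtain s' where s': "s' \<in> S" "s = h s'" by blast
    then have "s' \<in> carrier G" using S by blast
    then show "s [^]\<^bsub>Q\<^esub> n = \<one>\<^bsub>Q\<^esub>"
      unfolding s'(2) using pow[OF s'(1)] one h.hom_nat_pow by (metis nat_pow_closed)
  qed
  then show ?thesis using one xc h.hom_nat_pow by (metis nat_pow_closed)
qed

lemma pow_in_subgroup:
  assumes "subgroup H G" "x \<in> H"
  shows "x [^] (n::nat) \<in> H"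
  using subgroup_int_pow_closed[OF assms, of "int n"] by (simp add: int_pow_int)

lemma generate_pow_set:
  assumes "subgroup H G" "generate G S = H" "S \<subseteq> {t [^] n | t. t \<in> carrier G}"
    "\<And>t. t \<in> carrier G \<Longrightarrow> t [^] n \<in> H"
  shows "power_subgroup G n = H"
proof
  show "power_subgroup G n \<subseteq> H" unfolding power_subgroup_def
    by (rule generate_subgroup_incl[OF _ assms(1)]) (use assms(4) in auto)
  show "H \<subseteq> power_subgroup G n" unfolding power_subgroup_def assms(2)[symmetric]
    by (rule mono_generate[OF assms(3)])
qed

lemma commutator_swap:
  "x \<in> carrier G \<Longrightarrow> y \<in> carrier G \<Longrightarrow> commutator G y x = inv (commutator G x y)"
  by (simp add: commutator_def inv_mult_group m_assoc)

end

section \<open>The chain from the trivial group to the whole group\<close>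

context macdonald_3group
begin

definition "M1 = add_AB 27 {\<one>}"
definition "M2 = add_C 9 M1"
definition "M3 = add_AB 9 M2"
definition "M4 = add_C 3 M3"
definition "M5 = add_AB 3 M4"
definition "M6 = add_C 1 M5"
definition "M7 = add_AB 1 M6"

text \<open>At the bottom, \<open>nd\<close> says that the central element \<open>A [^] 27\<close>
  has order exactly 3. Its cube is trivial, so a Bezout relation between \<open>i\<close> and 3
  would make it trivial itself if 3 did not divide \<open>i\<close>.\<close>

lemma level2: "macdonald_level G A B C a b e 2 9 {\<one>} M1 M2 M3"
proof (intro macdonald_level.intro macdonald_level_axioms.intro macdonald_3group_axioms)
  have [simp]: "A [^] (27::nat) \<otimes> A = A \<otimes> A [^] (27::nat)" "B [^] (27::nat) \<otimes> B = B \<otimes> B [^] (27::nat)"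
    using commute_nat_pow[of A A 27 1] commute_nat_pow[of B B 27 1] by simp_all
  have [simp]: "B [^] (27::nat) \<otimes> A = A \<otimes> B [^] (27::nat)"
    by (rule macdonald_pair.A_pow_27_commute_B[OF swap])
  show "A [^] (3 * 9 :: nat) \<in> central_mod G {\<one>}" "B [^] (3 * 9 :: nat) \<in> central_mod G {\<one>}"
    by (auto intro!: central_modI one_is_normal simp: commutator_eq_one_iff A_pow_27_commute_B)
  show "C [^] (3 * 9 :: nat) \<in> M1"
    by (simp add: C_pow_27 M1_def add_AB_def generate.one)
  show "3 dvd i" if i: "(A [^] (3 * 9 :: nat)) [^] i \<in> {\<one>}" for i :: int
  proof (rule ccontr)
    assume "\<not> 3 dvd i"
    then have "coprime i 3" using prime_imp_coprime[of "3::int" i] by (simp add: coprime_commute)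
    then obtain u v where uv: "u * i + v * 3 = 1" using bezout_int[of i 3] coprime_imp_gcd_eq_1 by metis
    have 3: "(A [^] (27::nat)) [^] (3::int) = \<one>"
      using A_pow_81 int_pow_int[of G "A [^] (27::nat)" 3] by (simp add: nat_pow_pow)
    have "A [^] (27::nat) = (A [^] (27::nat)) [^] (i * u + 3 * v)" using uv by (simp add: mult.commute)
    also have "\<dots> = ((A [^] (27::nat)) [^] i) [^] u \<otimes> ((A [^] (27::nat)) [^] (3::int)) [^] v"
      by (simp add: int_pow_mult int_pow_pow)
    also have "\<dots> = \<one>" using i by (simp add: 3)
    finally show False using A27 by simp
  qed
qed (simp_all add: one_is_normal M1_def M2_def M3_def)

interpretation L2: macdonald_level G A B C a b e 2 9 "{\<one>}" M1 M2 M3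
  by (rule level2)

text \<open>Consecutive levels overlap: \<open>P'\<close> and \<open>R'\<close> of the level below
  are \<open>P\<close> and \<open>R\<close> here. Each level thus contributes two of the six descent
  conditions of the chain.\<close>

lemma level1: "macdonald_level G A B C a b e 1 3 M2 M3 M4 M5"
proof (intro macdonald_level.intro macdonald_level_axioms.intro macdonald_3group_axioms)
  show "M2 \<lhd> G" by (rule L2.level_P'(3))
  show "A [^] (3 * 3 :: nat) \<in> central_mod G M2" "B [^] (3 * 3 :: nat) \<in> central_mod G M2"
    using L2.Aq_central L2.Bq_central by simp_all
  show "C [^] (3 * 3 :: nat) \<in> M3" using L2.Cq_in_P' L2.level_R'(1) by auto
  \<comment> \<open>Nontriviality is handed over from the level below.\<close>
  show "3 dvd i" if "(A [^] (3 * 3 :: nat)) [^] i \<in> M2" for i :: int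
    using L2.dvd_if_A_B_pow_in_P'[of i 0] that by simp
qed (simp_all add: M3_def M4_def M5_def)

interpretation L1: macdonald_level G A B C a b e 1 3 M2 M3 M4 M5
  by (rule level1)

lemma level0: "macdonald_level G A B C a b e 0 1 M4 M5 M6 M7"
proof (intro macdonald_level.intro macdonald_level_axioms.intro macdonald_3group_axioms)
  show "M4 \<lhd> G" by (rule L1.level_P'(3))
  show "A [^] (3 * 1 :: nat) \<in> central_mod G M4" "B [^] (3 * 1 :: nat) \<in> central_mod G M4"
    using L1.Aq_central L1.Bq_central by simp_all
  show "C [^] (3 * 1 :: nat) \<in> M5" using L1.Cq_in_P' L1.level_R'(1) by auto
  show "3 dvd i" if "(A [^] (3 * 1 :: nat)) [^] i \<in> M4" for i :: int
    using L1.dvd_if_A_B_pow_in_P'[of i 0] that by simp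
qed (simp_all add: M5_def M6_def M7_def)

interpretation L0: macdonald_level G A B C a b e 0 1 M4 M5 M6 M7
  by (rule level0)

lemma M7: "M7 = carrier G"
proof
  show "M7 \<subseteq> carrier G" using L0.level_R'(2) central_mod_closed by blast
  have "{A, B} \<subseteq> M7" using L0.Aq_in_R' L0.Bq_in_R' by simp
  from generate_subgroup_incl[OF this normal_imp_subgroup[OF L0.level_R'(3)]]
  show "carrier G \<subseteq> M7" by (simp add: gen)
qed

lemma upper_central_chain:
  "i \<le> 7 \<Longrightarrow> upper_central G i = [{\<one>}, M1, M2, M3, M4, M5, M6, M7] ! i"
proof (rule upper_central_eq_chain[where n = 7])
  let ?M = "\<lambda>i. [{\<one>}, M1, M2, M3, M4, M5, M6, M7] ! i"
  have 7: "i = 0 \<or> i = 1 \<or> i = 2 \<or> i = 3 \<or> i = 4 \<or> i = 5 \<or> i = 6" if "i < 7" for i :: nat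
    using that by linarith
  have 6: "i = 0 \<or> i = 1 \<or> i = 2 \<or> i = 3 \<or> i = 4 \<or> i = 5" if "Suc (Suc i) \<le> 7" for i :: nat
    using that by linarith
  show "?M i \<lhd> G" if "i \<le> 7" for i
    using that 7[of i] one_is_normal L2.level_R(3) L2.level_P'(3) L2.level_R'(3) L1.level_P'(3)
      L1.level_R'(3) L0.level_P'(3) L0.level_R'(3) by (cases "i = 7") auto
  show "?M i \<subseteq> ?M (Suc i)" if "i < 7" for i
    using 7[OF that] L2.level_R(1) L2.level_P'(1) L2.level_R'(1) L1.level_P'(1)
      L1.level_R'(1) L0.level_P'(1) L0.level_R'(1) by (elim disjE) simp_all
  show "?M (Suc i) \<subseteq> central_mod G (?M i)" if "i < 7" for i
    using 7[OF that] L2.level_R(2) L2.level_P'(2) L2.level_R'(2) L1.level_P'(2)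
      L1.level_R'(2) L0.level_P'(2) L0.level_R'(2) by (elim disjE) simp_all
  show "t \<in> ?M (Suc i)" if "Suc (Suc i) \<le> 7" "t \<in> ?M (Suc (Suc i))" "t \<in> central_mod G (?M i)" for i t
    using 6[OF that(1)] that(2,3) L2.descend_P'[of t] L2.descend_R'[of t] L1.descend_P'[of t]
      L1.descend_R'[of t] L0.descend_P'[of t] L0.descend_R'[of t] by (elim disjE) simp_all
qed (simp_all add: M7)

lemma center_eq: "center G = M1"
proof -
  have "center G = central_mod G {\<one>}"
    by (auto simp: central_mod_iff[OF one_is_normal] center_def commutator_eq_one_iff)
  then show ?thesis using upper_central_chain[of 1] by (simp add: central_mod_def)
qed

lemma M1_eq: "M1 = generate G {A [^] (27::nat)}"
proof
  have sub: "subgroup (generate G {A [^] (27::nat)}) G" by (rule generate_is_subgroup) simp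
  have A: "A [^] (27::nat) \<in> generate G {A [^] (27::nat)}" by (simp add: generate.incl)
  have "A [^] (27::nat) = inv (B [^] (27::nat))" using A_pow_27_B_pow_27 by (simp add: inv_equality)
  then have "B [^] (27::nat) = inv (A [^] (27::nat))" by simp
  then have "B [^] (27::nat) \<in> generate G {A [^] (27::nat)}" using subgroup.m_inv_closed[OF sub A] by simp
  then show "M1 \<subseteq> generate G {A [^] (27::nat)}" unfolding M1_def add_AB_def
    using A subgroup.one_closed[OF sub] by (intro generate_subgroup_incl sub) auto
  show "generate G {A [^] (27::nat)} \<subseteq> M1" unfolding M1_def add_AB_def
    by (intro mono_generate) auto
qed

lemma M3_eq: "M3 = generate G {A [^] (9::nat), B [^] (9::nat), C [^] (9::nat)}" (is "_ = ?X")
proof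
  have sub: "subgroup ?X G" by (rule generate_is_subgroup) auto
  have gens: "A [^] (9::nat) \<in> ?X" "B [^] (9::nat) \<in> ?X" "C [^] (9::nat) \<in> ?X"
    by (auto intro: generate.incl)
  have "A [^] (27::nat) \<in> ?X" using pow_in_subgroup[OF sub gens(1), of 3] by (simp add: nat_pow_pow)
  then have "M1 \<subseteq> ?X" unfolding M1_eq by (intro generate_subgroup_incl sub) auto
  then have "M2 \<subseteq> ?X" unfolding M2_def add_C_def using gens by (intro generate_subgroup_incl sub) auto
  then show "M3 \<subseteq> ?X" unfolding M3_def add_AB_def using gens by (intro generate_subgroup_incl sub) auto
  show "?X \<subseteq> M3"
    using L2.Aq_in_R' L2.Bq_in_R' L2.Cq_in_P' L2.level_R'(1)
    by (intro generate_subgroup_incl normal_imp_subgroup[OF L2.level_R'(3)]) auto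
qed

lemma M5_eq: "M5 = generate G {A [^] (3::nat), B [^] (3::nat), C [^] (3::nat)}" (is "_ = ?X")
proof
  have sub: "subgroup ?X G" by (rule generate_is_subgroup) auto
  have gens: "A [^] (3::nat) \<in> ?X" "B [^] (3::nat) \<in> ?X" "C [^] (3::nat) \<in> ?X"
    by (auto intro: generate.incl)
  have "A [^] (9::nat) \<in> ?X" "B [^] (9::nat) \<in> ?X" "C [^] (9::nat) \<in> ?X"
    using pow_in_subgroup[OF sub gens(1), of 3] pow_in_subgroup[OF sub gens(2), of 3]
      pow_in_subgroup[OF sub gens(3), of 3] by (simp_all add: nat_pow_pow)
  then have "M3 \<subseteq> ?X" unfolding M3_eq by (intro generate_subgroup_incl sub) auto
  then have "M4 \<subseteq> ?X" unfolding M4_def add_C_def using gens by (intro generate_subgroup_incl sub) auto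
  then show "M5 \<subseteq> ?X" unfolding M5_def add_AB_def using gens by (intro generate_subgroup_incl sub) auto
  show "?X \<subseteq> M5"
    using L1.Aq_in_R' L1.Bq_in_R' L1.Cq_in_P' L1.level_R'(1)
    by (intro generate_subgroup_incl normal_imp_subgroup[OF L1.level_R'(3)]) auto
qed

text \<open>Conjugation by \<open>C [^] 9\<close> raises \<open>A\<close> to the power
  \<open>a ^ 9\<close>, which is 1 modulo 27. On ninth powers only \<open>9 * a ^ 9\<close> modulo
  81 counts, so it acts trivially; the same holds for \<open>B\<close> and \<open>b\<close>.\<close>

lemma A9_C9: "A [^] (9::nat) \<otimes> C [^] (9::nat) = C [^] (9::nat) \<otimes> A [^] (9::nat)"
  and B9_C9: "B [^] (9::nat) \<otimes> C [^] (9::nat) = C [^] (9::nat) \<otimes> B [^] (9::nat)"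
proof -
  have *: "[9 * c ^ 9 = 9] (mod 81)" if "c mod 9 = 4 \<or> c mod 9 = 7" for c :: nat
  proof -
    have "\<exists>u. c ^ 9 = 1 + 27 * u" using cube_power_minus_1[OF that, of 2] by auto
    then obtain u where "c ^ 9 = 1 + 27 * u" ..
    then have "9 * c ^ 9 = 9 + 81 * (3 * u)" by simp
    then show ?thesis by (simp only: cong_def mod_mult_self2)
  qed
  show "A [^] (9::nat) \<otimes> C [^] (9::nat) = C [^] (9::nat) \<otimes> A [^] (9::nat)"
    using A_pow_C_pow[of 9 9] pow_cong[OF _ A_pow_81 *[of a]] a9 by simp
  show "B [^] (9::nat) \<otimes> C [^] (9::nat) = C [^] (9::nat) \<otimes> B [^] (9::nat)"
    using B_pow_C_pow[of 9 9] pow_cong[OF _ B_pow_81 *[of b]] b9 by simp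
qed

lemma M1_cube: "t \<in> M1 \<Longrightarrow> t [^] (3::nat) = \<one>"
  unfolding M1_eq using A_pow_81
  by (elim generate_commute_pow[rotated -1]) (auto simp: nat_pow_pow)

text \<open>The commutator of \<open>B [^] 3\<close> and \<open>A [^] 9\<close> lies in the central
  subgroup \<open>M1\<close>, all of whose cubes are trivial. Passing from \<open>B [^] 3\<close> to
  \<open>B [^] 9\<close> cubes it.\<close>

lemma A9_B9: "A [^] (9::nat) \<otimes> B [^] (9::nat) = B [^] (9::nat) \<otimes> A [^] (9::nat)"
proof -
  let ?w = "commutator G (B [^] (3::nat)) (A [^] (9::nat))"
  have w: "?w \<in> M1" by (rule L2.commutator_B3_Aq)
  have c1: "commutator G \<one> (A [^] (9::nat)) = \<one>" by (simp add: commutator_eq_one_iff)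
  have "commutator G ((B [^] (3::nat)) [^] (3::int) \<otimes> \<one> [^] (0::int) \<otimes> \<one>) (A [^] (9::nat)) \<in> {\<one>}"
    using commutator_layer[OF one_is_normal, of "B [^] (3::nat)" \<one> \<one> "A [^] (9::nat)" 3 0] w
      L2.level_R(2) normal_subset_central_mod[OF one_is_normal] M1_cube[OF w] int_pow_int[of G ?w 3]
    by (auto simp: c1)
  then have "commutator G (B [^] (9::nat)) (A [^] (9::nat)) = \<one>"
    using int_pow_int[of G "B [^] (3::nat)" 3] by (simp add: nat_pow_pow)
  then show ?thesis by (simp add: commutator_eq_one_iff)
qed

lemma M3_commute: "x \<in> M3 \<Longrightarrow> y \<in> M3 \<Longrightarrow> x \<otimes> y = y \<otimes> x"
  unfolding M3_eq by (rule generate_commute) (auto simp: A9_B9 A9_C9 B9_C9)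

lemma M3_cube:
  assumes "t \<in> M3"
  shows "t [^] (3::nat) \<in> M1"
proof (rule generate_commute_mod[OF L2.level_R(3)])
  let ?S = "{A [^] (9::nat), B [^] (9::nat), C [^] (9::nat)}"
  show "t \<in> generate G ?S" using assms by (simp add: M3_eq)
  show "commutator G s t \<in> M1" if "s \<in> ?S" "t \<in> ?S" for s t
  proof -
    have "commutator G s t = \<one>" using that by (auto simp: commutator_eq_one_iff A9_B9 A9_C9 B9_C9)
    then show ?thesis using subgroup.one_closed[OF L2.subgroup_R] by simp
  qed
  show "s [^] (3::nat) \<in> M1" if "s \<in> ?S" for s
    using that L2.A3_in_R L2.B3_in_R L2.C3 by (auto simp: nat_pow_pow)
qed simp

lemma A3B3C3_commutator:
  assumes "s \<in> {A [^] (3::nat), B [^] (3::nat), C [^] (3::nat)}"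
    "t \<in> {A [^] (3::nat), B [^] (3::nat), C [^] (3::nat)}"
  shows "commutator G s t \<in> M3"
proof -
  have one: "\<one> \<in> M3" by (rule subgroup.one_closed[OF L1.subgroup_R])
  have inv: "commutator G y x \<in> M3" if "commutator G x y \<in> M3" "x \<in> carrier G" "y \<in> carrier G" for x y
    using subgroup.m_inv_closed[OF L1.subgroup_R that(1)] commutator_swap[OF that(2,3)] by simp
  have self: "commutator G x x = \<one>" if "x \<in> carrier G" for x
    using that by (simp add: commutator_eq_one_iff)
  have "C [^] (3::nat) \<in> central_mod G M3" by (rule L1.Cq_central)
  then have C: "commutator G (C [^] (3::nat)) x \<in> M3" if "x \<in> carrier G" for x
    using that central_mod_iff[OF L1.level_R(3)] by blast
  show ?thesis using assms L1.commutator_B3_Aq C one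
    by (auto simp: self intro: inv)
qed

text \<open>The three generators of \<open>M5\<close> commute modulo \<open>M3\<close> and have
  their cubes in \<open>M3\<close>, so their cubes decide for the whole subgroup.\<close>

lemma M5_cube: "t \<in> M5 \<Longrightarrow> t [^] (3::nat) \<in> M3"
  unfolding M5_eq
proof (rule generate_commute_mod[OF L1.level_R(3)])
  show "s [^] (3::nat) \<in> M3" if "s \<in> {A [^] (3::nat), B [^] (3::nat), C [^] (3::nat)}" for s
    using that L1.A3_in_R L1.B3_in_R L1.C3 by (auto simp: nat_pow_pow)
qed (auto intro: A3B3C3_commutator)

lemma order_A: "A [^] (n::nat) = \<one> \<longleftrightarrow> 81 dvd n"
proof -
  have "ord A dvd 3 ^ 4" using A_pow_81 pow_eq_id[of A 81] by simp
  then obtain i where i: "i \<le> 4" "ord A = 3 ^ i" using divides_primepow_nat[of 3 "ord A" 4] by auto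
  have "\<not> 3 ^ i dvd (3::nat) ^ 3" using A27 pow_eq_id[of A 27] i(2) by simp
  then have "\<not> i \<le> 3" using le_imp_power_dvd by blast
  then have "i = 4" using i(1) by linarith
  then show ?thesis using pow_eq_id[of A n] i(2) by simp
qed

lemma M5_decompose:
  assumes "t \<in> M5"
  shows "\<exists>(i::int) (j::int) (k::int). \<exists>n \<in> M3.
    t = (A [^] (3::nat)) [^] i \<otimes> (B [^] (3::nat)) [^] j \<otimes> ((C [^] (3::nat)) [^] k \<otimes> n)"
proof -
  obtain i j :: int and m where m: "m \<in> M4" "t = (A [^] (3::nat)) [^] i \<otimes> (B [^] (3::nat)) [^] j \<otimes> m"
    using generate_layer[OF L1.level_P'(3) L1.Aq_central L1.Bq_central] assms
    unfolding M5_def add_AB_def by blast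
  obtain k l :: int and n where "n \<in> M3" "m = (C [^] (3::nat)) [^] k \<otimes> (C [^] (3::nat)) [^] l \<otimes> n"
    using generate_layer[OF L1.level_R(3) L1.Cq_central L1.Cq_central] m(1)
    unfolding M4_def add_C_def by blast
  then show ?thesis using m(2) by (metis int_pow_mult closed(3) nat_pow_closed)
qed

lemma decompose:
  assumes "t \<in> carrier G"
  shows "\<exists>(i::int) (j::int) (k::int). \<exists>n \<in> M5. t = A [^] i \<otimes> B [^] j \<otimes> (C [^] k \<otimes> n)"
proof -
  have t: "t \<in> M7" using assms M7 by simp
  obtain i j :: int and m where m: "m \<in> M6" "t = A [^] i \<otimes> B [^] j \<otimes> m"
    using generate_layer[OF L0.level_P'(3) L0.Aq_central L0.Bq_central] t
    unfolding M7_def add_AB_def by (simp only: nat_pow_eone closed) blast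
  obtain k l :: int and n where "n \<in> M5" "m = C [^] k \<otimes> C [^] l \<otimes> n"
    using generate_layer[OF L0.level_R(3) L0.Cq_central L0.Cq_central] m(1)
    unfolding M6_def add_C_def by (simp only: nat_pow_eone closed) blast
  then show ?thesis using m(2) by (metis int_pow_mult closed(3))
qed

lemma normal_M3: "M3 \<lhd> G" and normal_M5: "M5 \<lhd> G" and M3_sub_M5: "M3 \<subseteq> M5"
  and subgroup_M1: "subgroup M1 G"
  using L1.level_R(3) L0.level_R(3) L1.level_P'(1) L1.level_R'(1) L2.subgroup_R by blast+

text \<open>Modulo \<open>M4\<close> the factor with \<open>C\<close> vanishes and 3 divides
  \<open>i\<close> and \<open>j\<close>. Then the factors with \<open>A\<close> and \<open>B\<close>
  already lie in \<open>M3\<close>, which leaves a power of \<open>C [^] 3\<close> in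
  \<open>M3\<close>.\<close>

lemma independent_mod_M3:
  assumes "(A [^] (3::nat)) [^] (i::int) \<otimes> (B [^] (3::nat)) [^] (j::int) \<otimes> (C [^] (3::nat)) [^] (k::int) \<in> M3"
  shows "3 dvd i \<and> 3 dvd j \<and> 3 dvd k"
proof -
  let ?x = "(A [^] (3::nat)) [^] i" and ?y = "(B [^] (3::nat)) [^] j" and ?z = "(C [^] (3::nat)) [^] k"
  have z: "?z \<in> M4" by (rule subgroup_int_pow_closed[OF L1.subgroup_P' L1.Cq_in_P'])
  have "?x \<otimes> ?y \<otimes> ?z \<in> M4" using assms L1.level_P'(1) by blast
  then have "?x \<otimes> ?y \<otimes> ?z \<otimes> inv ?z \<in> M4"
    using z subgroup.m_closed[OF L1.subgroup_P'] subgroup.m_inv_closed[OF L1.subgroup_P'] by blast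
  then have "?x \<otimes> ?y \<in> M4" by (simp add: m_assoc)
  then have ij: "3 dvd i \<and> 3 dvd j" by (rule L1.dvd_if_A_B_pow_in_P')
  then obtain i' j' where e: "i = 3 * i'" "j = 3 * j'" by (elim conjE dvdE)
  have "?x = (A [^] (3 * 3 :: nat)) [^] i'" "?y = (B [^] (3 * 3 :: nat)) [^] j'"
    by (simp_all only: e int_pow_int [symmetric] int_pow_pow closed of_nat_mult of_nat_numeral mult.assoc)
  then have "?x \<in> M3" "?y \<in> M3"
    using subgroup_int_pow_closed[OF L1.subgroup_R] L1.A3_in_R L1.B3_in_R by metis+
  then have "inv (?x \<otimes> ?y) \<otimes> (?x \<otimes> ?y \<otimes> ?z) \<in> M3"
    using assms subgroup.m_closed[OF L1.subgroup_R] subgroup.m_inv_closed[OF L1.subgroup_R] by blast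
  also have "inv (?x \<otimes> ?y) \<otimes> (?x \<otimes> ?y \<otimes> ?z) = ?z"
    by (metis closed int_pow_closed nat_pow_closed m_closed inv_closed l_inv l_one m_assoc)
  finally have "3 dvd k" by (rule L1.dvd_if_C_pow_in_R)
  then show ?thesis using ij by blast
qed

lemma cubes_in_M3: "(A [^] (3::nat)) [^] (3::nat) \<in> M3" "(B [^] (3::nat)) [^] (3::nat) \<in> M3"
    "(C [^] (3::nat)) [^] (3::nat) \<in> M3"
  using L1.A3_in_R L1.B3_in_R L1.C3 by (simp_all add: nat_pow_pow)

end

section \<open>The quotients\<close>

text \<open>Coordinates on the Heisenberg group: \<open>x\<close> and \<open>y\<close> sit above the
  diagonal and \<open>z\<close> in the corner, where products pick up the bilinear term
  \<open>x * y'\<close>.\<close>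

definition heis_elem :: "'a::comm_ring_1 \<Rightarrow> 'a \<Rightarrow> 'a \<Rightarrow> 'a ^ 3 ^ 3"
  where "heis_elem x y z = (\<chi> i j. if i = j then 1 else if i = 1 \<and> j = 2 then x
    else if i = 2 \<and> j = 3 then y else if i = 1 \<and> j = 3 then z else 0)"

lemma heis_elem_mult:
  "heis_elem x y z ** heis_elem x' y' z' = heis_elem (x + x') (y + y') (z + z' + x * y')"
  by (simp add: heis_elem_def matrix_matrix_mult_def vec_eq_iff forall_3 sum_3)

lemma heis_elem_inject: "heis_elem x y z = heis_elem x' y' z' \<longleftrightarrow> x = x' \<and> y = y' \<and> z = z'"
  by (auto simp: heis_elem_def vec_eq_iff forall_3)

lemma heis_carrier: "carrier heis = {heis_elem x y z | x y z. True}"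
proof -
  have "M = heis_elem (M $ 1 $ 2) (M $ 2 $ 3) (M $ 1 $ 3)" if "M \<in> carrier heis" for M :: "'a ^ 3 ^ 3"
    using that by (simp add: heis_def heis_elem_def vec_eq_iff forall_3)
  moreover have "heis_elem x y z \<in> carrier heis" for x y z :: 'a
    by (simp add: heis_def heis_elem_def)
  ultimately show ?thesis by blast
qed

lemma heis_elem_closed [simp]: "heis_elem x y z \<in> carrier heis"
  using heis_carrier by blast

lemma heis_mult: "heis_elem x y z \<otimes>\<^bsub>heis\<^esub> heis_elem x' y' z'
    = heis_elem (x + x') (y + y') (z + z' + x * y')"
  by (simp add: heis_def heis_elem_mult)

lemma heis_one: "\<one>\<^bsub>heis\<^esub> = heis_elem 0 0 0"
  by (simp add: heis_def heis_elem_def mat_def vec_eq_iff forall_3)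

lemma heis_group: "group heis"
proof (rule groupI)
  fix x :: "'a ^ 3 ^ 3" assume "x \<in> carrier heis"
  then obtain a b c where x: "x = heis_elem a b c" by (auto simp: heis_carrier)
  have "heis_elem (- a) (- b) (a * b - c) \<otimes>\<^bsub>heis\<^esub> x = \<one>\<^bsub>heis\<^esub>"
    by (simp add: x heis_mult heis_one)
  then show "\<exists>y \<in> carrier heis. y \<otimes>\<^bsub>heis\<^esub> x = \<one>\<^bsub>heis\<^esub>" using heis_elem_closed by blast
qed (auto simp: heis_carrier heis_mult heis_one heis_elem_inject algebra_simps)

interpretation heis: group heis
  by (rule heis_group)

lemma heis_inv: "inv\<^bsub>heis\<^esub> heis_elem x y z = heis_elem (- x) (- y) (x * y - z)"
  by (rule heis.inv_equality) (simp_all add: heis_mult heis_one)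

lemma heis_elem_pow_x: "heis_elem x 0 0 [^]\<^bsub>heis\<^esub> (i::int) = heis_elem (of_int i * x) 0 0"
proof -
  have nat: "heis_elem x 0 0 [^]\<^bsub>heis\<^esub> n = heis_elem (of_nat n * x) 0 0" for n :: nat
    by (induction n) (simp_all add: heis_one heis_mult algebra_simps)
  show ?thesis by (cases i rule: int_cases2) (simp_all add: int_pow_int heis.int_pow_neg_int nat heis_inv)
qed

lemma heis_elem_pow_y: "heis_elem 0 y 0 [^]\<^bsub>heis\<^esub> (i::int) = heis_elem 0 (of_int i * y) 0"
proof -
  have nat: "heis_elem 0 y 0 [^]\<^bsub>heis\<^esub> n = heis_elem 0 (of_nat n * y) 0" for n :: nat
    by (induction n) (simp_all add: heis_one heis_mult algebra_simps)
  show ?thesis by (cases i rule: int_cases2) (simp_all add: int_pow_int heis.int_pow_neg_int nat heis_inv)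
qed

lemma heis_elem_pow_z: "heis_elem 0 0 z [^]\<^bsub>heis\<^esub> (i::int) = heis_elem 0 0 (of_int i * z)"
proof -
  have nat: "heis_elem 0 0 z [^]\<^bsub>heis\<^esub> n = heis_elem 0 0 (of_nat n * z)" for n :: nat
    by (induction n) (simp_all add: heis_one heis_mult algebra_simps)
  show ?thesis by (cases i rule: int_cases2) (simp_all add: int_pow_int heis.int_pow_neg_int nat heis_inv)
qed

lemma of_int_3_eq_0: "of_int i = (0::3) \<longleftrightarrow> 3 dvd i"
proof -
  have "(3::3) = 0" by simp
  then have three: "of_int (3 * k) = (0::3)" for k by (simp only: of_int_mult of_int_numeral mult_zero_left)
  have "of_int i = (of_int (3 * (i div 3) + i mod 3) :: 3)" by (simp only: mult_div_mod_eq)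
  then have eq: "of_int i = (of_int (i mod 3) :: 3)" by (simp only: of_int_add three add_0_left)
  have "i mod 3 = 0 \<or> i mod 3 = 1 \<or> i mod 3 = 2" by presburger
  then have "(of_int (i mod 3) :: 3) = 0 \<longleftrightarrow> i mod 3 = 0" by (elim disjE) simp_all
  then show ?thesis unfolding eq by presburger
qed

text \<open>The cube has entries \<open>3 * a\<close> and \<open>3 * b\<close> and the corner
  \<open>3 * c + 3 * (a * b)\<close>; the last coefficient is a binomial coefficient divisible by
  3.\<close>

lemma heis_3_cube: "t \<in> carrier heis \<Longrightarrow> t [^]\<^bsub>heis\<^esub> (3::nat) = (\<one>\<^bsub>heis\<^esub> :: 3 ^ 3 ^ 3)"
proof -
  have three: "x + x + x = 0" for x :: 3
  proof -
    have "x + x + x = 3 * x" by simp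
    also have "(3::3) = 0" by simp
    finally show ?thesis by simp
  qed
  assume "t \<in> carrier heis"
  then obtain a b c where "t = heis_elem a b c" by (auto simp: heis_carrier)
  then show ?thesis using three[of a] three[of b] three[of c] three[of "a * b"]
    by (simp add: numeral_3_eq_3 heis_mult heis_one heis_elem_inject algebra_simps)
qed

lemma group_exponent_eqI:
  fixes n :: nat
  assumes "n > 0" "\<And>x. x \<in> carrier H \<Longrightarrow> x [^]\<^bsub>H\<^esub> n = \<one>\<^bsub>H\<^esub>"
    and "\<And>m. m > 0 \<Longrightarrow> (\<And>x. x \<in> carrier H \<Longrightarrow> x [^]\<^bsub>H\<^esub> m = \<one>\<^bsub>H\<^esub>) \<Longrightarrow> n \<le> m"
  shows "group_exponent H = n"
proof -
  let ?P = "\<lambda>n::nat. n > 0 \<and> (\<forall>x \<in> carrier H. x [^]\<^bsub>H\<^esub> n = \<one>\<^bsub>H\<^esub>)"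
  have "?P n" using assms(1,2) by blast
  moreover have "(LEAST n. ?P n) = n"
    by (rule Least_equality) (use assms in blast)+
  ultimately show ?thesis unfolding group_exponent_def Let_def by (metis (no_types, lifting))
qed

section \<open>Exponents, power subgroups and sections of the chain\<close>

context macdonald_3group
begin

lemma M3_exponent: "group_exponent (G\<lparr>carrier := M3\<rparr>) = 9"
proof (rule group_exponent_eqI)
  fix x assume "x \<in> carrier (G\<lparr>carrier := M3\<rparr>)"
  then have x: "x \<in> M3" by simp
  have xc: "x \<in> carrier G" using x subgroup.mem_carrier[OF normal_imp_subgroup[OF normal_M3]] by blast
  have "(x [^] (3::nat)) [^] (3::nat) = \<one>" by (rule M1_cube[OF M3_cube[OF x]])
  then show "x [^]\<^bsub>G\<lparr>carrier := M3\<rparr>\<^esub> (9::nat) = \<one>\<^bsub>G\<lparr>carrier := M3\<rparr>\<^esub>"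
    using xc by (simp add: nat_pow_pow nat_pow_consistent [symmetric])
next
  fix m :: nat assume m: "m > 0"
    and all: "\<And>x. x \<in> carrier (G\<lparr>carrier := M3\<rparr>) \<Longrightarrow> x [^]\<^bsub>G\<lparr>carrier := M3\<rparr>\<^esub> m = \<one>\<^bsub>G\<lparr>carrier := M3\<rparr>\<^esub>"
  have "A [^] (9::nat) \<in> M3" unfolding M3_eq by (auto intro: generate.incl)
  then have "(A [^] (9::nat)) [^] m = \<one>" using all by (simp add: nat_pow_consistent [symmetric])
  then have "81 dvd 9 * m" by (simp add: nat_pow_pow order_A)
  then show "9 \<le> m" using m by (auto elim!: dvdE)
qed simp

lemma M3_comm_group: "comm_group (G\<lparr>carrier := M3\<rparr>)"
proof -
  have "group (G\<lparr>carrier := M3\<rparr>)"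
    by (rule subgroup.subgroup_is_group[OF normal_imp_subgroup[OF normal_M3] is_group])
  then show ?thesis by (rule group.group_comm_groupI) (simp add: M3_commute)
qed

text \<open>The hypothesis \<open>cube\<close> cannot be checked on generators, because
  \<open>A\<close> and \<open>B\<close> do not commute modulo \<open>M5\<close>; it is supplied by
  \<open>quotient_M5_heis\<close>. The rest of the descent is \<open>M5_cube\<close>.\<close>

lemma power_subgroup_9:
  assumes cube: "\<And>t. t \<in> carrier G \<Longrightarrow> t [^] (3::nat) \<in> M5"
  shows "power_subgroup G 9 = M3"
proof (rule generate_pow_set[OF normal_imp_subgroup[OF normal_M3] M3_eq[symmetric]])
  have *: "x [^] (9::nat) \<in> {t [^] (9::int) | t. t \<in> carrier G}" if "x \<in> carrier G" for x
  proof -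
    have "x [^] (9::nat) = x [^] (9::int)" using int_pow_int[of G x 9] by simp
    then show ?thesis using that by blast
  qed
  show "{A [^] (9::nat), B [^] (9::nat), C [^] (9::nat)} \<subseteq> {t [^] (9::int) | t. t \<in> carrier G}"
    using *[of A] *[of B] *[of C] by simp
  fix t assume t: "t \<in> carrier G"
  have "(t [^] (3::nat)) [^] (3::nat) \<in> M3" by (rule M5_cube[OF cube[OF t]])
  then show "t [^] (9::int) \<in> M3" using t int_pow_int[of G t 9] by (simp add: nat_pow_pow)
qed

lemma power_subgroup_3:
  assumes cube: "\<And>t. t \<in> carrier G \<Longrightarrow> t [^] (3::nat) \<in> M5"
  shows "power_subgroup G 3 = M5"
proof (rule generate_pow_set[OF normal_imp_subgroup[OF normal_M5] M5_eq[symmetric]])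
  have *: "x [^] (3::nat) \<in> {t [^] (3::int) | t. t \<in> carrier G}" if "x \<in> carrier G" for x
  proof -
    have "x [^] (3::nat) = x [^] (3::int)" using int_pow_int[of G x 3] by simp
    then show ?thesis using that by blast
  qed
  show "{A [^] (3::nat), B [^] (3::nat), C [^] (3::nat)} \<subseteq> {t [^] (3::int) | t. t \<in> carrier G}"
    using *[of A] *[of B] *[of C] by simp
  fix t assume "t \<in> carrier G"
  then show "t [^] (3::int) \<in> M5" using cube int_pow_int[of G t 3] by simp
qed

lemma pow_27_in_M1:
  assumes cube: "\<And>t. t \<in> carrier G \<Longrightarrow> t [^] (3::nat) \<in> M5" and t: "t \<in> carrier G"
  shows "t [^] (27::nat) \<in> M1"
  using M3_cube[OF M5_cube[OF cube[OF t]]] t by (simp add: nat_pow_pow)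

lemma power_subgroup_27:
  assumes cube: "\<And>t. t \<in> carrier G \<Longrightarrow> t [^] (3::nat) \<in> M5"
  shows "power_subgroup G 27 = M1"
proof (rule generate_pow_set[OF subgroup_M1 M1_eq[symmetric]])
  show "{A [^] (27::nat)} \<subseteq> {t [^] (27::int) | t. t \<in> carrier G}"
  proof -
    have "A [^] (27::nat) = A [^] (27::int)" using int_pow_int[of G A 27] by simp
    then show ?thesis using closed(1) by blast
  qed
  fix t assume "t \<in> carrier G"
  then show "t [^] (27::int) \<in> M1" using pow_27_in_M1[OF cube] int_pow_int[of G t 27] by simp
qed

lemma exponent_81:
  assumes cube: "\<And>t. t \<in> carrier G \<Longrightarrow> t [^] (3::nat) \<in> M5"
  shows "group_exponent G = 81"
proof (rule group_exponent_eqI)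
  fix x assume x: "x \<in> carrier G"
  then show "x [^] (81::nat) = \<one>"
    using M1_cube[OF pow_27_in_M1[OF cube x]] by (simp add: nat_pow_pow)
next
  fix m :: nat assume "m > 0" and "\<And>x. x \<in> carrier G \<Longrightarrow> x [^] m = \<one>"
  then show "81 \<le> m" using order_A[of m] by (simp add: dvd_imp_le)
qed simp

text \<open>On the form \<open>A [^] i \<otimes> B [^] j \<otimes> (C [^] k \<otimes> n)\<close> the
  map reads off the exponents modulo 3, so its kernel is exactly \<open>M5\<close>. Cubes die in the
  Heisenberg group modulo 3, which gives the second claim.\<close>

lemma quotient_M5_heis:
  assumes h: "h \<in> hom G (heis :: (3 ^ 3 ^ 3) monoid)"
    and hA: "h A = heis_elem 1 0 0" and hB: "h B = heis_elem 0 1 0"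
  shows "G Mod M5 \<cong> (heis :: (3 ^ 3 ^ 3) monoid)"
    and "t \<in> carrier G \<Longrightarrow> t [^] (3::nat) \<in> M5"
proof -
  interpret h: group_hom G "heis :: (3 ^ 3 ^ 3) monoid" h
    by (intro group_hom.intro group_hom_axioms.intro is_group heis_group h)
  \<comment> \<open>The relation \<open>AB\<close> forces the image of \<open>C\<close> to be the
    central unit of the corner.\<close>
  have "h B \<otimes>\<^bsub>heis\<^esub> h A \<otimes>\<^bsub>heis\<^esub> h C = h B \<otimes>\<^bsub>heis\<^esub> h A \<otimes>\<^bsub>heis\<^esub> heis_elem 0 0 1"
    using arg_cong[OF AB, of h] by (simp add: hA hB heis_mult)
  then have hC: "h C = heis_elem 0 0 1"
    by (metis closed heis.Units_eq heis.Units_l_cancel heis.m_closed h.hom_closed heis_elem_closed)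
  have cube: "h (t [^] (3::nat)) = \<one>\<^bsub>heis\<^esub>" if "t \<in> carrier G" for t
    using that heis_3_cube[of "h t"] by (simp add: h.hom_nat_pow)
  have word: "h (A [^] i \<otimes> B [^] j \<otimes> (C [^] k \<otimes> n)) =
      heis_elem (of_int i) (of_int j) (of_int k + of_int i * of_int j)"
    if "n \<in> carrier G" "h n = \<one>\<^bsub>heis\<^esub>" for i j k :: int and n
    using that by (simp add: h.hom_int_pow hA hB hC heis_elem_pow_x heis_elem_pow_y heis_elem_pow_z heis_mult
        add.commute)
  have sub5: "subgroup M5 G" by (rule normal_imp_subgroup[OF normal_M5])
  have ker1: "M5 \<subseteq> kernel G heis h"
    unfolding M5_eq by (rule generate_subgroup_incl[OF _ h.subgroup_kernel]) (auto simp: kernel_def cube)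
  have M5_one: "h n = \<one>\<^bsub>heis\<^esub>" "n \<in> carrier G" if "n \<in> M5" for n
    using ker1 that by (auto simp: kernel_def)
  have pow3: "x [^] i \<in> M5" if "x \<in> carrier G" "x [^] (3::nat) \<in> M5" "3 dvd i" for x and i :: int
  proof -
    have "\<exists>l. i = 3 * l" using that(3) by (simp only: dvd_def)
    then obtain l where "i = 3 * l" ..
    then have "x [^] i = (x [^] (3::nat)) [^] l"
      using that(1) by (simp add: int_pow_int [symmetric] int_pow_pow)
    then show ?thesis using subgroup_int_pow_closed[OF sub5 that(2)] by simp
  qed
  have gens: "A [^] (3::nat) \<in> M5" "B [^] (3::nat) \<in> M5" "C [^] (3::nat) \<in> M5"
    unfolding M5_eq by (auto intro: generate.incl)
  have ker2: "kernel G heis h \<subseteq> M5"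
  proof
    fix t assume t: "t \<in> kernel G heis h"
    then have "t \<in> carrier G" by (simp add: kernel_def)
    then obtain i j k :: int and n where n: "n \<in> M5" and t': "t = A [^] i \<otimes> B [^] j \<otimes> (C [^] k \<otimes> n)"
      using decompose by blast
    have "heis_elem (of_int i) (of_int j) (of_int k + of_int i * of_int j) = (heis_elem 0 0 0 :: 3 ^ 3 ^ 3)"
      using t word[OF M5_one(2,1)[OF n], of i j k] by (simp add: kernel_def t' heis_one)
    then have ij: "(of_int i :: 3) = 0" "(of_int j :: 3) = 0"
      and "of_int k + of_int i * of_int j = (0 :: 3)" unfolding heis_elem_inject by blast+
    then have "(of_int k :: 3) = 0" by simp
    with ij have "3 dvd i" "3 dvd j" "3 dvd k" by (simp_all only: of_int_3_eq_0)
    then show "t \<in> M5" unfolding t' using n gens by (intro subgroup.m_closed[OF sub5] pow3) simp_all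
  qed
  have ker: "kernel G heis h = M5" using ker1 ker2 by blast
  have surj: "h ` carrier G = carrier heis"
  proof
    show "h ` carrier G \<subseteq> carrier heis" by auto
    show "carrier heis \<subseteq> h ` carrier G"
    proof
      fix M :: "3 ^ 3 ^ 3" assume "M \<in> carrier heis"
      then obtain x y z where M: "M = heis_elem x y z" by (auto simp: heis_carrier)
      have "\<exists>i. u = of_int i" for u :: 3
      proof -
        have "u = of_int 1 \<or> u = of_int 2 \<or> u = of_int 3" using exhaust_3[of u] by simp
        then show ?thesis by blast
      qed
      then obtain i j k where "x = of_int i" "y = of_int j" "z - x * y = of_int k" by metis
      then have "M = h (A [^] i \<otimes> B [^] j \<otimes> (C [^] k \<otimes> \<one>))"
        using M by (subst word) (simp_all add: algebra_simps)
      then show "M \<in> h ` carrier G" by (rule image_eqI) simp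
    qed
  qed
  show "G Mod M5 \<cong> (heis :: (3 ^ 3 ^ 3) monoid)" using h.FactGroup_iso[OF surj] by (simp add: ker)
  show "t \<in> carrier G \<Longrightarrow> t [^] (3::nat) \<in> M5" using cube[of t] unfolding ker[symmetric] kernel_def by simp
qed

lemma quotient_M5_M3:
  "G\<lparr>carrier := M5\<rparr> Mod M3 \<cong>
    integer_mod_group 3 \<times>\<times> integer_mod_group 3 \<times>\<times> integer_mod_group 3"
proof -
  define Q where "Q = G Mod M3"
  define h where "h = (\<lambda>x. M3 #> x)"
  interpret h: group_hom G Q h unfolding Q_def h_def by (rule quotient_hom[OF normal_M3])
  have one: "h u = \<one>\<^bsub>Q\<^esub> \<longleftrightarrow> u \<in> M3" if "u \<in> carrier G" for u
    unfolding h_def Q_def using quotient_one_iff[OF normal_M3 that] .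
  have comm: "h x \<otimes>\<^bsub>Q\<^esub> h y = h y \<otimes>\<^bsub>Q\<^esub> h x"
    if "x \<in> {A [^] (3::nat), B [^] (3::nat), C [^] (3::nat)}" "y \<in> {A [^] (3::nat), B [^] (3::nat), C [^] (3::nat)}" for x y
  proof -
    have "x \<in> carrier G" "y \<in> carrier G" using that by auto
    then show ?thesis
      using A3B3C3_commutator[OF that] commutator_in_normal_iff[OF normal_M3, of x y] unfolding h_def Q_def by blast
  qed
  define X Y Z where "X = h (A [^] (3::nat))" and "Y = h (B [^] (3::nat))" and "Z = h (C [^] (3::nat))"
  have [simp]: "X \<in> carrier Q" "Y \<in> carrier Q" "Z \<in> carrier Q" by (simp_all add: X_def Y_def Z_def)
  have XY: "X \<otimes>\<^bsub>Q\<^esub> Y = Y \<otimes>\<^bsub>Q\<^esub> X" and XZ: "X \<otimes>\<^bsub>Q\<^esub> Z = Z \<otimes>\<^bsub>Q\<^esub> X" and YZ: "Y \<otimes>\<^bsub>Q\<^esub> Z = Z \<otimes>\<^bsub>Q\<^esub> Y"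
    using comm by (simp_all add: X_def Y_def Z_def)
  have cube: "U [^]\<^bsub>Q\<^esub> (i mod 3) = U [^]\<^bsub>Q\<^esub> i" if "U \<in> {X, Y, Z}" for U and i :: int
  proof -
    have U [simp]: "U \<in> carrier Q" using that by auto
    have "h x [^]\<^bsub>Q\<^esub> (3::nat) = \<one>\<^bsub>Q\<^esub>" if "x \<in> carrier G" "x [^] (3::nat) \<in> M3" for x
      using that one[of "x [^] (3::nat)"] by (simp add: h.hom_nat_pow)
    then have "X [^]\<^bsub>Q\<^esub> (3::nat) = \<one>\<^bsub>Q\<^esub>" "Y [^]\<^bsub>Q\<^esub> (3::nat) = \<one>\<^bsub>Q\<^esub>" "Z [^]\<^bsub>Q\<^esub> (3::nat) = \<one>\<^bsub>Q\<^esub>"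
      using cubes_in_M3 by (simp_all add: X_def Y_def Z_def)
    then have "U [^]\<^bsub>Q\<^esub> (3::nat) = \<one>\<^bsub>Q\<^esub>" using that by blast
    then have "U [^]\<^bsub>Q\<^esub> (3::int) = \<one>\<^bsub>Q\<^esub>" using int_pow_int[of Q U 3] by simp
    then have "U [^]\<^bsub>Q\<^esub> (3 * (i div 3)) = \<one>\<^bsub>Q\<^esub>"
      by (simp add: h.H.int_pow_pow [symmetric])
    moreover have "U [^]\<^bsub>Q\<^esub> i = U [^]\<^bsub>Q\<^esub> (3 * (i div 3)) \<otimes>\<^bsub>Q\<^esub> U [^]\<^bsub>Q\<^esub> (i mod 3)"
      by (simp add: h.H.int_pow_mult [symmetric])
    ultimately show ?thesis by simp
  qed
  define f where "f = (\<lambda>(i::int, j::int, k::int). X [^]\<^bsub>Q\<^esub> i \<otimes>\<^bsub>Q\<^esub> Y [^]\<^bsub>Q\<^esub> j \<otimes>\<^bsub>Q\<^esub> Z [^]\<^bsub>Q\<^esub> k)"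
  define w where "w i j k = (A [^] (3::nat)) [^] i \<otimes> (B [^] (3::nat)) [^] j \<otimes> (C [^] (3::nat)) [^] k" for i j k :: int
  have wc [simp]: "w i j k \<in> carrier G" for i j k by (simp add: w_def)
  have fw: "f (i, j, k) = h (w i j k)" for i j k
    by (simp add: f_def w_def X_def Y_def Z_def h.hom_int_pow)
  \<comment> \<open>Addition in \<open>integer_mod_group 3\<close> reduces modulo 3, so
    \<open>f\<close> must not notice the reduction.\<close>
  have fmod: "f (i mod 3, j mod 3, k mod 3) = f (i, j, k)" for i j k
    by (simp add: f_def cube)
  have fmult: "f (i, j, k) \<otimes>\<^bsub>Q\<^esub> f (i', j', k') = f (i + i', j + j', k + k')" for i j k i' j' k'
  proof -
    have ZX: "Z [^]\<^bsub>Q\<^esub> k \<otimes>\<^bsub>Q\<^esub> X [^]\<^bsub>Q\<^esub> i' = X [^]\<^bsub>Q\<^esub> i' \<otimes>\<^bsub>Q\<^esub> Z [^]\<^bsub>Q\<^esub> k"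
      by (rule h.H.commute_int_pow) (simp_all add: XZ)
    have ZY: "Z [^]\<^bsub>Q\<^esub> k \<otimes>\<^bsub>Q\<^esub> Y [^]\<^bsub>Q\<^esub> j' = Y [^]\<^bsub>Q\<^esub> j' \<otimes>\<^bsub>Q\<^esub> Z [^]\<^bsub>Q\<^esub> k"
      by (rule h.H.commute_int_pow) (simp_all add: YZ)
    have "f (i, j, k) \<otimes>\<^bsub>Q\<^esub> f (i', j', k') =
      (X [^]\<^bsub>Q\<^esub> i \<otimes>\<^bsub>Q\<^esub> Y [^]\<^bsub>Q\<^esub> j) \<otimes>\<^bsub>Q\<^esub> (Z [^]\<^bsub>Q\<^esub> k \<otimes>\<^bsub>Q\<^esub> X [^]\<^bsub>Q\<^esub> i') \<otimes>\<^bsub>Q\<^esub> Y [^]\<^bsub>Q\<^esub> j' \<otimes>\<^bsub>Q\<^esub> Z [^]\<^bsub>Q\<^esub> k'"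
      by (simp add: f_def h.H.m_assoc)
    also have "\<dots> = (X [^]\<^bsub>Q\<^esub> i \<otimes>\<^bsub>Q\<^esub> Y [^]\<^bsub>Q\<^esub> j) \<otimes>\<^bsub>Q\<^esub> X [^]\<^bsub>Q\<^esub> i' \<otimes>\<^bsub>Q\<^esub> (Z [^]\<^bsub>Q\<^esub> k \<otimes>\<^bsub>Q\<^esub> Y [^]\<^bsub>Q\<^esub> j') \<otimes>\<^bsub>Q\<^esub> Z [^]\<^bsub>Q\<^esub> k'"
      unfolding ZX by (simp add: h.H.m_assoc)
    also have "\<dots> = ((X [^]\<^bsub>Q\<^esub> i \<otimes>\<^bsub>Q\<^esub> Y [^]\<^bsub>Q\<^esub> j) \<otimes>\<^bsub>Q\<^esub> (X [^]\<^bsub>Q\<^esub> i' \<otimes>\<^bsub>Q\<^esub> Y [^]\<^bsub>Q\<^esub> j')) \<otimes>\<^bsub>Q\<^esub> (Z [^]\<^bsub>Q\<^esub> k \<otimes>\<^bsub>Q\<^esub> Z [^]\<^bsub>Q\<^esub> k')"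
      unfolding ZY by (simp add: h.H.m_assoc)
    also have "\<dots> = f (i + i', j + j', k + k')"
      by (simp add: h.H.commute_layer_mult[OF _ _ XY] h.H.int_pow_mult f_def)
    finally show ?thesis .
  qed
  let ?Z = "integer_mod_group 3 \<times>\<times> integer_mod_group 3 \<times>\<times> integer_mod_group 3"
  let ?K = "G\<lparr>carrier := M5\<rparr> Mod M3"
  \<comment> \<open>Both quotients multiply cosets of \<open>M3\<close> as sets, so the section may
    be studied inside \<open>Q\<close>.\<close>
  have Kmult: "u \<otimes>\<^bsub>?K\<^esub> v = u \<otimes>\<^bsub>Q\<^esub> v" for u v by (simp add: Q_def)
  have Kcar: "carrier ?K = h ` M5" by (simp add: carrier_FactGroup h_def)
  have sub5: "subgroup M5 G" by (rule normal_imp_subgroup[OF normal_M5])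
  have wM5: "w i j k \<in> M5" for i j k
    unfolding w_def by (intro subgroup.m_closed[OF sub5] subgroup_int_pow_closed[OF sub5])
      (auto simp: M5_eq intro: generate.incl)
  have "f \<in> iso ?Z ?K"
  proof (rule isoI)
    show "f \<in> hom ?Z ?K"
    proof (rule homI)
      fix u assume "u \<in> carrier ?Z"
      then show "f u \<in> carrier ?K" using wM5 unfolding Kcar by (cases u) (auto simp: fw)
    next
      fix u v assume "u \<in> carrier ?Z" "v \<in> carrier ?Z"
      obtain i j k i' j' k' where u: "u = (i, j, k)" and v: "v = (i', j', k')" by (metis prod_cases3)
      show "f (u \<otimes>\<^bsub>?Z\<^esub> v) = f u \<otimes>\<^bsub>?K\<^esub> f v"
        unfolding Kmult by (simp add: u v fmult fmod)
    qed
    show "bij_betw f (carrier ?Z) (carrier ?K)"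
    proof (rule bij_betw_imageI)
      show "inj_on f (carrier ?Z)"
      proof (rule inj_onI)
        fix u v assume uv: "u \<in> carrier ?Z" "v \<in> carrier ?Z" "f u = f v"
        obtain i j k i' j' k' where u: "u = (i, j, k)" and v: "v = (i', j', k')" by (metis prod_cases3)
        have "f (i - i', j - j', k - k') \<otimes>\<^bsub>Q\<^esub> f v = f u" unfolding u v fmult by simp
        moreover have "f v \<in> carrier Q" "f (i - i', j - j', k - k') \<in> carrier Q" by (simp_all add: v fw)
        ultimately have "f (i - i', j - j', k - k') = \<one>\<^bsub>Q\<^esub>" using uv(3) by simp
        then have "w (i - i') (j - j') (k - k') \<in> M3" using one by (simp add: fw)
        then have "3 dvd i - i' \<and> 3 dvd j - j' \<and> 3 dvd k - k'"
          unfolding w_def by (rule independent_mod_M3)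
        then have "i mod 3 = i' mod 3" "j mod 3 = j' mod 3" "k mod 3 = k' mod 3"
          by (simp_all add: mod_eq_dvd_iff)
        then show "u = v" using uv(1,2) by (simp add: u v carrier_integer_mod_group)
      qed
      show "f ` carrier ?Z = carrier ?K"
      proof
        show "f ` carrier ?Z \<subseteq> carrier ?K" using wM5 unfolding Kcar by (auto simp: fw)
        show "carrier ?K \<subseteq> f ` carrier ?Z"
        proof
          fix t assume "t \<in> carrier ?K"
          then obtain s where s: "s \<in> M5" "t = h s" unfolding Kcar by blast
          obtain i j k :: int and n where n: "n \<in> M3"
            "s = (A [^] (3::nat)) [^] i \<otimes> (B [^] (3::nat)) [^] j \<otimes> ((C [^] (3::nat)) [^] k \<otimes> n)"
            using M5_decompose[OF s(1)] by blast
          have nc: "n \<in> carrier G" using n(1) subgroup.mem_carrier[OF normal_imp_subgroup[OF normal_M3]] by blast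
          have "s = w i j k \<otimes> n" using nc by (simp add: n(2) w_def m_assoc)
          then have "h s = f (i, j, k)" using one[OF nc] n(1) nc by (simp add: fw)
          then have "t = f (i mod 3, j mod 3, k mod 3)" by (simp add: s(2) fmod)
          moreover have "(i mod 3, j mod 3, k mod 3) \<in> carrier ?Z" by (simp add: carrier_integer_mod_group)
          ultimately show "t \<in> f ` carrier ?Z" by blast
        qed
      qed
    qed
  qed
  then have "?Z \<cong> ?K" by (rule is_isoI)
  moreover have "group ?Z" by (intro DirProd_group group_integer_mod_group)
  ultimately show ?thesis using group.iso_sym by blast
qed

end

section \<open>Homomorphisms from the Macdonald group\<close>

text \<open>Conjugation by \<open>c\<close> takes \<open>x\<close> to \<open>x [^] a\<close>, hence
  \<open>x [^] b\<close> to \<open>x\<close>. This produces the relations with exponent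
  \<open>b\<close> that \<open>macdonald_pair\<close> requires.\<close>

lemma (in group) semiconj_inverse_exponent:
  fixes a b n :: nat
  assumes "x \<in> carrier G" "c \<in> carrier G" "x \<otimes> c = c \<otimes> x [^] a"
    and "x [^] n = \<one>" "[a * b = 1] (mod n)"
  shows "c \<otimes> x = x [^] b \<otimes> c"
proof -
  have "x [^] b \<otimes> c = c \<otimes> (x [^] a) [^] b" by (rule semiconj_pow) (use assms in simp_all)
  also have "(x [^] a) [^] b = x" using pow_cong[OF assms(1,4,5)] assms(1) by (simp add: nat_pow_pow)
  finally show ?thesis by simp
qed

lemma (in group) semiconj_inverse_exponent':
  fixes a b n :: nat
  assumes "x \<in> carrier G" "c \<in> carrier G" "c \<otimes> x = x [^] a \<otimes> c"
    and "x [^] n = \<one>" "[a * b = 1] (mod n)"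
  shows "x \<otimes> c = c \<otimes> x [^] b"
proof -
  have "(x [^] a) [^] b \<otimes> c = c \<otimes> x [^] b" by (rule semiconj_pow) (use assms in simp_all)
  moreover have "(x [^] a) [^] b = x" using pow_cong[OF assms(1,4,5)] assms(1) by (simp add: nat_pow_pow)
  ultimately show ?thesis by simp
qed

context macdonald_pair
begin

text \<open>Powers of \<open>A\<close> satisfy the relations for other exponents: \<open>[A\<^sup>r, B]\<close> is
  \<open>A\<^sup>g\<^sup>-\<^sup>r C\<^sup>r\<close> with \<open>g = gsum b r\<close>, and its first factor is central.\<close>

lemma power_relations:
  assumes r: "gsum b r = r + 27 * w"
  shows "conjugate G (A [^] r) (commutator G (A [^] r) B) = (A [^] r) [^] (a ^ r)"
    and "conjugate G B (commutator G B (A [^] r)) = B [^] (a ^ r)"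
proof -
  define z where "z = A [^] (27 * w)"
  have zc [simp]: "z \<in> carrier G" by (simp add: z_def)
  have C': "commutator G (A [^] r) B = z \<otimes> C [^] r"
    unfolding z_def by (rule commutator_A_B[OF r])
  have zA: "A [^] r \<otimes> z = z \<otimes> A [^] r" unfolding z_def by (rule commute_nat_pow) simp_all
  have zB: "z \<otimes> B [^] n = B [^] n \<otimes> z" for n :: nat
    using commute_nat_pow[OF _ _ A_pow_27_commute_B, of w n] by (simp add: z_def nat_pow_pow)
  have "A [^] r \<otimes> (z \<otimes> C [^] r) = z \<otimes> (A [^] r \<otimes> C [^] r)"
    using zA by (simp add: m_assoc [symmetric])
  also have "\<dots> = z \<otimes> C [^] r \<otimes> (A [^] r) [^] (a ^ r)"
    by (simp add: A_pow_C_pow nat_pow_pow m_assoc)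
  finally show "conjugate G (A [^] r) (commutator G (A [^] r) B) = (A [^] r) [^] (a ^ r)"
    unfolding C' conjugate_def by (simp add: m_assoc inv_solve_left')
  have "(z \<otimes> C [^] r) \<otimes> B = z \<otimes> (C [^] r \<otimes> B [^] (1::nat))" by (simp add: m_assoc)
  also have "\<dots> = z \<otimes> B [^] (a ^ r) \<otimes> C [^] r" unfolding C_pow_B_pow by (simp add: m_assoc)
  also have "\<dots> = B [^] (a ^ r) \<otimes> (z \<otimes> C [^] r)" by (simp add: zB m_assoc)
  finally have eq: "z \<otimes> C [^] r \<otimes> B = B [^] (a ^ r) \<otimes> (z \<otimes> C [^] r)" .
  have "commutator G B (A [^] r) = inv (z \<otimes> C [^] r)"
    using commutator_swap[of "A [^] r" B] by (simp only: C' closed nat_pow_closed simp_thms)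
  then have "conjugate G B (commutator G B (A [^] r)) = z \<otimes> C [^] r \<otimes> B \<otimes> inv (z \<otimes> C [^] r)"
    by (simp only: conjugate_def inv_inv m_closed zc closed nat_pow_closed)
  also have "\<dots> = B [^] (a ^ r) \<otimes> (z \<otimes> C [^] r \<otimes> inv (z \<otimes> C [^] r))"
    unfolding eq by (simp only: m_assoc closed zc nat_pow_closed m_closed inv_closed)
  finally show "conjugate G B (commutator G B (A [^] r)) = B [^] (a ^ r)" by (simp add: r_inv)
qed

end

text \<open>The map from the free group kills the relators, so its kernel contains their normal
  closure and it factors through the quotient.\<close>

lemma macdonald_universal:
  assumes H: "group H" and xy: "x \<in> carrier H" "y \<in> carrier H"
    and rel: "conjugate H x (commutator H x y) = x [^]\<^bsub>H\<^esub> \<alpha>"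
      "conjugate H y (commutator H y x) = y [^]\<^bsub>H\<^esub> \<alpha>"
  shows "\<exists>h \<in> hom (macdonald \<alpha>) H. h (mac_elem \<alpha> GenA) = x \<and> h (mac_elem \<alpha> GenB) = y"
proof -
  interpret F: group "free_group :: mac_gen word set monoid" by (rule free_group_is_group)
  have f: "case_mac_gen x y g \<in> carrier H" for g using xy by (cases g) simp_all
  obtain h where h: "h \<in> hom free_group H" "\<And>g. h (free_gen g) = case_mac_gen x y g"
    using f by (rule free_group_universal[OF H, where ?'g = mac_gen]) (rule that)
  interpret h: group_hom free_group H h
    by (intro group_hom.intro group_hom_axioms.intro free_group_is_group H h(1))
  have xy': "h (free_gen GenA) = x" "h (free_gen GenB) = y" using h(2) by simp_all
  have "mac_relators \<alpha> \<subseteq> kernel free_group H h"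
    using rel xy mac_relators_closed[of \<alpha>]
    by (auto simp: mac_relators_def Let_def kernel_def conjugate_def commutator_def xy'
        free_gen_closed h.hom_int_pow simp del: F.int_pow_neg)
  then have "normal_closure free_group (mac_relators \<alpha>) \<subseteq> kernel free_group H h"
    using h.normal_kernel unfolding normal_closure_def by blast
  from h.FactGroup_universal_kernel[OF normal_closure_normal[OF free_group_is_group mac_relators_closed] this]
  obtain g where g: "g \<in> hom (free_group Mod normal_closure free_group (mac_relators \<alpha>)) H"
    "\<And>u. u \<in> carrier free_group \<Longrightarrow> g (normal_closure free_group (mac_relators \<alpha>) #>\<^bsub>free_group\<^esub> u) = h u"
    by blast
  then show ?thesis
    by (intro bexI[of _ g]) (simp_all add: macdonald_def mac_elem_def free_gen_closed xy')
qed

lemma macdonald_relations: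
  fixes \<alpha> :: int
  defines "G \<equiv> macdonald \<alpha>" and "x \<equiv> mac_elem \<alpha> GenA" and "y \<equiv> mac_elem \<alpha> GenB"
  shows "conjugate G x (commutator G x y) = x [^]\<^bsub>G\<^esub> \<alpha>" "conjugate G y (commutator G y x) = y [^]\<^bsub>G\<^esub> \<alpha>"
proof -
  let ?F = "free_group :: mac_gen word set monoid"
  define N where "N = normal_closure ?F (mac_relators \<alpha>)"
  interpret F: group ?F by (rule free_group_is_group)
  have N: "N \<lhd> ?F" unfolding N_def
    by (rule normal_closure_normal[OF free_group_is_group mac_relators_closed])
  have sub: "mac_relators \<alpha> \<subseteq> N" unfolding N_def normal_closure_def by blast
  define h where "h = (\<lambda>u. N #>\<^bsub>?F\<^esub> u)"
  have GN: "G = ?F Mod N" by (simp add: G_def macdonald_def N_def)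
  interpret h: group_hom ?F G h unfolding GN h_def by (rule F.quotient_hom[OF N])
  have xy: "x = h (free_gen GenA)" "y = h (free_gen GenB)"
    by (simp_all add: x_def y_def mac_elem_def h_def N_def)
  have key: "h u = h v" if "u \<otimes>\<^bsub>?F\<^esub> inv\<^bsub>?F\<^esub> v \<in> N" "u \<in> carrier ?F" "v \<in> carrier ?F" for u v
  proof -
    have "h (u \<otimes>\<^bsub>?F\<^esub> inv\<^bsub>?F\<^esub> v) = \<one>\<^bsub>G\<^esub>"
      unfolding h_def GN by (subst F.quotient_one_iff[OF N]) (use that in simp_all)
    then have "h u \<otimes>\<^bsub>G\<^esub> inv\<^bsub>G\<^esub> (h v) = \<one>\<^bsub>G\<^esub>" using that by simp
    then show ?thesis using that by (metis h.H.inv_closed h.H.inv_equality h.H.inv_inv h.hom_closed)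
  qed
  let ?a = "free_gen GenA :: mac_gen word set" and ?b = "free_gen GenB :: mac_gen word set"
  have c [simp]: "?a \<in> carrier ?F" "?b \<in> carrier ?F" by (rule free_gen_closed)+
  have "conjugate ?F ?a (commutator ?F ?a ?b) \<otimes>\<^bsub>?F\<^esub> inv\<^bsub>?F\<^esub> (?a [^]\<^bsub>?F\<^esub> \<alpha>) \<in> N"
    using sub by (auto simp: mac_relators_def Let_def)
  then have "h (conjugate ?F ?a (commutator ?F ?a ?b)) = h (?a [^]\<^bsub>?F\<^esub> \<alpha>)"
    by (rule key) (simp_all add: conjugate_def)
  then show "conjugate G x (commutator G x y) = x [^]\<^bsub>G\<^esub> \<alpha>"
    by (simp add: xy conjugate_def h.hom_commutator h.hom_int_pow)
  have "conjugate ?F ?b (commutator ?F ?b ?a) \<otimes>\<^bsub>?F\<^esub> inv\<^bsub>?F\<^esub> (?b [^]\<^bsub>?F\<^esub> \<alpha>) \<in> N"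
    using sub by (auto simp: mac_relators_def Let_def)
  then have "h (conjugate ?F ?b (commutator ?F ?b ?a)) = h (?b [^]\<^bsub>?F\<^esub> \<alpha>)"
    by (rule key) (simp_all add: conjugate_def)
  then show "conjugate G y (commutator G y x) = y [^]\<^bsub>G\<^esub> \<alpha>"
    by (simp add: xy conjugate_def h.hom_commutator h.hom_int_pow)
qed

lemma macdonald_generated:
  "generate (macdonald \<alpha>) {mac_elem \<alpha> GenA, mac_elem \<alpha> GenB} = carrier (macdonald \<alpha>)"
proof -
  let ?F = "free_group :: mac_gen word set monoid"
  define N where "N = normal_closure ?F (mac_relators \<alpha>)"
  interpret F: group ?F by (rule free_group_is_group)
  have N: "N \<lhd> ?F" unfolding N_def
    by (rule normal_closure_normal[OF free_group_is_group mac_relators_closed])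
  define h where "h = (\<lambda>u. N #>\<^bsub>?F\<^esub> u)"
  have GN: "macdonald \<alpha> = ?F Mod N" by (simp add: macdonald_def N_def)
  interpret h: group_hom ?F "macdonald \<alpha>" h unfolding GN h_def by (rule F.quotient_hom[OF N])
  let ?S = "{mac_elem \<alpha> GenA, mac_elem \<alpha> GenB}"
  have sub: "subgroup (generate (macdonald \<alpha>) ?S) (macdonald \<alpha>)"
    by (rule h.H.generate_is_subgroup) (simp add: mac_elem_closed)
  have gen: "h (free_gen g) \<in> generate (macdonald \<alpha>) ?S" for g
    by (cases g) (auto simp: h_def N_def mac_elem_def intro: generate.incl)
  have letter: "h (word_class [(g, b)]) \<in> generate (macdonald \<alpha>) ?S" for g b
  proof (cases b)
    case True
    then show ?thesis using gen[of g] by (simp add: free_gen_def)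
  next
    case False
    have "word_class [(g, False)] \<otimes>\<^bsub>?F\<^esub> free_gen g = \<one>\<^bsub>?F\<^esub>"
      using word_eq_inv[of "[(g, True)]"]
      by (simp add: free_gen_def free_group_mult word_inv_def) (simp add: free_group_def word_class_eq_iff)
    from F.inv_equality[OF this free_gen_closed]
    have "word_class [(g, False)] = inv\<^bsub>?F\<^esub> (free_gen g)" by (simp add: free_group_def)
    then show ?thesis
      using False subgroup.m_inv_closed[OF sub gen[of g]] by (simp add: free_gen_closed)
  qed
  have "h (word_class u) \<in> generate (macdonald \<alpha>) ?S" for u
  proof (induction u)
    case Nil
    have "word_class [] = \<one>\<^bsub>?F\<^esub>" by (simp add: free_group_def)
    then show ?case using subgroup.one_closed[OF sub] h.hom_one by simp
  next
    case (Cons l u)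
    obtain g b where l: "l = (g, b)" by fastforce
    have cl: "word_class v \<in> carrier ?F" for v by (simp add: free_group_def)
    have "word_class (l # u) = word_class [(g, b)] \<otimes>\<^bsub>?F\<^esub> word_class u"
      by (simp add: free_group_mult l)
    then show ?case using subgroup.m_closed[OF sub letter Cons.IH] by (simp only: h.hom_mult cl)
  qed
  moreover have "carrier (macdonald \<alpha>) = h ` carrier ?F" by (simp add: GN carrier_FactGroup h_def)
  ultimately have "carrier (macdonald \<alpha>) \<subseteq> generate (macdonald \<alpha>) ?S" by (auto simp: free_group_def)
  then show ?thesis using subgroup.subset[OF sub] by blast
qed

section \<open>A permutation group for \<open>\<alpha> = -2\<close>\<close>

type_synonym table = "(int \<times> int \<times> nat) list"

text \<open>A permutation of 2187 points is stored as 27 affine maps modulo 81, one for each block.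
  Composition then takes 27 coefficient computations and can be evaluated.\<close>

definition table_app :: "table \<Rightarrow> int \<times> nat \<Rightarrow> int \<times> nat"
  where "table_app t = (\<lambda>(i, j). case t ! j of (m, n, j') \<Rightarrow> ((m * i + n) mod 81, j'))"

definition table_comp :: "table \<Rightarrow> table \<Rightarrow> table"
  where "table_comp t u =
    map (\<lambda>(m, n, j). case t ! j of (m', n', j') \<Rightarrow> (m' * m mod 81, (m' * n + n') mod 81, j')) u"

definition table_id :: table
  where "table_id = map (\<lambda>j. (1, 0, j)) [0..<27]"

definition table_ok :: "table \<Rightarrow> bool"
  where "table_ok t \<longleftrightarrow> length t = 27 \<and> (\<forall>(m, n, j) \<in> set t. j < 27)"

definition points :: "(int \<times> nat) set"
  where "points = {0..<81} \<times> {..<27}"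

definition table_perm :: "table \<Rightarrow> int \<times> nat \<Rightarrow> int \<times> nat"
  where "table_perm t = restrict (table_app t) points"

lemma table_nth_ok: "table_ok t \<Longrightarrow> j < 27 \<Longrightarrow> t ! j = (m, n, j') \<Longrightarrow> j' < 27"
  unfolding table_ok_def by (metis (no_types, lifting) case_prodD nth_mem)

lemma table_app_closed: "table_ok t \<Longrightarrow> p \<in> points \<Longrightarrow> table_app t p \<in> points"
  using table_nth_ok by (auto simp: points_def table_app_def split: prod.splits)

lemma table_app_comp:
  assumes t: "table_ok t" and u: "table_ok u" and p: "p \<in> points"
  shows "table_app (table_comp t u) p = table_app t (table_app u p)"
proof -
  obtain i j where ij: "p = (i, j)" "j < 27" using p by (auto simp: points_def)
  obtain m n j' where u': "u ! j = (m, n, j')" by (metis prod_cases3)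
  obtain m' n' j'' where t': "t ! j' = (m', n', j'')" by (metis prod_cases3)
  have "j < length u" using u ij by (simp add: table_ok_def)
  then have "table_comp t u ! j = (m' * m mod 81, (m' * n + n') mod 81, j'')"
    by (simp add: table_comp_def u' t')
  then have "table_app (table_comp t u) p = ((m' * m mod 81 * i + (m' * n + n') mod 81) mod 81, j'')"
    by (simp add: table_app_def ij)
  also have "(m' * m mod 81 * i + (m' * n + n') mod 81) mod 81 = (m' * ((m * i + n) mod 81) + n') mod 81"
  proof -
    have "[m' * m mod 81 * i + (m' * n + n') mod 81 = m' * m * i + (m' * n + n')] (mod 81)"
      by (intro cong_add cong_mult) simp_all
    then have "(m' * m mod 81 * i + (m' * n + n') mod 81) mod 81 = (m' * m * i + (m' * n + n')) mod 81"
      by (simp only: cong_def)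
    moreover have "[m' * ((m * i + n) mod 81) + n' = m' * (m * i + n) + n'] (mod 81)"
      by (intro cong_add cong_mult) simp_all
    ultimately show ?thesis by (simp add: cong_def algebra_simps)
  qed
  finally show ?thesis by (simp add: table_app_def ij u' t')
qed

lemma table_comp_ok:
  assumes t: "table_ok t" and u: "table_ok u"
  shows "table_ok (table_comp t u)"
proof -
  have "j'' < 27" if "(m, n, j) \<in> set u" "t ! j = (m', n', j'')" for m n j m' n' j''
    using table_nth_ok[OF t _ that(2)] u that(1) by (auto simp: table_ok_def)
  then show ?thesis using u by (auto simp: table_ok_def table_comp_def split: prod.splits)
qed

lemma table_id_app: "p \<in> points \<Longrightarrow> table_app table_id p = p"
  by (auto simp: points_def table_app_def table_id_def)

lemma table_perm_Bij:
  assumes t: "table_ok t" and u: "table_ok u"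
    and "table_comp t u = table_id" "table_comp u t = table_id"
  shows "table_perm t \<in> carrier (BijGroup points)"
proof -
  have "table_app t (table_app u p) = p" "table_app u (table_app t p) = p" if "p \<in> points" for p
    using table_app_comp[OF t u that] table_app_comp[OF u t that] table_id_app[OF that] assms(3,4)
    by simp_all
  then have "bij_betw (table_app t) points points"
    using table_app_closed[OF t] table_app_closed[OF u]
    by (intro bij_betw_byWitness[of _ "table_app u"]) auto
  then show ?thesis unfolding table_perm_def BijGroup_def Bij_def by simp
qed

lemma table_perm_comp:
  assumes t: "table_ok t" "table_perm t \<in> carrier (BijGroup points)"
    and u: "table_ok u" "table_perm u \<in> carrier (BijGroup points)"
  shows "table_perm (table_comp t u) = table_perm t \<otimes>\<^bsub>BijGroup points\<^esub> table_perm u"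
    and "table_perm (table_comp t u) \<in> carrier (BijGroup points)"
proof -
  have "compose points (table_perm t) (table_perm u) = table_perm (table_comp t u)"
  proof (rule ext)
    fix p
    show "compose points (table_perm t) (table_perm u) p = table_perm (table_comp t u) p"
      using t(1) u(1) by (auto simp: compose_def table_perm_def table_app_comp table_app_closed)
  qed
  then show eq: "table_perm (table_comp t u) = table_perm t \<otimes>\<^bsub>BijGroup points\<^esub> table_perm u"
    using t(2) u(2) by (simp add: BijGroup_def)
  show "table_perm (table_comp t u) \<in> carrier (BijGroup points)"
    unfolding eq using t(2) u(2) by (rule monoid.m_closed[OF group.is_monoid[OF group_BijGroup]])
qed

lemma table_perm_id: "table_perm table_id = \<one>\<^bsub>BijGroup points\<^esub>"
  by (auto simp: table_perm_def BijGroup_def table_id_app)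

text \<open>Three or four cubings reach the exponents 27 and 81.\<close>

definition table_cube :: "table \<Rightarrow> table"
  where "table_cube t = table_comp (table_comp t t) t"

text \<open>The action on the \<open>3\<^sup>7\<close> cosets \<open>B\<^sup>jA\<^sup>i\<langle>C\<rangle>\<close> for \<open>\<alpha> = -2\<close>. Since \<open>A\<^sup>2\<^sup>7B\<^sup>2\<^sup>7 = 1\<close>,
  such a coset is determined by \<open>(i - j) mod 81\<close> and \<open>j mod 27\<close>. The entry \<open>(m, n, j')\<close> at position
  \<open>j\<close> of a table sends \<open>(x, j)\<close> to \<open>(m x + n, j')\<close>.\<close>

definition table_A :: table
  where "table_A =
    [(1, 1, 0), (40, 40, 1), (79, 79, 26), (37, 19, 12), (76, 4, 4), (34, 16, 20), (73, 37, 24),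
      (31, 49, 7), (70, 34, 14), (28, 55, 9), (67, 13, 10), (25, 52, 8), (64, 73, 21), (22, 58,
      13), (61, 70, 2), (19, 10, 6), (58, 22, 16), (16, 7, 23), (55, 28, 18), (13, 67, 19), (52,
      25, 17), (10, 46, 3), (49, 31, 22), (7, 43, 11), (46, 64, 15), (4, 76, 25), (43, 61, 5)]"

definition table_A_inv :: table
  where "table_A_inv =
    [(1, 80, 0), (79, 80, 1), (4, 44, 14), (73, 44, 21), (16, 17, 4), (49, 8, 26), (64, 8, 15),
      (34, 35, 7), (13, 53, 11), (55, 53, 9), (52, 53, 10), (58, 17, 23), (46, 17, 3), (70, 71,
      13), (22, 62, 8), (37, 62, 24), (7, 8, 16), (67, 26, 20), (28, 26, 18), (25, 26, 19), (31,
      71, 5), (19, 71, 12), (43, 44, 22), (76, 35, 17), (10, 35, 6), (61, 62, 25), (40, 80, 2)]"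

definition table_B :: table
  where "table_B =
    [(1, 80, 1), (1, 80, 2), (1, 80, 3), (1, 80, 4), (1, 80, 5), (1, 80, 6), (1, 80, 7), (1, 80,
      8), (1, 80, 9), (1, 80, 10), (1, 80, 11), (1, 80, 12), (1, 80, 13), (1, 80, 14), (1, 80,
      15), (1, 80, 16), (1, 80, 17), (1, 80, 18), (1, 80, 19), (1, 80, 20), (1, 80, 21), (1, 80,
      22), (1, 80, 23), (1, 80, 24), (1, 80, 25), (1, 80, 26), (1, 80, 0)]"

definition table_B_inv :: table
  where "table_B_inv =
    [(1, 1, 26), (1, 1, 0), (1, 1, 1), (1, 1, 2), (1, 1, 3), (1, 1, 4), (1, 1, 5), (1, 1, 6),
      (1, 1, 7), (1, 1, 8), (1, 1, 9), (1, 1, 10), (1, 1, 11), (1, 1, 12), (1, 1, 13), (1, 1,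
      14), (1, 1, 15), (1, 1, 16), (1, 1, 17), (1, 1, 18), (1, 1, 19), (1, 1, 20), (1, 1, 21),
      (1, 1, 22), (1, 1, 23), (1, 1, 24), (1, 1, 25)]"

text \<open>Obtained from \<open>C B^j A^i = B^(79 j) A^(40 i) C\<close>. With
  \<open>i = x + j\<close> the new block is \<open>79 * j mod 27\<close> and the new first
  coordinate is \<open>40 * i - 79 * j\<close>, which is \<open>40 * x + 42 * j\<close> modulo
  81.\<close>

definition table_C :: table
  where "table_C =
    [(40, 0, 0), (40, 42, 25), (40, 3, 23), (40, 45, 21), (40, 6, 19), (40, 48, 17), (40, 9,
      15), (40, 51, 13), (40, 12, 11), (40, 54, 9), (40, 15, 7), (40, 57, 5), (40, 18, 3), (40,
      60, 1), (40, 21, 26), (40, 63, 24), (40, 24, 22), (40, 66, 20), (40, 27, 18), (40, 69,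
      16), (40, 30, 14), (40, 72, 12), (40, 33, 10), (40, 75, 8), (40, 36, 6), (40, 78, 4), (40,
      39, 2)]"

definition table_C_inv :: table
  where "table_C_inv =
    [(79, 0, 0), (79, 39, 13), (79, 78, 26), (79, 36, 12), (79, 75, 25), (79, 33, 11), (79, 72,
      24), (79, 30, 10), (79, 69, 23), (79, 27, 9), (79, 66, 22), (79, 24, 8), (79, 63, 21),
      (79, 21, 7), (79, 60, 20), (79, 18, 6), (79, 57, 19), (79, 15, 5), (79, 54, 18), (79, 12,
      4), (79, 51, 17), (79, 9, 3), (79, 48, 16), (79, 6, 2), (79, 45, 15), (79, 3, 1), (79, 42,
      14)]"

lemmas table_defs = table_A_def table_A_inv_def table_B_def table_B_inv_def table_C_def table_C_inv_def

lemma tables_ok: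
  "table_ok table_A" "table_ok table_A_inv" "table_ok table_B" "table_ok table_B_inv"
  "table_ok table_C" "table_ok table_C_inv"
  by (simp_all add: table_ok_def table_defs)

lemma tables_inverse:
  "table_comp table_A table_A_inv = table_id" "table_comp table_A_inv table_A = table_id"
  "table_comp table_B table_B_inv = table_id" "table_comp table_B_inv table_B = table_id"
  "table_comp table_C table_C_inv = table_id" "table_comp table_C_inv table_C = table_id"
  by code_simp+

text \<open>The last two are \<open>A C = C A^(-2)\<close> and \<open>C B = B^(-2) C\<close> with
  the negative powers moved across, so that no inverse has to be evaluated.\<close>

lemma tables_relations:
  "table_comp table_A table_B = table_comp (table_comp table_B table_A) table_C"
  "table_comp (table_comp (table_comp table_A table_C) table_A) table_A = table_C"
  "table_comp (table_comp (table_comp table_B table_B) table_C) table_B = table_C"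
  by code_simp+

lemma tables_power:
  "table_cube (table_cube (table_cube (table_cube table_A))) = table_id"
  "table_cube (table_cube (table_cube (table_cube table_B))) = table_id"
  "table_cube (table_cube (table_cube table_A)) ! 0 = (1, 27, 0)"
  by code_simp+

abbreviation "perm_group \<equiv> BijGroup points"

interpretation perm: group perm_group
  by (rule group_BijGroup)

lemma perm_closed:
  "table_perm table_A \<in> carrier perm_group" "table_perm table_B \<in> carrier perm_group"
  "table_perm table_C \<in> carrier perm_group"
  using table_perm_Bij tables_ok tables_inverse by blast+

lemma perm_cube:
  assumes "table_ok t" "table_perm t \<in> carrier perm_group"
  shows "table_ok (table_cube t) \<and> table_perm (table_cube t) = table_perm t [^]\<^bsub>perm_group\<^esub> (3::nat)
    \<and> table_perm (table_cube t) \<in> carrier perm_group"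
proof -
  have ok: "table_ok (table_comp t t)" using assms table_comp_ok by simp
  have "table_perm (table_cube t) = table_perm t \<otimes>\<^bsub>perm_group\<^esub> table_perm t \<otimes>\<^bsub>perm_group\<^esub> table_perm t"
    using assms ok table_perm_comp by (simp add: table_cube_def)
  then show ?thesis using assms table_comp_ok[OF ok assms(1)]
    by (simp add: table_cube_def numeral_3_eq_3)
qed

lemma perm_pow:
  assumes "table_ok t" "table_perm t \<in> carrier perm_group"
  shows "table_perm t [^]\<^bsub>perm_group\<^esub> (27::nat) = table_perm (table_cube (table_cube (table_cube t)))"
    and "table_perm t [^]\<^bsub>perm_group\<^esub> (81::nat) = table_perm (table_cube (table_cube (table_cube (table_cube t))))"
proof -
  note 1 = perm_cube[OF assms]
  note 2 = perm_cube[OF conjunct1[OF 1] conjunct2[OF conjunct2[OF 1]]]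
  note 3 = perm_cube[OF conjunct1[OF 2] conjunct2[OF conjunct2[OF 2]]]
  note 4 = perm_cube[OF conjunct1[OF 3] conjunct2[OF conjunct2[OF 3]]]
  show "table_perm t [^]\<^bsub>perm_group\<^esub> (27::nat) = table_perm (table_cube (table_cube (table_cube t)))"
    "table_perm t [^]\<^bsub>perm_group\<^esub> (81::nat) = table_perm (table_cube (table_cube (table_cube (table_cube t))))"
    using 1 2 3 4 assms by (simp_all add: perm.nat_pow_pow)
qed

lemma perm_A_27: "table_perm table_A [^]\<^bsub>perm_group\<^esub> (27::nat) \<noteq> \<one>\<^bsub>perm_group\<^esub>"
proof
  assume "table_perm table_A [^]\<^bsub>perm_group\<^esub> (27::nat) = \<one>\<^bsub>perm_group\<^esub>"
  then have "table_perm (table_cube (table_cube (table_cube table_A))) (0, 0) = table_perm table_id (0, 0)"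
    using perm_pow(1)[OF tables_ok(1) perm_closed(1)] table_perm_id by simp
  then show False
    by (simp add: table_perm_def points_def table_app_def tables_power table_id_def)
qed

text \<open>Here 79 represents -2 modulo 81, 40 is its inverse, and \<open>e = 4\<close> because
  both generators have trivial 81st power.\<close>

lemma perm_macdonald_pair:
  "macdonald_pair perm_group (table_perm table_A) (table_perm table_B) (table_perm table_C) 79 40 4"
proof -
  let ?A = "table_perm table_A" and ?B = "table_perm table_B" and ?C = "table_perm table_C"
  note cl [simp] = perm_closed
  have A81: "?A [^]\<^bsub>perm_group\<^esub> (81::nat) = \<one>\<^bsub>perm_group\<^esub>"
    and B81: "?B [^]\<^bsub>perm_group\<^esub> (81::nat) = \<one>\<^bsub>perm_group\<^esub>"
    using perm_pow(2)[OF tables_ok(1) perm_closed(1)] perm_pow(2)[OF tables_ok(3) perm_closed(2)]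
    by (simp_all add: tables_power table_perm_id)
  note comp = table_perm_comp table_comp_ok tables_ok
  have AB: "?A \<otimes>\<^bsub>perm_group\<^esub> ?B = ?B \<otimes>\<^bsub>perm_group\<^esub> ?A \<otimes>\<^bsub>perm_group\<^esub> ?C"
    using arg_cong[OF tables_relations(1), of table_perm] by (simp add: comp)
  have ACAA: "?A \<otimes>\<^bsub>perm_group\<^esub> ?C \<otimes>\<^bsub>perm_group\<^esub> ?A \<otimes>\<^bsub>perm_group\<^esub> ?A = ?C"
    using arg_cong[OF tables_relations(2), of table_perm] by (simp add: comp)
  have BBCB: "?B \<otimes>\<^bsub>perm_group\<^esub> ?B \<otimes>\<^bsub>perm_group\<^esub> ?C \<otimes>\<^bsub>perm_group\<^esub> ?B = ?C"
    using arg_cong[OF tables_relations(3), of table_perm] by (simp add: comp)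
  have pow79: "x \<otimes>\<^bsub>perm_group\<^esub> x \<otimes>\<^bsub>perm_group\<^esub> x [^]\<^bsub>perm_group\<^esub> (79::nat) = \<one>\<^bsub>perm_group\<^esub>
      \<and> x [^]\<^bsub>perm_group\<^esub> (79::nat) \<otimes>\<^bsub>perm_group\<^esub> (x \<otimes>\<^bsub>perm_group\<^esub> x) = \<one>\<^bsub>perm_group\<^esub>"
    if "x \<in> carrier perm_group" "x [^]\<^bsub>perm_group\<^esub> (81::nat) = \<one>\<^bsub>perm_group\<^esub>" for x
  proof -
    have "x \<otimes>\<^bsub>perm_group\<^esub> x = x [^]\<^bsub>perm_group\<^esub> (2::nat)" using that by (simp add: numeral_2_eq_2)
    then show ?thesis using that perm.nat_pow_mult[of x 2 79] perm.nat_pow_mult[of x 79 2] by simp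
  qed
  have AC: "?A \<otimes>\<^bsub>perm_group\<^esub> ?C = ?C \<otimes>\<^bsub>perm_group\<^esub> ?A [^]\<^bsub>perm_group\<^esub> (79::nat)"
  proof -
    have "?C \<otimes>\<^bsub>perm_group\<^esub> ?A [^]\<^bsub>perm_group\<^esub> (79::nat)
        = ?A \<otimes>\<^bsub>perm_group\<^esub> ?C \<otimes>\<^bsub>perm_group\<^esub> ?A \<otimes>\<^bsub>perm_group\<^esub> ?A \<otimes>\<^bsub>perm_group\<^esub> ?A [^]\<^bsub>perm_group\<^esub> (79::nat)"
      by (simp only: ACAA)
    also have "\<dots> = ?A \<otimes>\<^bsub>perm_group\<^esub> ?C \<otimes>\<^bsub>perm_group\<^esub> (?A \<otimes>\<^bsub>perm_group\<^esub> ?A \<otimes>\<^bsub>perm_group\<^esub> ?A [^]\<^bsub>perm_group\<^esub> (79::nat))"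
      by (simp only: perm.m_assoc cl perm.m_closed perm.nat_pow_closed)
    finally show ?thesis using pow79[OF cl(1) A81] by simp
  qed
  have CB: "?C \<otimes>\<^bsub>perm_group\<^esub> ?B = ?B [^]\<^bsub>perm_group\<^esub> (79::nat) \<otimes>\<^bsub>perm_group\<^esub> ?C"
  proof -
    have "?B [^]\<^bsub>perm_group\<^esub> (79::nat) \<otimes>\<^bsub>perm_group\<^esub> ?C
        = ?B [^]\<^bsub>perm_group\<^esub> (79::nat) \<otimes>\<^bsub>perm_group\<^esub> (?B \<otimes>\<^bsub>perm_group\<^esub> ?B \<otimes>\<^bsub>perm_group\<^esub> ?C \<otimes>\<^bsub>perm_group\<^esub> ?B)"
      by (simp only: BBCB)
    also have "\<dots> = (?B [^]\<^bsub>perm_group\<^esub> (79::nat) \<otimes>\<^bsub>perm_group\<^esub> (?B \<otimes>\<^bsub>perm_group\<^esub> ?B)) \<otimes>\<^bsub>perm_group\<^esub> (?C \<otimes>\<^bsub>perm_group\<^esub> ?B)"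
      by (simp only: perm.m_assoc cl perm.m_closed perm.nat_pow_closed)
    finally show ?thesis using pow79[OF cl(2) B81] by simp
  qed
  have inv: "[79 * 40 = 1] (mod (81::nat))" by (simp add: cong_def)
  show ?thesis
    by (intro macdonald_pair.intro macdonald_pair_axioms.intro group_BijGroup cl AB AC CB
        perm.semiconj_inverse_exponent[OF cl(1,3) AC A81 inv]
        perm.semiconj_inverse_exponent'[OF cl(2,3) CB B81 inv]) (simp_all add: A81 B81)
qed

text \<open>The exponents are discrete logarithms to base 79 modulo 81. All are 1 modulo 3, which
  makes them prime to 3 and forces \<open>gsum 40 r\<close> to agree with \<open>r\<close> modulo
  27.\<close>

lemma residue_7_as_power_of_79:
  assumes "(\<alpha>::int) mod 9 = 7"
  shows "\<exists>r w. gsum 40 r = r + 27 * w \<and> \<not> 3 dvd r \<and> [int (79 ^ r) = \<alpha>] (mod 81)"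
proof -
  have "\<alpha> mod 81 mod 9 = 7" using assms by (simp add: mod_mod_cancel)
  then have "\<alpha> mod 81 = 9 * (\<alpha> mod 81 div 9) + 7" by (metis mult_div_mod_eq)
  moreover have "\<alpha> mod 81 div 9 \<in> {0,1,2,3,4,5,6,7,8}"
  proof -
    have "0 \<le> \<alpha> mod 81 div 9" "\<alpha> mod 81 div 9 < 9" by (simp_all add: div_less_iff_less_mult pos_imp_zdiv_nonneg_iff)
    then show ?thesis by auto
  qed
  ultimately have "\<alpha> mod 81 \<in> {7,16,25,34,43,52,61,70,79}" by auto
  then have "\<exists>r. (\<exists>w. gsum 40 r = r + 27 * w) \<and> \<not> 3 dvd r \<and> int (79 ^ r) mod 81 = \<alpha> mod 81"
  proof (elim insertE emptyE)
    have sol: "\<exists>w. gsum 40 r = r + 27 * w" if "gsum 40 r mod 27 = r mod 27" for r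
    proof -
      have "r \<le> gsum 40 r" by (rule gsum_ge) simp
      then show ?thesis using that by (metis le_add_diff_inverse mod_eq_dvd_iff_nat dvdE)
    qed
    show ?thesis if "\<alpha> mod 81 = 7" by (rule exI[of _ 16]) (use that in \<open>simp add: sol gsum_numeral gsum_Suc2\<close>)
    show ?thesis if "\<alpha> mod 81 = 16" by (rule exI[of _ 4]) (use that in \<open>simp add: sol gsum_numeral gsum_Suc2\<close>)
    show ?thesis if "\<alpha> mod 81 = 25" by (rule exI[of _ 19]) (use that in \<open>simp add: sol gsum_numeral gsum_Suc2\<close>)
    show ?thesis if "\<alpha> mod 81 = 34" by (rule exI[of _ 7]) (use that in \<open>simp add: sol gsum_numeral gsum_Suc2\<close>)
    show ?thesis if "\<alpha> mod 81 = 43" by (rule exI[of _ 22]) (use that in \<open>simp add: sol gsum_numeral gsum_Suc2\<close>)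
    show ?thesis if "\<alpha> mod 81 = 52" by (rule exI[of _ 10]) (use that in \<open>simp add: sol gsum_numeral gsum_Suc2\<close>)
    show ?thesis if "\<alpha> mod 81 = 61" by (rule exI[of _ 25]) (use that in \<open>simp add: sol gsum_numeral gsum_Suc2\<close>)
    show ?thesis if "\<alpha> mod 81 = 70" by (rule exI[of _ 13]) (use that in \<open>simp add: sol gsum_numeral gsum_Suc2\<close>)
    show ?thesis if "\<alpha> mod 81 = 79" by (rule exI[of _ 1]) (use that in \<open>simp add: sol gsum_Suc2\<close>)
  qed
  then show ?thesis unfolding cong_def by blast
qed

lemma (in group) int_pow_cong:
  fixes i j :: int and n :: nat
  assumes "x \<in> carrier G" "x [^] n = \<one>" "[i = j] (mod int n)"
  shows "x [^] i = x [^] j"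
proof -
  obtain k where k: "i = j + int n * k"
    using assms(3) by (metis cong_iff_lin cong_sym)
  have "x [^] (int n * k) = \<one>" using assms(1,2) by (simp add: int_pow_pow [symmetric] int_pow_int)
  then show ?thesis using assms(1) by (simp add: k int_pow_mult)
qed

text \<open>By \<open>power_relations\<close> the elements \<open>A^r\<close> and \<open>B\<close>
  of the permutation group satisfy the relations for \<open>79 ^ r\<close>, and these depend on the
  exponent only modulo 81.\<close>

lemma macdonald_hom_perm:
  assumes "\<alpha> mod 9 = 7"
  shows "\<exists>h \<in> hom (macdonald \<alpha>) perm_group. \<exists>r. \<not> 3 dvd r \<and>
    h (mac_elem \<alpha> GenA) = table_perm table_A [^]\<^bsub>perm_group\<^esub> (r::nat)"
proof -
  let ?A = "table_perm table_A" and ?B = "table_perm table_B"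
  interpret P: macdonald_pair perm_group ?A ?B "table_perm table_C" 79 40 4
    by (rule perm_macdonald_pair)
  obtain r w where r: "gsum 40 r = r + 27 * w" "\<not> 3 dvd r" and ra: "[int (79 ^ r) = \<alpha>] (mod 81)"
    using residue_7_as_power_of_79[OF assms] by blast
  have pow: "x [^]\<^bsub>perm_group\<^esub> ((79::nat) ^ r) = x [^]\<^bsub>perm_group\<^esub> \<alpha>"
    if "x \<in> carrier perm_group" "x [^]\<^bsub>perm_group\<^esub> (81::nat) = \<one>\<^bsub>perm_group\<^esub>" for x
    using perm.int_pow_cong[OF that, of "int (79 ^ r)" \<alpha>] ra int_pow_int[of perm_group x "79 ^ r"]
    by simp
  have Ar: "(?A [^]\<^bsub>perm_group\<^esub> r) [^]\<^bsub>perm_group\<^esub> (81::nat) = \<one>\<^bsub>perm_group\<^esub>"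
    using P.A_pow_81 by (simp add: perm.nat_pow_pow mult.commute[of r]) (simp add: perm.nat_pow_pow [symmetric])
  have "\<exists>h \<in> hom (macdonald \<alpha>) perm_group. h (mac_elem \<alpha> GenA) = ?A [^]\<^bsub>perm_group\<^esub> r
      \<and> h (mac_elem \<alpha> GenB) = ?B"
    using P.power_relations[OF r(1)] pow[OF _ Ar] pow[OF _ P.B_pow_81]
    by (intro macdonald_universal group_BijGroup) simp_all
  then show ?thesis using r(2) by blast
qed

lemma (in group_hom) card_kernel_mult:
  assumes "h ` carrier G = carrier H"
  shows "card (carrier H) * card (kernel G H h) = order G"
proof -
  have "card (rcosets (kernel G H h)) = card (carrier H)"
    using FactGroup_iso_set[OF assms] by (auto simp: iso_def FactGroup_def bij_betw_same_card)
  then show ?thesis using G.lagrange[OF subgroup_kernel] by simp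
qed

section \<open>Transfer to the Sylow subgroup\<close>

theorem proposition9p3:
  fixes \<alpha> :: int
    and J :: "mac_gen word set set set"
    and \<pi> :: "mac_gen word set set \<Rightarrow> mac_gen word set set"
    and T :: "mac_gen word set set monoid"
    and A B C :: "mac_gen word set set"
  assumes "\<alpha> \<notin> {0, 1, 2}"
    and "multiplicity 3 (\<alpha> - 1) = 1"
    and "[(\<alpha> - 1) div 3 = -1] (mod 3)"
    and "sylow_subgroup (macdonald \<alpha>) 3 J"
    and "sylow_projection (macdonald \<alpha>) 3 J \<pi>"
    and "T = (macdonald \<alpha>)\<lparr>carrier := J\<rparr>"
    and "A = \<pi> (mac_elem \<alpha> GenA)"
    and "B = \<pi> (mac_elem \<alpha> GenB)"
    and "C = commutator T A B"
  shows
    "(upper_central T 5 = generate T {A [^]\<^bsub>T\<^esub> (3::nat), B [^]\<^bsub>T\<^esub> (3::nat), C [^]\<^bsub>T\<^esub> (3::nat)} \<and>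
      upper_central T 5 = power_subgroup T 3 \<and>
      T Mod upper_central T 5 \<cong> (heis :: (3 ^ 3 ^ 3) monoid))
     \<and>
     (upper_central T 3 = generate T {A [^]\<^bsub>T\<^esub> (9::nat), B [^]\<^bsub>T\<^esub> (9::nat), C [^]\<^bsub>T\<^esub> (9::nat)} \<and>
      upper_central T 3 = power_subgroup T 9 \<and>
      comm_group (T\<lparr>carrier := upper_central T 3\<rparr>) \<and>
      group_exponent (T\<lparr>carrier := upper_central T 3\<rparr>) = 9 \<and>
      T\<lparr>carrier := upper_central T 5\<rparr> Mod upper_central T 3
        \<cong> integer_mod_group 3 \<times>\<times> integer_mod_group 3 \<times>\<times> integer_mod_group 3)
     \<and>
     (center T = generate T {A [^]\<^bsub>T\<^esub> (27::nat)} \<and>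
      center T = power_subgroup T 27 \<and>
      group_exponent T = 81)"
proof -
  define G where "G = macdonald \<alpha>"
  define x y where "x = mac_elem \<alpha> GenA" and "y = mac_elem \<alpha> GenB"
  interpret G: group G unfolding G_def by (rule macdonald_group)
  have xy [simp]: "x \<in> carrier G" "y \<in> carrier G" by (simp_all add: x_def y_def G_def mac_elem_closed)
  have \<alpha>9: "\<alpha> mod 9 = 7"
  proof -
    have "3 dvd \<alpha> - 1" using assms(2) not_dvd_imp_multiplicity_0[of 3 "\<alpha> - 1"] by fastforce
    then show ?thesis using assms(3) unfolding cong_def by presburger
  qed
  have J: "subgroup J G" using assms(4) by (simp add: sylow_subgroup_def G_def)
  obtain n m where nm: "order G = 3 ^ n * m" "\<not> 3 dvd m" "card J = 3 ^ n"
    using assms(4) by (auto simp: sylow_subgroup_def G_def)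
  have T: "T = G\<lparr>carrier := J\<rparr>" using assms(6) by (simp add: G_def)
  interpret T: group T unfolding T by (rule subgroup.subgroup_is_group[OF J G.is_group])
  have \<pi>: "\<pi> \<in> hom G T" "\<And>u. u \<in> J \<Longrightarrow> \<pi> u = u"
    using assms(5) by (simp_all add: sylow_projection_def G_def T)
  interpret \<pi>: group_hom G T \<pi> by (intro group_hom.intro group_hom_axioms.intro G.is_group T.is_group \<pi>(1))
  have img: "A = \<pi> x" "B = \<pi> y" by (simp_all add: assms(7,8) x_def y_def)
  have cT: "carrier T = J" by (simp add: T)
  have JG: "J \<subseteq> carrier G" using J by (rule subgroup.subset)
  have [simp]: "A \<in> carrier T" "B \<in> carrier T" "C \<in> carrier T"
    by (simp_all add: img assms(9))

  have surj: "\<pi> ` carrier G = carrier T"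
  proof
    show "\<pi> ` carrier G \<subseteq> carrier T" using \<pi>.hom_closed by blast
    show "carrier T \<subseteq> \<pi> ` carrier G"
    proof
      fix u assume "u \<in> carrier T"
      then have u: "u \<in> J" by (simp only: cT)
      show "u \<in> \<pi> ` carrier G" by (rule image_eqI[where x = u]) (use \<pi>(2)[OF u] u JG in auto)
    qed
  qed
  \<comment> \<open>The image of \<open>\<pi>\<close> has order \<open>3 ^ n\<close>, so its kernel
    has order \<open>m\<close>, which is prime to 3.\<close>
  have ker: "k [^]\<^bsub>G\<^esub> m = \<one>\<^bsub>G\<^esub>" if "k \<in> kernel G T \<pi>" for k
  proof -
    have "3 ^ n * card (kernel G T \<pi>) = 3 ^ n * m"
      using \<pi>.card_kernel_mult[OF surj] nm by (simp add: cT)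
    then have "card (kernel G T \<pi>) = m" by simp
    moreover have sub: "subgroup (kernel G T \<pi>) G" by (rule \<pi>.subgroup_kernel)
    ultimately have "k [^]\<^bsub>G\<lparr>carrier := kernel G T \<pi>\<rparr>\<^esub> m = \<one>\<^bsub>G\<^esub>"
      using group.pow_order_eq_1[OF subgroup.subgroup_is_group[OF sub G.is_group], of k] that
      by (simp add: order_def)
    then show ?thesis by (simp add: G.nat_pow_consistent [symmetric])
  qed
  have T_order: "u [^]\<^bsub>T\<^esub> ((3::nat) ^ n) = \<one>\<^bsub>T\<^esub>" if "u \<in> carrier T" for u
    using T.pow_order_eq_1[OF that] nm(3) by (simp add: order_def cT)

  \<comment> \<open>The modulus must annihilate \<open>T\<close> and be divisible by 81, even when
    \<open>n\<close> is smaller than 4; hence the summand 4. Then \<open>b\<close> inverts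
    \<open>a\<close> both on \<open>T\<close> and modulo 81.\<close>
  define M where "M = (3::nat) ^ (n + 4)"
  have T_M: "u [^]\<^bsub>T\<^esub> M = \<one>\<^bsub>T\<^esub>" if "u \<in> carrier T" for u
    using T_order[OF that] that by (simp add: M_def power_add T.nat_pow_pow [symmetric])
  define a where "a = nat (\<alpha> mod int M)"
  have a: "int a = \<alpha> mod int M" by (simp add: a_def M_def)
  have "int 9 dvd int M" unfolding of_nat_dvd_iff M_def by (simp add: power_add)
  then have "int a mod 9 = 7" using \<alpha>9 a by (simp add: mod_mod_cancel)
  then have a9: "a mod 9 = 7" by presburger
  then have "\<not> 3 dvd a" by presburger
  then have "coprime a M" unfolding M_def by (rule coprime_3_power)
  then obtain b where b: "[a * b = 1] (mod M)" using cong_solve_coprime_nat[of a M] by auto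
  have "81 dvd M" by (simp add: M_def power_add)
  then have ab: "(a * b) mod 81 = 1" using cong_dvd_modulus_nat[OF b] by (simp add: cong_def)
  have pow_a: "u [^]\<^bsub>T\<^esub> \<alpha> = u [^]\<^bsub>T\<^esub> a" if "u \<in> carrier T" for u
    using T.int_pow_cong[OF that T_M[OF that], of \<alpha> "int a"] int_pow_int[of T u a] a by (simp add: cong_def)

  note rel = macdonald_relations[of \<alpha>, folded G_def x_def y_def]
  have relA: "conjugate T A (commutator T A B) = A [^]\<^bsub>T\<^esub> a"
    using arg_cong[OF rel(1), of \<pi>] pow_a[of A]
    by (simp add: conjugate_def \<pi>.hom_commutator \<pi>.hom_int_pow img)
  have relB: "conjugate T B (commutator T B A) = B [^]\<^bsub>T\<^esub> a"
    using arg_cong[OF rel(2), of \<pi>] pow_a[of B]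
    by (simp add: conjugate_def \<pi>.hom_commutator \<pi>.hom_int_pow img)
  have AC: "A \<otimes>\<^bsub>T\<^esub> C = C \<otimes>\<^bsub>T\<^esub> A [^]\<^bsub>T\<^esub> a"
    using relA unfolding conjugate_def assms(9) [symmetric] by (simp add: T.m_assoc T.inv_solve_left')
  have "commutator T B A = inv\<^bsub>T\<^esub> C" unfolding assms(9) by (rule T.commutator_swap) simp_all
  then have "C \<otimes>\<^bsub>T\<^esub> B \<otimes>\<^bsub>T\<^esub> inv\<^bsub>T\<^esub> C = B [^]\<^bsub>T\<^esub> a" using relB by (simp add: conjugate_def)
  then have CB: "C \<otimes>\<^bsub>T\<^esub> B = B [^]\<^bsub>T\<^esub> a \<otimes>\<^bsub>T\<^esub> C" by (simp add: T.inv_solve_right')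
  have ABC: "A \<otimes>\<^bsub>T\<^esub> B = B \<otimes>\<^bsub>T\<^esub> A \<otimes>\<^bsub>T\<^esub> C" unfolding assms(9) by (rule T.swap_commutator) simp_all

  have gen: "generate T {A, B} = carrier T"
  proof -
    have "\<pi> ` generate G {x, y} = generate T (\<pi> ` {x, y})" by (rule \<pi>.generate_img [symmetric]) simp
    then have "generate T {A, B} = \<pi> ` carrier G"
      using macdonald_generated[of \<alpha>] by (simp add: img G_def x_def y_def)
    then show ?thesis by (simp only: surj)
  qed

  \<comment> \<open>As \<open>\<pi>\<close> is the identity on \<open>J\<close>, it is idempotent,
    and \<open>u\<close> differs from its projection by a kernel element.\<close>
  have in_ker: "inv\<^bsub>G\<^esub> (\<pi> u) \<otimes>\<^bsub>G\<^esub> u \<in> kernel G T \<pi>" "\<pi> u \<in> carrier G" if "u \<in> carrier G" for u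
  proof -
    have J': "\<pi> u \<in> J" using \<pi>.hom_closed[OF that] cT by simp
    then show c: "\<pi> u \<in> carrier G" using JG by blast
    have "\<pi> (inv\<^bsub>G\<^esub> (\<pi> u) \<otimes>\<^bsub>G\<^esub> u) = inv\<^bsub>T\<^esub> (\<pi> u) \<otimes>\<^bsub>T\<^esub> \<pi> u"
      using c that \<pi>(2)[OF J'] by simp
    also have "\<dots> = \<one>\<^bsub>T\<^esub>" using that by simp
    finally show "inv\<^bsub>G\<^esub> (\<pi> u) \<otimes>\<^bsub>G\<^esub> u \<in> kernel G T \<pi>" using c that by (simp add: kernel_def)
  qed

  \<comment> \<open>If this failed, \<open>x [^] 27\<close> would lie in the kernel and have trivial
    \<open>m\<close>-th power. Its image in the permutation group would make the power
    \<open>27 * (r * m)\<close> of the first generator trivial, although \<open>r * m\<close> is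
    prime to 3.\<close>
  have A27: "A [^]\<^bsub>T\<^esub> (27::nat) \<noteq> \<one>\<^bsub>T\<^esub>"
  proof
    assume "A [^]\<^bsub>T\<^esub> (27::nat) = \<one>\<^bsub>T\<^esub>"
    then have "x [^]\<^bsub>G\<^esub> (27::nat) \<in> kernel G T \<pi>" by (simp add: kernel_def img \<pi>.hom_nat_pow)
    then have xm: "(x [^]\<^bsub>G\<^esub> (27::nat)) [^]\<^bsub>G\<^esub> m = \<one>\<^bsub>G\<^esub>" by (rule ker)
    obtain h r where h: "h \<in> hom G perm_group" and r: "\<not> 3 dvd r"
      and hx: "h x = table_perm table_A [^]\<^bsub>perm_group\<^esub> (r::nat)"
      using macdonald_hom_perm[OF \<alpha>9] unfolding G_def x_def by blast
    interpret h: group_hom G perm_group h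
      by (intro group_hom.intro group_hom_axioms.intro G.is_group group_BijGroup h)
    interpret P: macdonald_pair perm_group "table_perm table_A" "table_perm table_B" "table_perm table_C" 79 40 4
      by (rule perm_macdonald_pair)
    have "(h x [^]\<^bsub>perm_group\<^esub> (27::nat)) [^]\<^bsub>perm_group\<^esub> m = h ((x [^]\<^bsub>G\<^esub> (27::nat)) [^]\<^bsub>G\<^esub> m)"
      by (simp add: h.hom_nat_pow)
    then have "table_perm table_A [^]\<^bsub>perm_group\<^esub> (27 * (r * m)) = \<one>\<^bsub>perm_group\<^esub>"
      by (simp add: xm hx perm.nat_pow_pow ac_simps)
    moreover have "coprime (r * m) (3 ^ 4)"
      using coprime_3_power[OF r, of 4] coprime_3_power[OF nm(2), of 4] by (simp only: coprime_mult_left_iff)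
    ultimately have "table_perm table_A [^]\<^bsub>perm_group\<^esub> (27::nat) = \<one>\<^bsub>perm_group\<^esub>"
      using perm.pow_coprime_cancel[OF perm_closed(1)] P.A_pow by blast
    then show False using perm_A_27 by simp
  qed

  interpret macdonald_3group T A B C a b n
  proof (intro macdonald_3group.intro macdonald_pair.intro macdonald_pair_axioms.intro
      macdonald_3group_axioms.intro T.is_group)
    show "C \<otimes>\<^bsub>T\<^esub> A = A [^]\<^bsub>T\<^esub> b \<otimes>\<^bsub>T\<^esub> C"
      by (rule T.semiconj_inverse_exponent[OF _ _ AC T_M b]) simp_all
    show "B \<otimes>\<^bsub>T\<^esub> C = C \<otimes>\<^bsub>T\<^esub> B [^]\<^bsub>T\<^esub> b"
      by (rule T.semiconj_inverse_exponent'[OF _ _ CB T_M b]) simp_all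
  qed (simp_all add: ABC AC CB a9 ab T_order gen A27)

  \<comment> \<open>The commutator of the two matrices is central, so the relations reduce to
    \<open>g = g^\<alpha>\<close> for the two matrices \<open>g\<close>. They hold because
    \<open>\<alpha>\<close> is 1 modulo 3.\<close>
  have "\<exists>h \<in> hom (macdonald \<alpha>) (heis :: (3 ^ 3 ^ 3) monoid).
      h (mac_elem \<alpha> GenA) = heis_elem 1 0 0 \<and> h (mac_elem \<alpha> GenB) = heis_elem 0 1 0"
  proof (rule macdonald_universal[OF heis_group])
    have "3 dvd \<alpha> - 1" using \<alpha>9 by presburger
    then have one: "of_int \<alpha> = (1::3)" using of_int_3_eq_0[of "\<alpha> - 1"] by simp
    show "conjugate heis (heis_elem 1 0 0) (commutator heis (heis_elem 1 0 0) (heis_elem 0 1 0))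
        = heis_elem 1 0 (0::3) [^]\<^bsub>heis\<^esub> \<alpha>"
      by (simp add: conjugate_def commutator_def heis_inv heis_mult heis_elem_pow_x one)
    show "conjugate heis (heis_elem 0 1 0) (commutator heis (heis_elem 0 1 0) (heis_elem 1 0 0))
        = heis_elem 0 1 (0::3) [^]\<^bsub>heis\<^esub> \<alpha>"
      by (simp add: conjugate_def commutator_def heis_inv heis_mult heis_elem_pow_y one)
  qed simp_all
  then obtain h where h: "h \<in> hom G (heis :: (3 ^ 3 ^ 3) monoid)" "h x = heis_elem 1 0 0" "h y = heis_elem 0 1 0"
    unfolding G_def x_def y_def by blast
  interpret h: group_hom G "heis :: (3 ^ 3 ^ 3) monoid" h
    by (intro group_hom.intro group_hom_axioms.intro G.is_group heis_group h)
  \<comment> \<open>The quotient of \<open>u\<close> by its projection is annihilated by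
    \<open>m\<close>, and its image by 3 as well, so that image is trivial. Hence the restriction of
    \<open>h\<close> to \<open>J\<close> takes the prescribed values on \<open>A\<close> and
    \<open>B\<close>.\<close>
  have h\<pi>: "h (\<pi> u) = h u" if u: "u \<in> carrier G" for u
  proof -
    define k where "k = inv\<^bsub>G\<^esub> (\<pi> u) \<otimes>\<^bsub>G\<^esub> u"
    have kc [simp]: "k \<in> carrier G" using u in_ker(2)[OF u] by (simp add: k_def)
    have "h k [^]\<^bsub>heis\<^esub> m = \<one>\<^bsub>heis\<^esub>"
      using ker[OF in_ker(1)[OF u]] kc by (simp add: h.hom_nat_pow [symmetric] k_def)
    then have "h k [^]\<^bsub>heis\<^esub> (1 * m) = \<one>\<^bsub>heis\<^esub>" by simp
    moreover have "coprime m 3" using coprime_3_power[OF nm(2), of 1] by simp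
    ultimately have "h k [^]\<^bsub>heis\<^esub> (1::nat) = \<one>\<^bsub>heis\<^esub>"
      using heis.pow_coprime_cancel[of "h k" 1 m 3] heis_3_cube[of "h k"] by simp
    then have "h k = \<one>\<^bsub>heis\<^esub>" by simp
    moreover have "u = \<pi> u \<otimes>\<^bsub>G\<^esub> k" using u in_ker(2)[OF u] by (simp add: k_def G.m_assoc [symmetric])
    ultimately show ?thesis using in_ker(2)[OF u] kc by (metis h.hom_mult h.hom_closed heis.r_one)
  qed
  have hT: "h \<in> hom T heis" using h(1) subsetD[OF JG] unfolding hom_def T by auto
  have hA: "h A = heis_elem 1 0 0" and hB: "h B = heis_elem 0 1 0" using h h\<pi> by (simp_all add: img)
  note Q = quotient_M5_heis[OF hT hA hB]

  have Z: "upper_central T 5 = M5" "upper_central T 3 = M3"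
    using upper_central_chain[of 5] upper_central_chain[of 3] by simp_all
  show ?thesis unfolding Z center_eq
    using M5_eq power_subgroup_3[OF Q(2)] Q(1) M3_eq power_subgroup_9[OF Q(2)] M3_comm_group
      M3_exponent quotient_M5_M3 M1_eq power_subgroup_27[OF Q(2)] exponent_81[OF Q(2)]
    by simp
qed

end
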